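(* Let $A>0$ and $R\ge1$. Assume $n\ge\exp(2(A/R)^2)$ and $\frac{n}{\log^2(n)}\ge 2R^2/27$. Let $K=\lceil 2R^4\log^2(n)/27\rceil$ and let $\hat P$ be a $\rho$-estimator on $\mathscr G_{K,\delta}$ with $\delta=1$ if $K=1$ and $\delta=\frac{KV}{n(K-1)}\wedge\frac1K$ if $K\ge2$. Assume that the observations are i.i.d. with distribution $P^*$, i.e. $\mathbf P^*=(P^* )^{\otimes n}$. There exists a numeric constant $C>0$ such that for all $\xi>0$, with probability at least $1-e^{-\xi}$, $$C\,h^2(P^*,\hat P)\le h^2(P^*,\mathscr C(A,R))+\frac{R^4\log^3(n)+\xi}{n}.$$
   Context: $X_1,\dots,X_n$ are real random variables, $\mathbf X=(X_1,\dots,X_n)$ has distribution $\mathbf P^*$. $h^2(Q,Q')=\frac12\int(\sqrt{dQ/d\nu}-\sqrt{dQ'/d\nu})^2d\nu$ is the squared Hellinger distance and $h^2(P,\mathscr A)=\inf_{Q\in\mathscr A}h^2(P,Q)$. $\phi_\sigma(x)=\frac1{\sqrt{2\pi\sigma^2}}e^{-x^2/(2\sigma^2)}$. For a probability distribution $H$ on $\mathbb R\times(0,\infty)$, $p_H(x)=\int\phi_\sigma(x-z)\,dH(z,\sigma)$. $\mathcal C(A,R)=\{p_H:\exists l\in\mathbb R,\exists s>0,\ \mathrm{supp}(H)\subset[l-sA,l+sA]\times[s,sR]\}$ and $\mathscr C(A,R)$ is the associated set of distributions (densities with respect to Lebesgue measure). $\mathcal G=\{x\mapsto\phi_\sigma(x-z):z\in\mathbb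 R,\sigma>0\}$; $V$ is the VC-index of $\mathcal G$ (the smallest integer $m\ge1$ such that no $m$-point set is shattered by the subgraphs $\{(x,t):t<f(x)\}$, $f\in\mathcal G$). With $\mathcal W_K=\{w\in[0,1]^K:\sum_kw_k=1\}$, $\mathscr G_{K,\delta}$ is the set of distributions $\sum_{k=1}^Kw_kF_k$ with $w\in\mathcal W_K$, $w_k\ge\delta$, $w_k\in\mathbb Q$, $F_k\in\mathscr F$, where $\mathscr F$ is a fixed at most countable, Hellinger-dense subset of the set of Gaussian distributions $\{\mathcal N(z,\sigma^2)\}$; $\mathcal G_{K,\delta}$ is the corresponding set of Lebesgue densities. $\rho$-estimator. Let $\psi(x)=\frac{x-1}{x+1}$ on $[0,+\infty]$ ($\psi(+\infty)=1$), $\mathbf T(\mathbf X,q,q')=\sum_{i=1}^n\psi\big(\sqrt{q'(X_i)/q(X_i)}\big)$ (with $0/0=1$, $a/0=+\infty$ for $a>0$) and $\mathbf\Upsilon(\mathbf X,q)=\sup_{q'\in\mathcal G_{K,\delta}}\mathbf T(\mathbf X,q,q')$. A $\rho$-estimator on $\mathscr G_{K,\delta}$ is any measurable element of the Hellinger closure of the set of distributions with density $q\in\mathcal G_{K,\delta}$ such that $\mathbf\Upsilon(\mathbf X,q)<\inf_{q'\in\mathcal G_{K,\delta}}\mathbf\Upsilon(\mathbf X,q')+8.24$. *)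

theory Defs
  imports "HOL-Probability.Probability"
begin

definition plus_measure :: "'a measure \<Rightarrow> 'a measure \<Rightarrow> 'a measure" where
  "plus_measure P Q = measure_of (space P) (sets P) (\<lambda>B. emeasure P B + emeasure Q B)"

text \<open>
  The dominating measure is chosen to be \<open>P + Q\<close>; the lemma \<open>hellinger_sq_density\<close> below
  shows that any other sigma-finite dominating measure gives the same value.
\<close>

definition hellinger_sq :: "'a measure \<Rightarrow> 'a measure \<Rightarrow> real" where
  "hellinger_sq P Q =
     (let \<nu> = plus_measure P Q in
      1 / 2 * (\<integral>x. (sqrt (enn2real (RN_deriv \<nu> P x)) - sqrt (enn2real (RN_deriv \<nu> Q x)))\<^sup>2 \<partial>\<nu>))"

definition hellinger :: "'a measure \<Rightarrow> 'a measure \<Rightarrow> real" where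
  "hellinger P Q = sqrt (hellinger_sq P Q)"

definition hellinger_sq_set :: "'a measure \<Rightarrow> 'a measure set \<Rightarrow> real" where
  "hellinger_sq_set P \<A> = (INF Q\<in>\<A>. hellinger_sq P Q)"

lemma space_plus_measure [simp]: "space (plus_measure P Q) = space P"
  and sets_plus_measure [simp]: "sets (plus_measure P Q) = sets P"
  by (simp_all add: plus_measure_def)

lemma emeasure_plus_measure:
  assumes "sets P = sets Q" "B \<in> sets P"
  shows "emeasure (plus_measure P Q) B = emeasure P B + emeasure Q B"
proof (rule emeasure_measure_of[OF plus_measure_def])
  show "countably_additive (sets (plus_measure P Q)) (\<lambda>B. emeasure P B + emeasure Q B)"
  proof (rule countably_additiveI)
    fix S :: "nat \<Rightarrow> 'a set"
    assume S: "range S \<subseteq> sets (plus_measure P Q)" "disjoint_family S"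
    then have "range S \<subseteq> sets P" "range S \<subseteq> sets Q"
      using assms by auto
    then show "(\<Sum>i. emeasure P (S i) + emeasure Q (S i)) =
               emeasure P (\<Union> (range S)) + emeasure Q (\<Union> (range S))"
      using S(2) by (simp add: suminf_add[symmetric] suminf_emeasure)
  qed
qed (use assms sets.space_closed in \<open>auto simp: positive_def\<close>)

lemma hellinger_sq_density:
  fixes p q :: "'a \<Rightarrow> real"
  assumes [measurable]: "p \<in> borel_measurable \<nu>" "q \<in> borel_measurable \<nu>"
    and nonneg: "\<And>x. p x \<ge> 0" "\<And>x. q x \<ge> 0"
    and prob: "prob_space (density \<nu> p)" "prob_space (density \<nu> q)"
  shows "hellinger_sq (density \<nu> p) (density \<nu> q) =
           1 / 2 * (\<integral>x. (sqrt (p x) - sqrt (q x))\<^sup>2 \<partial>\<nu>)"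
proof -
  define s where "s = (\<lambda>x. p x + q x)"
  have [measurable]: "s \<in> borel_measurable \<nu>"
    unfolding s_def by measurable
  have s: "s x \<ge> 0" for x
    by (simp add: s_def nonneg)
  let ?P = "density \<nu> p" and ?Q = "density \<nu> q" and ?\<mu> = "density \<nu> s"
  have mu: "plus_measure ?P ?Q = ?\<mu>"
  proof (rule measure_eqI)
    fix B assume "B \<in> sets (plus_measure ?P ?Q)"
    then have [measurable]: "B \<in> sets \<nu>"
      by simp
    have "emeasure (plus_measure ?P ?Q) B = emeasure ?P B + emeasure ?Q B"
      by (rule emeasure_plus_measure) auto
    also have "\<dots> = (\<integral>\<^sup>+x. ennreal (p x) * indicator B x + ennreal (q x) * indicator B x \<partial>\<nu>)"
      by (simp add: emeasure_density nn_integral_add)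
    also have "\<dots> = emeasure ?\<mu> B"
      by (simp add: emeasure_density s_def nonneg distrib_right)
    finally show "emeasure (plus_measure ?P ?Q) B = emeasure ?\<mu> B" .
  qed simp
  have "emeasure ?\<mu> (space \<nu>) = emeasure ?P (space ?P) + emeasure ?Q (space ?Q)"
    unfolding mu[symmetric] by (subst emeasure_plus_measure) auto
  also have "\<dots> < \<infinity>"
    unfolding prob_space.emeasure_space_1[OF prob(1)] prob_space.emeasure_space_1[OF prob(2)]
    by simp
  finally interpret finite_measure ?\<mu>
    by (intro finite_measureI) auto
  have deriv: "AE x in ?\<mu>. ennreal (f x / s x) = RN_deriv ?\<mu> (density \<nu> f) x"
    if [measurable]: "f \<in> borel_measurable \<nu>" and f: "\<And>x. 0 \<le> f x" "\<And>x. f x \<le> s x" for f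
  proof (rule RN_deriv_unique)
    have "density ?\<mu> (\<lambda>x. ennreal (f x / s x)) = density \<nu> (\<lambda>x. ennreal (s x) * ennreal (f x / s x))"
      by (subst density_density_eq) auto
    also have "(\<lambda>x. ennreal (s x) * ennreal (f x / s x)) = (\<lambda>x. ennreal (f x))"
    proof
      fix x
      show "ennreal (s x) * ennreal (f x / s x) = ennreal (f x)"
        using f[of x] s[of x] by (cases "s x = 0") (auto simp: ennreal_mult[symmetric])
    qed
    finally show "density ?\<mu> (\<lambda>x. ennreal (f x / s x)) = density \<nu> f" .
  qed measurable
  have "(\<integral>x. (sqrt (enn2real (RN_deriv ?\<mu> ?P x)) - sqrt (enn2real (RN_deriv ?\<mu> ?Q x)))\<^sup>2 \<partial>?\<mu>)
      = (\<integral>x. (sqrt (p x / s x) - sqrt (q x / s x))\<^sup>2 \<partial>?\<mu>)"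
  proof (rule integral_cong_AE)
    have "AE x in ?\<mu>. ennreal (p x / s x) = RN_deriv ?\<mu> ?P x"
         "AE x in ?\<mu>. ennreal (q x / s x) = RN_deriv ?\<mu> ?Q x"
      by (rule deriv; simp add: s_def nonneg)+
    then show "AE x in ?\<mu>. (sqrt (enn2real (RN_deriv ?\<mu> ?P x)) - sqrt (enn2real (RN_deriv ?\<mu> ?Q x)))\<^sup>2
             = (sqrt (p x / s x) - sqrt (q x / s x))\<^sup>2"
    proof eventually_elim
      case (elim x)
      have "enn2real (RN_deriv ?\<mu> ?P x) = p x / s x" "enn2real (RN_deriv ?\<mu> ?Q x) = q x / s x"
        unfolding elim[symmetric] by (simp_all add: nonneg s)
      then show ?case by simp
    qed
  qed measurable
  also have "\<dots> = (\<integral>x. s x * (sqrt (p x / s x) - sqrt (q x / s x))\<^sup>2 \<partial>\<nu>)"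
    by (subst integral_real_density) (auto simp: s)
  also have "\<dots> = (\<integral>x. (sqrt (p x) - sqrt (q x))\<^sup>2 \<partial>\<nu>)"
  proof (rule Bochner_Integration.integral_cong[OF refl])
    fix x
    show "s x * (sqrt (p x / s x) - sqrt (q x / s x))\<^sup>2 = (sqrt (p x) - sqrt (q x))\<^sup>2"
    proof (cases "s x = 0")
      case True
      then have "p x = 0" "q x = 0"
        using nonneg[of x] by (auto simp: s_def)
      then show ?thesis by (simp add: True)
    next
      case False
      then show ?thesis
        using s[of x] by (simp add: real_sqrt_divide diff_divide_distrib[symmetric] power_divide)
    qed
  qed
  finally show ?thesis
    by (simp add: hellinger_sq_def mu)
qed

definition real_distributions :: "real measure set" where
  "real_distributions = {P. prob_space P \<and> sets P = sets borel}"

definition hellinger_open :: "real measure set \<Rightarrow> bool" where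
  "hellinger_open U \<longleftrightarrow> U \<subseteq> real_distributions \<and>
     (\<forall>P\<in>U. \<exists>\<epsilon>>0. \<forall>Q\<in>real_distributions. hellinger P Q < \<epsilon> \<longrightarrow> Q \<in> U)"

definition hellinger_closure :: "real measure set \<Rightarrow> real measure set" where
  "hellinger_closure S = {P \<in> real_distributions. \<forall>\<epsilon>>0. \<exists>Q\<in>S. hellinger P Q < \<epsilon>}"

definition hellinger_borel :: "real measure measure" where
  "hellinger_borel = sigma real_distributions {U. hellinger_open U}"

definition half_plane :: "(real \<times> real) set" where
  "half_plane = UNIV \<times> {0<..}"

definition mixing_distributions :: "(real \<times> real) measure set" where
  "mixing_distributions = {H. prob_space H \<and> sets H = sets (restrict_space borel half_plane)}"

definition supp :: "'a::topological_space measure \<Rightarrow> 'a set" where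
  "supp H = {x \<in> space H. \<forall>U. open U \<and> x \<in> U \<longrightarrow> emeasure H (U \<inter> space H) > 0}"

definition mixture_density :: "(real \<times> real) measure \<Rightarrow> real \<Rightarrow> real" where
  "mixture_density H x = (\<integral>(z, \<sigma>). normal_density z \<sigma> x \<partial>H)"

definition mixture_densities :: "real \<Rightarrow> real \<Rightarrow> (real \<Rightarrow> real) set" where
  "mixture_densities A R = {mixture_density H | H. H \<in> mixing_distributions \<and>
     (\<exists>l. \<exists>s>0. supp H \<subseteq> {l - s * A..l + s * A} \<times> {s..s * R})}"

definition distributions_of :: "(real \<Rightarrow> real) set \<Rightarrow> real measure set" where
  "distributions_of D = {density lborel q | q. q \<in> D}"

definition shatters :: "'a set set \<Rightarrow> 'a set \<Rightarrow> bool" where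
  "shatters \<D> S \<longleftrightarrow> (\<forall>B\<subseteq>S. \<exists>D\<in>\<D>. D \<inter> S = B)"

definition subgraph :: "('a \<Rightarrow> real) \<Rightarrow> ('a \<times> real) set" where
  "subgraph f = {(x, t). t < f x}"

text \<open>
  \<open>LEAST\<close> is only meaningful if some \<open>m\<close> qualifies. For the Gaussian densities this is the case: points
  with \<open>t \<le> 0\<close> lie in every subgraph, and for \<open>t > 0\<close> the condition \<open>t < f x\<close> is a linear inequality
  in \<open>(x\<^sup>2, x, 1, ln t)\<close>.
\<close>

definition vc_index :: "('a \<Rightarrow> real) set \<Rightarrow> nat" where
  "vc_index G = (LEAST m. m \<ge> 1 \<and> \<not> (\<exists>S. finite S \<and> card S = m \<and> shatters (subgraph ` G) S))"

definition gaussian_densities :: "(real \<Rightarrow> real) set" where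
  "gaussian_densities = {normal_density z \<sigma> | z \<sigma>. \<sigma> > 0}"

definition countable_dense_gaussians :: "real measure set \<Rightarrow> bool" where
  "countable_dense_gaussians F \<longleftrightarrow> F \<subseteq> distributions_of gaussian_densities \<and> countable F \<and>
     (\<forall>P\<in>distributions_of gaussian_densities. \<forall>\<epsilon>>0. \<exists>Q\<in>F. hellinger P Q < \<epsilon>)"

text \<open>
  The elements are pointwise defined functions (the \<open>\<rho>\<close>-estimation statistic evaluates them at the
  data): each component with distribution in \<open>F\<close> is represented by its Gaussian density.
\<close>

definition finite_mixture_densities :: "real measure set \<Rightarrow> nat \<Rightarrow> real \<Rightarrow> (real \<Rightarrow> real) set" where
  "finite_mixture_densities F K \<delta> =
     {(\<lambda>x. \<Sum>k<K. w k * f k x) | w f.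
        (\<forall>k<K. w k \<in> {0..1} \<and> w k \<ge> \<delta> \<and> w k \<in> \<rat>) \<and> (\<Sum>k<K. w k) = 1 \<and>
        (\<forall>k<K. f k \<in> gaussian_densities \<and> density lborel (f k) \<in> F)}"

lemma emeasure_finite_mixture:
  assumes "\<And>k. k < K \<Longrightarrow> w k \<ge> 0" "\<And>k. k < K \<Longrightarrow> f k \<in> gaussian_densities" "B \<in> sets borel"
  shows "emeasure (density lborel (\<lambda>x. \<Sum>k<K. w k * f k x)) B =
           (\<Sum>k<K. ennreal (w k) * emeasure (density lborel (f k)) B)"
proof -
  have f: "f k \<in> borel_measurable borel" "0 \<le> f k x" if "k < K" for k x
    using assms(2)[OF that] by (auto simp: gaussian_densities_def)
  have [measurable]: "(\<lambda>x. \<Sum>k<K. w k * f k x) \<in> borel_measurable borel"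
    by (intro borel_measurable_sum borel_measurable_times) (auto intro: f)
  have "emeasure (density lborel (\<lambda>x. \<Sum>k<K. w k * f k x)) B =
          (\<integral>\<^sup>+x. ennreal (\<Sum>k<K. w k * f k x) * indicator B x \<partial>lborel)"
    using assms(3) by (subst emeasure_density) auto
  also have "\<dots> = (\<integral>\<^sup>+x. (\<Sum>k<K. ennreal (w k) * (ennreal (f k x) * indicator B x)) \<partial>lborel)"
  proof (rule nn_integral_cong)
    fix x
    have "ennreal (\<Sum>k<K. w k * f k x) = (\<Sum>k<K. ennreal (w k * f k x))"
      by (subst sum_ennreal) (auto simp: f assms(1))
    also have "\<dots> = (\<Sum>k<K. ennreal (w k) * ennreal (f k x))"
      by (rule sum.cong) (auto simp: f assms(1) ennreal_mult)
    finally show "ennreal (\<Sum>k<K. w k * f k x) * indicator B x =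
        (\<Sum>k<K. ennreal (w k) * (ennreal (f k x) * indicator B x))"
      by (simp add: sum_distrib_right mult.assoc)
  qed
  also have "\<dots> = (\<Sum>k<K. \<integral>\<^sup>+x. ennreal (w k) * (ennreal (f k x) * indicator B x) \<partial>lborel)"
    using f assms(3) by (intro nn_integral_sum) auto
  also have "\<dots> = (\<Sum>k<K. ennreal (w k) * emeasure (density lborel (f k)) B)"
    using f assms(3)
    by (intro sum.cong refl) (simp add: emeasure_density nn_integral_cmult)
  finally show ?thesis .
qed

definition psi :: "ereal \<Rightarrow> real" where
  "psi x = (if x = \<infinity> then 1 else (real_of_ereal x - 1) / (real_of_ereal x + 1))"

definition sqrt_ratio :: "real \<Rightarrow> real \<Rightarrow> ereal" where
  "sqrt_ratio a b = (if b = 0 then (if a = 0 then 1 else \<infinity>) else ereal (sqrt (a / b)))"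

definition rho_T :: "nat \<Rightarrow> (nat \<Rightarrow> real) \<Rightarrow> (real \<Rightarrow> real) \<Rightarrow> (real \<Rightarrow> real) \<Rightarrow> real" where
  "rho_T n X q q' = (\<Sum>i<n. psi (sqrt_ratio (q' (X i)) (q (X i))))"

definition rho_Upsilon :: "nat \<Rightarrow> (real \<Rightarrow> real) set \<Rightarrow> (nat \<Rightarrow> real) \<Rightarrow> (real \<Rightarrow> real) \<Rightarrow> real" where
  "rho_Upsilon n G X q = (SUP q'\<in>G. rho_T n X q q')"

definition is_rho_estimator ::
    "nat \<Rightarrow> (real \<Rightarrow> real) set \<Rightarrow> ((nat \<Rightarrow> real) \<Rightarrow> real measure) \<Rightarrow> bool" where
  "is_rho_estimator n G Phat \<longleftrightarrow>
     Phat \<in> measurable (PiM {..<n} (\<lambda>_. borel)) hellinger_borel \<and>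
     (\<forall>X\<in>space (PiM {..<n} (\<lambda>_. borel)). Phat X \<in> hellinger_closure
        (distributions_of {q \<in> G. rho_Upsilon n G X q < (INF q'\<in>G. rho_Upsilon n G X q') + 8.24}))"

definition mixture_order :: "real \<Rightarrow> nat \<Rightarrow> nat" where
  "mixture_order R n = nat \<lceil>2 * R ^ 4 * (ln (real n))\<^sup>2 / 27\<rceil>"

definition weight_threshold :: "nat \<Rightarrow> nat \<Rightarrow> real" where
  "weight_threshold n K =
     (if K = 1 then 1
      else min (real K * real (vc_index gaussian_densities) / (real n * (real K - 1))) (1 / real K))"

end

theory Submission
  imports Defs
begin

text \<open>
  The estimator is compared with one fixed reference density \<open>q\<^sub>0\<close> of the model, chosen close to the
  best approximation of the true distribution by the Gaussian mixtures with bounded support. The test statistic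
  is antisymmetric, so a near minimiser \<open>q\<close> of the supremum is close to \<open>q\<^sub>0\<close> as soon as there is an upper
  bound, uniform in \<open>q\<close> and with the negative drift \<open>- n h\<^sup>2(q\<^sub>0, q) / 16\<close>, for the statistics that test \<open>q\<^sub>0\<close>
  against \<open>q\<close> (\<open>near_minimizer_close_to_reference\<close>).

  Since the reference is fixed and the statistic is increasing in \<open>q\<close>, such an upper bound follows from a union
  bound: dominate the model by finitely many upper brackets, bound the exponential moment of each one and sum the
  error probabilities. For the
  score \<open>(sqrt u - sqrt q\<^sub>0) / (sqrt u + sqrt q\<^sub>0)\<close> of a bracket \<open>u\<close>, an elementary inequality between
  squares bounds the exponential moment by the drift above and \<open>h\<^sup>2(P, q\<^sub>0)\<close>
  (\<open>bracket_exponential_moment\<close>). Location and scale are unbounded, but a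
  polynomial number of brackets covers all Gaussian densities up to a small error (\<open>gauss_kernel_bracket\<close>):
  only a window around the reference matters, very flat and very distant components are negligible there, and
  for very narrow ones a tiny interval is given up, on which the score is replaced by its maximal value 1; this is
  cheap because the reference has bounded density, up to a small error. The logarithm of the number of brackets
  for mixtures of order \<open>K\<close> is of order \<open>K ln n\<close>, that is \<open>R\<^sup>4 ln\<^sup>3 n\<close>.

  It remains to find the reference density (\<open>reference_density_exists\<close>). On a window of half-width
  of order \<open>R sqrt (ln n)\<close> in units of the scale, the Gaussian densities with parameters in the given box
  agree up to a power of \<open>1 / n\<close> with Taylor polynomials of degree of order \<open>R\<^sup>2 ln n\<close>. Preserving the mean
  coefficients of these polynomials, Caratheodory's theorem reduces any mixing distribution to
  \<open>O(R\<^sup>2 ln n)\<close> atoms, and the order \<open>K\<close> exceeds this number as soon as \<open>ln n\<close> is larger than a constant. Raising the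
  weights to the threshold costs \<open>O(K / n)\<close>. When \<open>ln n\<close> is not large the inequality is trivial, because the
  squared Hellinger distance is at most one and the remainder term is bounded below.
\<close>

section \<open>Hellinger distance and \<open>L\<^sup>1\<close> distance\<close>

lemma borel_measurable_sets_eq:
  "sets M = sets N \<Longrightarrow> borel_measurable M = borel_measurable N"
  by (intro measurable_cong_sets) auto

lemma real_density_exists:
  fixes \<mu> :: "'a measure"
  assumes "finite_measure \<nu>" "finite_measure \<mu>" "absolutely_continuous \<nu> \<mu>" "sets \<mu> = sets \<nu>"
  shows "\<exists>p :: 'a \<Rightarrow> real. p \<in> borel_measurable \<nu> \<and> (\<forall>x. 0 \<le> p x) \<and> \<mu> = density \<nu> (\<lambda>x. ennreal (p x))"
proof -
  interpret N: finite_measure \<nu> by fact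
  interpret M: finite_measure \<mu> by fact
  obtain f where f [measurable]: "f \<in> borel_measurable \<nu>" and "density \<nu> f = \<mu>"
    using N.Radon_Nikodym[OF assms(3,4)] by auto
  then have "(\<integral>\<^sup>+x. f x \<partial>\<nu>) = emeasure \<mu> (space \<nu>)"
    by (auto simp: emeasure_density intro!: nn_integral_cong)
  also have "\<dots> \<noteq> \<infinity>"
    using M.emeasure_finite by (simp add: top.not_eq_extremum)
  finally have "AE x in \<nu>. f x \<noteq> \<infinity>"
    by (intro nn_integral_PInf_AE) auto
  then have "AE x in \<nu>. f x = ennreal (enn2real (f x))"
    by eventually_elim (simp add: top.not_eq_extremum)
  then have "density \<nu> f = density \<nu> (\<lambda>x. ennreal (enn2real (f x)))"
    by (intro density_cong) auto
  then show ?thesis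
    using \<open>density \<nu> f = \<mu>\<close> by (intro exI[of _ "\<lambda>x. enn2real (f x)"]) auto
qed

lemma finite_measure_plus_measure:
  assumes "finite_measure P" "finite_measure Q" "sets P = sets Q"
  shows "finite_measure (plus_measure P Q)"
proof -
  interpret P: finite_measure P by fact
  interpret Q: finite_measure Q by fact
  show ?thesis
  proof (rule finite_measureI)
    have "emeasure (plus_measure P Q) (space P) = emeasure P (space P) + emeasure Q (space P)"
      by (rule emeasure_plus_measure) (use assms in \<open>auto simp flip: assms(3)\<close>)
    then show "emeasure (plus_measure P Q) (space (plus_measure P Q)) \<noteq> \<infinity>"
      using P.emeasure_finite Q.emeasure_finite by simp
  qed
qed

lemma absolutely_continuous_plus_measure:
  assumes "sets P = sets Q"
  shows "absolutely_continuous (plus_measure P Q) P" "absolutely_continuous (plus_measure P Q) Q"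
  unfolding absolutely_continuous_def null_sets_def
  using assms by (auto simp: emeasure_plus_measure)

lemma real_distributionsD:
  assumes "P \<in> real_distributions"
  shows "prob_space P" "finite_measure P" "sets P = sets borel" "space P = UNIV"
  using assms prob_space.finite_measure sets_eq_imp_space_eq[of P borel]
  by (auto simp: real_distributions_def)

lemma dominating_measure:
  assumes "P \<in> real_distributions" "Q \<in> real_distributions" "R \<in> real_distributions"
  obtains \<nu> :: "real measure" and p q r :: "real \<Rightarrow> real"
  where "sets \<nu> = sets borel"
    "p \<in> borel_measurable \<nu>" "q \<in> borel_measurable \<nu>" "r \<in> borel_measurable \<nu>"
    "\<And>x. 0 \<le> p x" "\<And>x. 0 \<le> q x" "\<And>x. 0 \<le> r x"
    "P = density \<nu> p" "Q = density \<nu> q" "R = density \<nu> r"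
proof -
  define \<nu> where "\<nu> = plus_measure P (plus_measure Q R)"
  note P = real_distributionsD[OF assms(1)] and Q = real_distributionsD[OF assms(2)]
    and R = real_distributionsD[OF assms(3)]
  have s: "sets \<nu> = sets borel" by (simp add: \<nu>_def P)
  have f: "finite_measure \<nu>"
    unfolding \<nu>_def by (intro finite_measure_plus_measure P Q R) (simp_all add: P Q R)
  have a: "absolutely_continuous \<nu> P" "absolutely_continuous \<nu> (plus_measure Q R)"
    unfolding \<nu>_def by (intro absolutely_continuous_plus_measure; simp add: P Q)+
  have "absolutely_continuous (plus_measure Q R) Q" "absolutely_continuous (plus_measure Q R) R"
    by (intro absolutely_continuous_plus_measure; simp add: Q R)+
  with a have a': "absolutely_continuous \<nu> Q" "absolutely_continuous \<nu> R"
    by (auto simp: absolutely_continuous_def)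
  obtain p :: "real \<Rightarrow> real" where p: "p \<in> borel_measurable \<nu>" "\<forall>x. 0 \<le> p x" "P = density \<nu> p"
    using real_density_exists[OF f P(2) a(1)] s P by metis
  obtain q :: "real \<Rightarrow> real" where q: "q \<in> borel_measurable \<nu>" "\<forall>x. 0 \<le> q x" "Q = density \<nu> q"
    using real_density_exists[OF f Q(2) a'(1)] s Q by metis
  obtain r :: "real \<Rightarrow> real" where r: "r \<in> borel_measurable \<nu>" "\<forall>x. 0 \<le> r x" "R = density \<nu> r"
    using real_density_exists[OF f R(2) a'(2)] s R by metis
  show thesis
    by (rule that[OF s p(1) q(1) r(1) _ _ _ p(3) q(3) r(3)]) (use p q r in auto)
qed

text \<open>
  A Gaussian measure takes the place of Lebesgue measure in the dominating measure, which is then finite; this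
  gives real-valued densities of both the given distribution and Lebesgue measure.
\<close>

lemma dominating_measure_lborel:
  assumes P: "P \<in> real_distributions"
  obtains \<nu> :: "real measure" and p s :: "real \<Rightarrow> real"
  where "sets \<nu> = sets borel" "p \<in> borel_measurable borel" "s \<in> borel_measurable borel"
    "\<And>x. 0 \<le> p x" "\<And>x. 0 \<le> s x" "P = density \<nu> p" "lborel = density \<nu> s"
proof -
  note P = real_distributionsD[OF P]
  define \<gamma> where "\<gamma> = density lborel std_normal_density"
  interpret \<gamma>: prob_space \<gamma> unfolding \<gamma>_def by (rule prob_space_normal_density) simp
  have g: "sets \<gamma> = sets borel" by (simp add: \<gamma>_def)
  define \<nu> where "\<nu> = plus_measure P \<gamma>"
  have f: "finite_measure \<nu>"
    unfolding \<nu>_def by (intro finite_measure_plus_measure P) (simp_all add: P g \<gamma>.finite_measure_axioms)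
  have a: "absolutely_continuous \<nu> P" "absolutely_continuous \<nu> \<gamma>"
    unfolding \<nu>_def by (intro absolutely_continuous_plus_measure; simp add: P g)+
  have s: "sets \<nu> = sets borel" by (simp add: \<nu>_def P)
  note B [simp] = borel_measurable_sets_eq[OF s]
  obtain p :: "real \<Rightarrow> real"
    where p: "p \<in> borel_measurable \<nu>" "\<forall>x. 0 \<le> p x" "P = density \<nu> (\<lambda>x. ennreal (p x))"
    using real_density_exists[OF f P(2) a(1)] s P(3) by metis
  obtain h :: "real \<Rightarrow> real"
    where h: "h \<in> borel_measurable \<nu>" and h0: "\<forall>x. 0 \<le> h x" and h': "\<gamma> = density \<nu> (\<lambda>x. ennreal (h x))"
    using real_density_exists[OF f \<gamma>.finite_measure_axioms a(2)] s g by metis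
  have [measurable]: "h \<in> borel_measurable borel" using h by simp
  define t where "t x = h x / std_normal_density x" for x
  have pos: "std_normal_density x > 0" for x by (simp add: normal_density_pos)
  have "density \<gamma> (\<lambda>x. ennreal (1 / std_normal_density x))
      = density lborel (\<lambda>x. ennreal (std_normal_density x) * ennreal (1 / std_normal_density x))"
    unfolding \<gamma>_def by (subst density_density_eq) auto
  also have "(\<lambda>x. ennreal (std_normal_density x) * ennreal (1 / std_normal_density x)) = (\<lambda>_. 1)"
    using pos by (auto simp: ennreal_mult'[symmetric] less_imp_neq[OF pos, symmetric])
  finally have l1: "lborel = density \<gamma> (\<lambda>x. ennreal (1 / std_normal_density x))"
    by (simp add: density_1)
  have "(\<lambda>x. ennreal (h x) * ennreal (1 / std_normal_density x)) = (\<lambda>x. ennreal (t x))"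
    using h0 by (auto simp: ennreal_mult'[symmetric] t_def)
  then have l: "lborel = density \<nu> (\<lambda>x. ennreal (t x))"
    unfolding l1 h' by (subst density_density_eq) (auto simp: B h)
  have t: "t \<in> borel_measurable borel" "0 \<le> t x" for x
    unfolding t_def using pos[of x] h0 by auto
  show thesis
    by (rule that[OF s _ t(1) _ t(2) p(3) l]) (use p B in auto)
qed

lemma integrable_prob_density:
  fixes p :: "'a \<Rightarrow> real"
  assumes [measurable]: "p \<in> borel_measurable \<nu>" and "\<And>x. 0 \<le> p x" "prob_space (density \<nu> p)"
  shows "integrable \<nu> p" "integral\<^sup>L \<nu> p = 1"
proof -
  have "(\<integral>\<^sup>+x. p x \<partial>\<nu>) = 1"
    using prob_space.emeasure_space_1[OF assms(3)]
    by (auto simp: emeasure_density cong: nn_integral_cong)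
  then have "has_bochner_integral \<nu> p 1"
    using assms by (intro has_bochner_integral_nn_integral) auto
  then show "integrable \<nu> p" "integral\<^sup>L \<nu> p = 1"
    by (auto simp: has_bochner_integral_iff)
qed

lemma prob_space_densityI:
  fixes p :: "'a \<Rightarrow> real"
  assumes "integrable \<nu> p" "\<And>x. 0 \<le> p x" "integral\<^sup>L \<nu> p = 1"
  shows "prob_space (density \<nu> p)"
proof
  have [measurable]: "p \<in> borel_measurable \<nu>" using assms by auto
  show "emeasure (density \<nu> p) (space (density \<nu> p)) = 1"
    using assms by (simp add: emeasure_density nn_integral_eq_integral cong: nn_integral_cong)
qed

abbreviation mass :: "real set \<Rightarrow> (real \<Rightarrow> real) \<Rightarrow> real" where
  "mass B f \<equiv> \<integral>x. indicator B x * f x \<partial>lborel"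

lemma integrable_indicator_mult:
  fixes f :: "real \<Rightarrow> real"
  assumes "integrable lborel f" "B \<in> sets borel"
  shows "integrable lborel (\<lambda>x. indicator B x * f x)"
proof -
  have [measurable]: "f \<in> borel_measurable borel" using assms by auto
  show ?thesis
    by (rule Bochner_Integration.integrable_bound[OF assms(1)])
      (use assms in \<open>auto split: split_indicator\<close>)
qed

lemma sqrt_diff_sq_le:
  fixes a b :: real
  assumes "0 \<le> a" "0 \<le> b"
  shows "(sqrt a - sqrt b)\<^sup>2 \<le> \<bar>a - b\<bar>"
proof -
  have "(sqrt a - sqrt b)\<^sup>2 \<le> \<bar>sqrt a - sqrt b\<bar> * (sqrt a + sqrt b)"
    using assms power2_abs[of "sqrt a - sqrt b"]
      mult_left_mono[of "\<bar>sqrt a - sqrt b\<bar>" "sqrt a + sqrt b" "\<bar>sqrt a - sqrt b\<bar>"]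
    by (simp add: power2_eq_square abs_le_iff)
  also have "\<dots> = \<bar>(sqrt a - sqrt b) * (sqrt a + sqrt b)\<bar>"
    using assms by (simp add: abs_mult)
  also have "\<dots> = \<bar>a - b\<bar>" using assms by (simp add: algebra_simps)
  finally show ?thesis .
qed

lemma integrable_sqrt_diff_sq:
  fixes p q :: "'a \<Rightarrow> real"
  assumes "integrable \<nu> p" "integrable \<nu> q" "\<And>x. 0 \<le> p x" "\<And>x. 0 \<le> q x"
  shows "integrable \<nu> (\<lambda>x. (sqrt (p x) - sqrt (q x))\<^sup>2)"
proof (rule Bochner_Integration.integrable_bound)
  show "integrable \<nu> (\<lambda>x. \<bar>p x - q x\<bar>)" using assms by simp
  have [measurable]: "p \<in> borel_measurable \<nu>" "q \<in> borel_measurable \<nu>" using assms by auto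
  show "(\<lambda>x. (sqrt (p x) - sqrt (q x))\<^sup>2) \<in> borel_measurable \<nu>" by measurable
  show "AE x in \<nu>. norm ((sqrt (p x) - sqrt (q x))\<^sup>2) \<le> norm \<bar>p x - q x\<bar>"
    using sqrt_diff_sq_le assms by auto
qed

lemma hellinger_sq_nonneg: "0 \<le> hellinger_sq P Q"
  unfolding hellinger_sq_def Let_def by (intro mult_nonneg_nonneg integral_nonneg_AE) auto

lemma hellinger_sq_eq: "hellinger P Q ^ 2 = hellinger_sq P Q"
  by (simp add: hellinger_def hellinger_sq_nonneg)

lemma hellinger_nonneg: "0 \<le> hellinger P Q"
  by (simp add: hellinger_def hellinger_sq_nonneg)

lemma hellinger_sq_representation:
  assumes "P \<in> real_distributions" "Q \<in> real_distributions" "R \<in> real_distributions"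
  obtains \<nu> :: "real measure" and p q r :: "real \<Rightarrow> real"
  where "integrable \<nu> p" "integrable \<nu> q" "integrable \<nu> r"
    "\<And>x. 0 \<le> p x" "\<And>x. 0 \<le> q x" "\<And>x. 0 \<le> r x"
    "integral\<^sup>L \<nu> p = 1" "integral\<^sup>L \<nu> q = 1" "integral\<^sup>L \<nu> r = 1"
    "hellinger_sq P Q = 1 / 2 * (\<integral>x. (sqrt (p x) - sqrt (q x))\<^sup>2 \<partial>\<nu>)"
    "hellinger_sq Q P = 1 / 2 * (\<integral>x. (sqrt (q x) - sqrt (p x))\<^sup>2 \<partial>\<nu>)"
    "hellinger_sq Q R = 1 / 2 * (\<integral>x. (sqrt (q x) - sqrt (r x))\<^sup>2 \<partial>\<nu>)"
    "hellinger_sq P R = 1 / 2 * (\<integral>x. (sqrt (p x) - sqrt (r x))\<^sup>2 \<partial>\<nu>)"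
proof (rule dominating_measure[OF assms])
  fix \<nu> :: "real measure" and p q r :: "real \<Rightarrow> real"
  assume m: "p \<in> borel_measurable \<nu>" "q \<in> borel_measurable \<nu>" "r \<in> borel_measurable \<nu>"
    and nn: "\<And>x. 0 \<le> p x" "\<And>x. 0 \<le> q x" "\<And>x. 0 \<le> r x"
    and d: "P = density \<nu> (\<lambda>x. ennreal (p x))" "Q = density \<nu> (\<lambda>x. ennreal (q x))"
      "R = density \<nu> (\<lambda>x. ennreal (r x))"
  have pr: "prob_space (density \<nu> p)" "prob_space (density \<nu> q)" "prob_space (density \<nu> r)"
    using assms[THEN real_distributionsD(1)] unfolding d by auto
  show thesis
    by (rule that[of \<nu> p q r])
      (use integrable_prob_density[OF m(1) nn(1) pr(1)] integrable_prob_density[OF m(2) nn(2) pr(2)]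
         integrable_prob_density[OF m(3) nn(3) pr(3)] nn in
       \<open>simp_all add: d hellinger_sq_density m nn pr\<close>)
qed

lemma hellinger_sq_commute:
  assumes "P \<in> real_distributions" "Q \<in> real_distributions"
  shows "hellinger_sq P Q = hellinger_sq Q P"
  by (rule hellinger_sq_representation[OF assms assms(1)]) (simp add: power2_commute)

lemma hellinger_sq_le_1:
  assumes "P \<in> real_distributions" "Q \<in> real_distributions"
  shows "hellinger_sq P Q \<le> 1"
proof (rule hellinger_sq_representation[OF assms assms(1)])
  fix \<nu> :: "real measure" and p q :: "real \<Rightarrow> real"
  assume i: "integrable \<nu> p" "integrable \<nu> q" "\<And>x. 0 \<le> p x" "\<And>x. 0 \<le> q x"
    "integral\<^sup>L \<nu> p = 1" "integral\<^sup>L \<nu> q = 1"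
    and h: "hellinger_sq P Q = 1 / 2 * (\<integral>x. (sqrt (p x) - sqrt (q x))\<^sup>2 \<partial>\<nu>)"
  have "(\<integral>x. (sqrt (p x) - sqrt (q x))\<^sup>2 \<partial>\<nu>) \<le> (\<integral>x. p x + q x \<partial>\<nu>)"
    using i by (intro integral_mono integrable_sqrt_diff_sq) (auto simp: power2_diff)
  also have "\<dots> = 2" using i by simp
  finally show ?thesis by (simp add: h)
qed

text \<open>
  Minkowski's inequality in \<open>L\<^sup>2\<close>, obtained by optimising \<open>t\<close> in
  \<open>(x + y)\<^sup>2 \<le> (1 + t) x\<^sup>2 + (1 + 1 / t) y\<^sup>2\<close>.
\<close>

lemma hellinger_triangle:
  assumes "P \<in> real_distributions" "Q \<in> real_distributions" "R \<in> real_distributions"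
  shows "hellinger P R \<le> hellinger P Q + hellinger Q R"
proof (rule hellinger_sq_representation[OF assms])
  fix \<nu> :: "real measure" and p q r :: "real \<Rightarrow> real"
  assume i: "integrable \<nu> p" "integrable \<nu> q" "integrable \<nu> r"
    "\<And>x. 0 \<le> p x" "\<And>x. 0 \<le> q x" "\<And>x. 0 \<le> r x"
    and h: "hellinger_sq P Q = 1 / 2 * (\<integral>x. (sqrt (p x) - sqrt (q x))\<^sup>2 \<partial>\<nu>)"
      "hellinger_sq Q R = 1 / 2 * (\<integral>x. (sqrt (q x) - sqrt (r x))\<^sup>2 \<partial>\<nu>)"
      "hellinger_sq P R = 1 / 2 * (\<integral>x. (sqrt (p x) - sqrt (r x))\<^sup>2 \<partial>\<nu>)"
  let ?a = "\<lambda>x. (sqrt (p x) - sqrt (q x))\<^sup>2" and ?b = "\<lambda>x. (sqrt (q x) - sqrt (r x))\<^sup>2"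
    and ?c = "\<lambda>x. (sqrt (p x) - sqrt (r x))\<^sup>2"
  have young: "hellinger_sq P R \<le> (1 + t) * hellinger_sq P Q + (1 + 1 / t) * hellinger_sq Q R"
    if t: "t > 0" for t
  proof -
    have pw: "(x + y)\<^sup>2 \<le> (1 + t) * x\<^sup>2 + (1 + 1 / t) * y\<^sup>2" for x y :: real
    proof -
      have "(1 + t) * x\<^sup>2 + (1 + 1 / t) * y\<^sup>2 - (x + y)\<^sup>2 = (t * x - y)\<^sup>2 / t"
        using t by (simp add: field_simps power2_eq_square)
      also have "\<dots> \<ge> 0" using t by simp
      finally show ?thesis by simp
    qed
    have "(\<integral>x. ?c x \<partial>\<nu>) \<le> (\<integral>x. (1 + t) * ?a x + (1 + 1 / t) * ?b x \<partial>\<nu>)"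
      using i pw[of "sqrt (p x) - sqrt (q x)" "sqrt (q x) - sqrt (r x)" for x]
      by (intro integral_mono integrable_sqrt_diff_sq Bochner_Integration.integrable_add
          integrable_mult_right) auto
    also have "\<dots> = (1 + t) * (\<integral>x. ?a x \<partial>\<nu>) + (1 + 1 / t) * (\<integral>x. ?b x \<partial>\<nu>)"
      using i by (subst Bochner_Integration.integral_add) (auto intro!: integrable_sqrt_diff_sq)
    finally show ?thesis using t by (simp add: h field_simps)
  qed
  define A B where "A = hellinger P Q" and "B = hellinger Q R"
  have AB: "0 \<le> A" "0 \<le> B" by (auto simp: A_def B_def hellinger_nonneg)
  have *: "(hellinger P R)\<^sup>2 \<le> (1 + t) * A\<^sup>2 + (1 + 1 / t) * B\<^sup>2" if "t > 0" for t
    using young[OF that] by (simp add: A_def B_def hellinger_sq_eq)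
  have "hellinger P R \<le> A + B + e" if e: "e > 0" for e
  proof -
    let ?t = "(B + e / 2) / (A + e / 2)"
    have "(hellinger P R)\<^sup>2 \<le> (1 + ?t) * A\<^sup>2 + (1 + 1 / ?t) * B\<^sup>2"
      using AB e by (intro *) auto
    also have "\<dots> \<le> (1 + ?t) * (A + e / 2)\<^sup>2 + (1 + 1 / ?t) * (B + e / 2)\<^sup>2"
      using AB e by (intro add_mono mult_left_mono power_mono) auto
    also have "\<dots> = (A + B + e)\<^sup>2"
    proof -
      have *: "(1 + y / x) * x\<^sup>2 + (1 + 1 / (y / x)) * y\<^sup>2 = (x + y)\<^sup>2" if "x > 0" "y > 0" for x y :: real
        using that by (simp add: field_simps power2_eq_square)
      have "A + e / 2 + (B + e / 2) = A + B + e" by simp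
      with *[of "A + e / 2" "B + e / 2"] AB e show ?thesis by (metis add_nonneg_pos half_gt_zero)
    qed
    finally show ?thesis using AB e by (auto dest: power2_le_imp_le)
  qed
  then show ?thesis unfolding A_def B_def by (rule field_le_epsilon)
qed

lemma hellinger_sq_triangle:
  assumes "P \<in> real_distributions" "Q \<in> real_distributions" "R \<in> real_distributions"
  shows "hellinger_sq P R \<le> 2 * hellinger_sq P Q + 2 * hellinger_sq Q R"
proof -
  have "(hellinger P R)\<^sup>2 \<le> (hellinger P Q + hellinger Q R)\<^sup>2"
    using hellinger_triangle[OF assms] by (intro power_mono hellinger_nonneg)
  also have "\<dots> \<le> 2 * (hellinger P Q)\<^sup>2 + 2 * (hellinger Q R)\<^sup>2"
    using sum_squares_bound[of "hellinger P Q" "hellinger Q R"] by (simp add: power2_sum)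
  finally show ?thesis by (simp add: hellinger_sq_eq)
qed

text \<open>The distance to a fixed distribution is continuous in the Hellinger topology, hence Borel.\<close>

lemma hellinger_sq_measurable:
  assumes P: "P \<in> real_distributions"
  shows "{Q \<in> real_distributions. hellinger_sq P Q \<le> c} \<in> sets hellinger_borel"
proof -
  let ?U = "{Q \<in> real_distributions. c < hellinger_sq P Q}"
  have "hellinger_open ?U"
    unfolding hellinger_open_def
  proof safe
    fix Q assume Q: "Q \<in> real_distributions" "c < hellinger_sq P Q"
    show "\<exists>\<epsilon>>0. \<forall>Q'\<in>real_distributions. hellinger Q Q' < \<epsilon> \<longrightarrow> Q' \<in> ?U"
    proof (cases "c < 0")
      case True
      have "c < hellinger_sq P Q'" for Q' using hellinger_sq_nonneg[of P Q'] True by linarith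
      then show ?thesis by (intro exI[of _ 1]) auto
    next
      case False
      define \<epsilon> where "\<epsilon> = hellinger P Q - sqrt c"
      have e: "\<epsilon> > 0" using Q unfolding \<epsilon>_def hellinger_def by simp
      have "Q' \<in> ?U" if Q': "Q' \<in> real_distributions" "hellinger Q Q' < \<epsilon>" for Q'
      proof -
        have "hellinger P Q \<le> hellinger P Q' + hellinger Q' Q"
          by (rule hellinger_triangle) (use P Q Q' in auto)
        also have "hellinger Q' Q = hellinger Q Q'"
          using Q Q' by (simp add: hellinger_def hellinger_sq_commute)
        finally have "sqrt c < hellinger P Q'" using Q' unfolding \<epsilon>_def by linarith
        then show ?thesis using Q' by (simp add: hellinger_def)
      qed
      with e show ?thesis by blast
    qed
  qed
  then have "?U \<in> sets hellinger_borel"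
    by (simp add: hellinger_borel_def hellinger_open_def sets_measure_of_conv sigma_sets.Basic subset_iff)
  then have "space hellinger_borel - ?U \<in> sets hellinger_borel" by blast
  also have "space hellinger_borel - ?U = {Q \<in> real_distributions. hellinger_sq P Q \<le> c}"
    by (auto simp: hellinger_borel_def space_measure_of_conv)
  finally show ?thesis .
qed

lemma density_lborel_real_distribution:
  fixes p :: "real \<Rightarrow> real"
  assumes "integrable lborel p" "\<And>x. 0 \<le> p x" "integral\<^sup>L lborel p = 1"
  shows "density lborel p \<in> real_distributions"
  using prob_space_densityI[OF assms] by (simp add: real_distributions_def)

lemma hellinger_sq_le_L1:
  fixes p q :: "real \<Rightarrow> real"
  assumes "integrable lborel p" "\<And>x. 0 \<le> p x" "integral\<^sup>L lborel p = 1"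
    and "integrable lborel q" "\<And>x. 0 \<le> q x" "integral\<^sup>L lborel q = 1"
  shows "hellinger_sq (density lborel p) (density lborel q) \<le> 1 / 2 * (\<integral>x. \<bar>p x - q x\<bar> \<partial>lborel)"
proof -
  have "(\<integral>x. (sqrt (p x) - sqrt (q x))\<^sup>2 \<partial>lborel) \<le> (\<integral>x. \<bar>p x - q x\<bar> \<partial>lborel)"
    using assms by (intro integral_mono integrable_sqrt_diff_sq sqrt_diff_sq_le) auto
  then show ?thesis
    using prob_space_densityI[OF assms(1-3)] prob_space_densityI[OF assms(4-6)] assms
    by (subst hellinger_sq_density) simp_all
qed

text \<open>
  The factorisation \<open>\<bar>a - b\<bar> = \<bar>sqrt a - sqrt b\<bar> * (sqrt a + sqrt b)\<close> and Young's inequality, with the second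
  factor weighted by the bound \<open>e\<close> itself.
\<close>

lemma L1_le_hellinger:
  fixes p q :: "real \<Rightarrow> real"
  assumes "integrable lborel p" "\<And>x. 0 \<le> p x" "integral\<^sup>L lborel p = 1"
    and "integrable lborel q" "\<And>x. 0 \<le> q x" "integral\<^sup>L lborel q = 1"
    and e: "hellinger (density lborel p) (density lborel q) \<le> e" "e > 0"
  shows "(\<integral>x. \<bar>p x - q x\<bar> \<partial>lborel) \<le> 3 * e"
proof -
  have pw: "\<bar>a - b\<bar> \<le> (sqrt a - sqrt b)\<^sup>2 / (2 * e) + e * (a + b)" if "0 \<le> a" "0 \<le> b" for a b
  proof -
    define x y where "x = \<bar>sqrt a - sqrt b\<bar>" and "y = sqrt a + sqrt b"
    have "\<bar>a - b\<bar> = \<bar>(sqrt a - sqrt b) * (sqrt a + sqrt b)\<bar>"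
      using that by (simp add: algebra_simps)
    also have "\<dots> = x * y" using that by (simp add: abs_mult x_def y_def)
    also have "\<dots> \<le> x\<^sup>2 / (2 * e) + e * y\<^sup>2 / 2"
    proof -
      have "x\<^sup>2 / (2 * e) + e * y\<^sup>2 / 2 - x * y = (x - e * y)\<^sup>2 / (2 * e)"
        using e by (simp add: field_simps power2_eq_square)
      also have "\<dots> \<ge> 0" using e by simp
      finally show ?thesis by simp
    qed
    also have "y\<^sup>2 \<le> 2 * (a + b)"
      using that sum_squares_bound[of "sqrt a" "sqrt b"] by (simp add: y_def power2_sum)
    finally show ?thesis using e by (simp add: x_def field_simps)
  qed
  have "hellinger_sq (density lborel p) (density lborel q) \<le> e\<^sup>2"
    unfolding hellinger_sq_eq[symmetric] using e by (intro power_mono hellinger_nonneg)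
  then have h: "(\<integral>x. (sqrt (p x) - sqrt (q x))\<^sup>2 \<partial>lborel) \<le> 2 * e\<^sup>2"
    using prob_space_densityI[OF assms(1-3)] prob_space_densityI[OF assms(4-6)] assms(1-6)
    by (subst (asm) hellinger_sq_density) simp_all
  have "(\<integral>x. \<bar>p x - q x\<bar> \<partial>lborel) \<le> (\<integral>x. (sqrt (p x) - sqrt (q x))\<^sup>2 / (2 * e) + e * (p x + q x) \<partial>lborel)"
    using assms pw by (intro integral_mono Bochner_Integration.integrable_add
      integrable_divide integrable_mult_right integrable_sqrt_diff_sq integrable_abs Bochner_Integration.integrable_diff) auto
  also have "\<dots> = (\<integral>x. (sqrt (p x) - sqrt (q x))\<^sup>2 \<partial>lborel) / (2 * e) + e * 2"
    using assms by (subst Bochner_Integration.integral_add) (auto intro!: integrable_sqrt_diff_sq)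
  also have "\<dots> \<le> 2 * e\<^sup>2 / (2 * e) + e * 2"
    using e h by (intro add_right_mono divide_right_mono) auto
  also have "\<dots> = 3 * e" using e by (simp add: power2_eq_square)
  finally show ?thesis .
qed

section \<open>Exponential moments of the bracketed score\<close>

lemma exp_le_quadratic:
  fixes x :: real
  assumes "\<bar>x\<bar> \<le> 1"
  shows "exp x \<le> 1 + x + x\<^sup>2"
proof (cases "0 \<le> x")
  case True then show ?thesis using assms exp_bound by auto
next
  case False
  define y where "y = - x"
  have y: "0 \<le> y" "y \<le> 1" using False assms by (auto simp: y_def)
  have q: "0 \<le> 1 - y + y\<^sup>2"
    using y by (simp add: add_nonneg_nonneg)
  have "1 \<le> 1 + y\<^sup>2 / 2 + y ^ 3 / 2 + y ^ 4 / 2" using y by simp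
  also have "\<dots> = (1 - y + y\<^sup>2) * (1 + y + y\<^sup>2 / 2)"
    by (simp add: field_simps power2_eq_square power3_eq_cube power4_eq_xxxx)
  also have "\<dots> \<le> (1 - y + y\<^sup>2) * exp y"
    using exp_lower_Taylor_quadratic[OF y(1)] q by (rule mult_left_mono)
  finally have "exp (- y) \<le> 1 - y + y\<^sup>2"
    by (simp add: exp_minus field_simps)
  then show ?thesis by (simp add: y_def)
qed

text \<open>
  Here \<open>a\<close>, \<open>t * B\<close>, \<open>t * U\<close> are the square roots of the densities of the true distribution, of the
  reference and of the competitor. If \<open>a = t * B\<close>, the mean score \<open>a\<^sup>2 * g\<close> is at most
  \<open>((t * U)\<^sup>2 - (t * B)\<^sup>2) / 4\<close>, which integrates to about zero, minus \<open>(t * U - t * B)\<^sup>2 / 4\<close>. Replacing \<open>t * B\<close> by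
  \<open>a\<close> costs half of the negative term and a multiple of \<open>(a - t * B)\<^sup>2\<close>. The second moment is of the order of the
  same squares, so that a small factor in the exponent, here \<open>1 / 32\<close>, keeps the sign of the drift.
\<close>

lemma score_pointwise:
  fixes a t B U :: real
  assumes "0 \<le> t" "0 < B" "0 \<le> U"
  defines "g \<equiv> (U - B) / (U + B)"
  shows "32 * a\<^sup>2 * (exp (g / 32) - 1)
    \<le> ((t * U)\<^sup>2 - (t * B)\<^sup>2) / 4 - (t * U - t * B)\<^sup>2 / 16 + 10 * (a - t * B)\<^sup>2"
proof -
  define b c r where "b = t * B" and "c = t * U" and "r = b * g"
  have UB: "U + B > 0" using assms by simp
  have g1: "\<bar>g\<bar> \<le> 1" using assms UB by (auto simp: g_def abs_le_iff divide_simps)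
  have r: "\<bar>r\<bar> \<le> \<bar>c - b\<bar>"
  proof -
    have "\<bar>r\<bar> = (B / (U + B)) * \<bar>c - b\<bar>"
      using assms UB by (simp add: r_def b_def c_def g_def abs_mult right_diff_distrib[symmetric])
    also have "\<dots> \<le> 1 * \<bar>c - b\<bar>" using assms UB by (intro mult_right_mono) auto
    finally show ?thesis by simp
  qed
  then have r2: "r\<^sup>2 \<le> (c - b)\<^sup>2" by (simp add: abs_le_square_iff)
  have bg: "b\<^sup>2 * g \<le> (c\<^sup>2 - b\<^sup>2) / 4 - (c - b)\<^sup>2 / 4"
  proof -
    have "(c\<^sup>2 - b\<^sup>2) / 4 - b\<^sup>2 * g - (c - b)\<^sup>2 / 4 = t\<^sup>2 * ((U\<^sup>2 - B\<^sup>2) / 4 - B\<^sup>2 * g - (U - B)\<^sup>2 / 4)"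
      by (simp add: b_def c_def power2_eq_square field_simps)
    also have "(U\<^sup>2 - B\<^sup>2) / 4 - B\<^sup>2 * g - (U - B)\<^sup>2 / 4 = B * (U - B)\<^sup>2 / (2 * (U + B))"
      using UB by (simp add: g_def divide_simps) (simp add: power2_eq_square algebra_simps)
    also have "t\<^sup>2 * \<dots> \<ge> 0" using assms UB by (intro mult_nonneg_nonneg divide_nonneg_nonneg) auto
    finally show ?thesis by linarith
  qed
  have g2: "g\<^sup>2 \<le> 1" using g1 by (simp add: abs_square_le_1)
  have cross: "2 * (a - b) * r \<le> 8 * (a - b)\<^sup>2 + r\<^sup>2 / 8"
  proof -
    have "8 * (a - b)\<^sup>2 + r\<^sup>2 / 8 - 2 * (a - b) * r = (8 * (a - b) - r)\<^sup>2 / 8"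
      by (simp add: power2_eq_square field_simps)
    also have "\<dots> \<ge> 0" by simp
    finally show ?thesis by simp
  qed
  have ag: "a\<^sup>2 * g \<le> (c\<^sup>2 - b\<^sup>2) / 4 - (c - b)\<^sup>2 / 8 + 9 * (a - b)\<^sup>2"
  proof -
    have "a\<^sup>2 * g = b\<^sup>2 * g + 2 * (a - b) * r + (a - b)\<^sup>2 * g"
      by (simp add: r_def power2_eq_square algebra_simps)
    moreover have "(a - b)\<^sup>2 * g \<le> (a - b)\<^sup>2 * 1" using g1 by (intro mult_left_mono) auto
    ultimately show ?thesis using bg cross r2 by (simp add: field_simps)
  qed
  have ag2: "a\<^sup>2 * g\<^sup>2 \<le> 2 * (c - b)\<^sup>2 + 2 * (a - b)\<^sup>2"
  proof -
    have "a\<^sup>2 \<le> 2 * b\<^sup>2 + 2 * (a - b)\<^sup>2"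
      using zero_le_power2[of "a - 2 * b"] by (simp add: power2_eq_square algebra_simps)
    then have "a\<^sup>2 * g\<^sup>2 \<le> (2 * b\<^sup>2 + 2 * (a - b)\<^sup>2) * g\<^sup>2" by (rule mult_right_mono) simp
    also have "\<dots> = 2 * r\<^sup>2 + 2 * ((a - b)\<^sup>2 * g\<^sup>2)" by (simp add: r_def power2_eq_square algebra_simps)
    also have "(a - b)\<^sup>2 * g\<^sup>2 \<le> (a - b)\<^sup>2 * 1" using g2 by (intro mult_left_mono) auto
    finally show ?thesis using r2 by simp
  qed
  have "exp (g / 32) - 1 \<le> g / 32 + (g / 32)\<^sup>2"
    using exp_le_quadratic[of "g / 32"] g1 by simp
  then have "32 * a\<^sup>2 * (exp (g / 32) - 1) \<le> 32 * a\<^sup>2 * (g / 32 + (g / 32)\<^sup>2)"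
    by (intro mult_left_mono) auto
  also have "\<dots> = a\<^sup>2 * g + a\<^sup>2 * g\<^sup>2 / 32" by (simp add: power2_eq_square field_simps)
  finally show ?thesis using ag ag2 zero_le_power2[of "a - b"] unfolding b_def[symmetric] c_def[symmetric]
    by linarith
qed

text \<open>
  The value 1 outside \<open>S\<close> is the supremum of the scores: it amounts to the upper bracket \<open>\<infinity>\<close> there.
\<close>

definition bracket_score :: "real set \<Rightarrow> (real \<Rightarrow> real) \<Rightarrow> (real \<Rightarrow> real) \<Rightarrow> real \<Rightarrow> real" where
  "bracket_score S u q\<^sub>0 x =
     (if x \<in> S then (sqrt (u x) - sqrt (q\<^sub>0 x)) / (sqrt (u x) + sqrt (q\<^sub>0 x)) else 1)"

lemma bracket_score_measurable [measurable]:
  assumes [measurable]: "S \<in> sets borel" "u \<in> borel_measurable borel" "q\<^sub>0 \<in> borel_measurable borel"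
  shows "bracket_score S u q\<^sub>0 \<in> borel_measurable borel"
  unfolding bracket_score_def[abs_def] by measurable

lemma bracket_score_abs_le_1:
  assumes "0 \<le> u x" "0 < q\<^sub>0 x"
  shows "\<bar>bracket_score S u q\<^sub>0 x\<bar> \<le> 1"
proof -
  define a b where "a = sqrt (u x)" and "b = sqrt (q\<^sub>0 x)"
  have "0 \<le> a" "0 < b" using assms by (auto simp: a_def b_def)
  then have "\<bar>(a - b) / (a + b)\<bar> \<le> 1" by (simp add: abs_le_iff divide_simps)
  then show ?thesis by (simp add: bracket_score_def a_def b_def)
qed

text \<open>
  The competitor \<open>q\<close> itself appears in the drift instead of its bracket \<open>u\<close>. On \<open>S\<close> the two differ by at
  most \<open>v\<close>. Outside \<open>S\<close> the density \<open>q\<close> may be large, but there the term \<open>s * (q - q\<^sub>0) / 4\<close>, which has integral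
  zero in total, absorbs the squared difference up to a multiple of \<open>s * q\<^sub>0\<close>.
\<close>

lemma bracket_pointwise:
  fixes p s q\<^sub>0 q u v :: real
  assumes "0 \<le> p" "0 \<le> s" "0 < q\<^sub>0" "0 \<le> q" "0 \<le> v" and b: "x \<in> S \<Longrightarrow> q \<le> u \<and> u \<le> q + v"
    and g: "g = (if x \<in> S then (sqrt u - sqrt q\<^sub>0) / (sqrt u + sqrt q\<^sub>0) else 1)"
  shows "32 * (p * (exp (g / 32) - 1)) \<le> s * (q - q\<^sub>0) / 4 - (sqrt (s * q\<^sub>0) - sqrt (s * q))\<^sup>2 / 32
    + 10 * (sqrt p - sqrt (s * q\<^sub>0))\<^sup>2 + s * v + 5 * (s * (indicator (- S) x * q\<^sub>0))"
proof (cases "x \<in> S")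
  case True
  have qu: "0 \<le> u" "q \<le> u" "u \<le> q + v" using b[OF True] assms by auto
  define c d e where "c = sqrt (s * u)" and "d = sqrt (s * q)" and "e = sqrt (s * q\<^sub>0)"
  have "32 * (sqrt p)\<^sup>2 * (exp (g / 32) - 1)
    \<le> ((sqrt s * sqrt u)\<^sup>2 - (sqrt s * sqrt q\<^sub>0)\<^sup>2) / 4 - (sqrt s * sqrt u - sqrt s * sqrt q\<^sub>0)\<^sup>2 / 16
      + 10 * (sqrt p - sqrt s * sqrt q\<^sub>0)\<^sup>2"
    using score_pointwise[of "sqrt s" "sqrt q\<^sub>0" "sqrt u" "sqrt p"] True g assms qu by auto
  then have 1: "32 * (p * (exp (g / 32) - 1)) \<le> (s * u - s * q\<^sub>0) / 4 - (c - e)\<^sup>2 / 16 + 10 * (sqrt p - e)\<^sup>2"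
    using assms qu by (simp add: c_def e_def real_sqrt_mult power_mult_distrib mult.assoc)
  have "(e - d)\<^sup>2 \<le> 2 * (c - e)\<^sup>2 + 2 * (c - d)\<^sup>2"
    using zero_le_power2[of "2 * c - d - e"] by (simp add: power2_eq_square algebra_simps)
  moreover have "(c - d)\<^sup>2 \<le> s * v"
  proof -
    have "(c - d)\<^sup>2 \<le> \<bar>s * u - s * q\<bar>" unfolding c_def d_def
      using assms qu by (intro sqrt_diff_sq_le) auto
    also have "\<dots> = s * (u - q)" using assms qu by (simp add: right_diff_distrib[symmetric] abs_mult)
    also have "\<dots> \<le> s * v" using assms qu by (intro mult_left_mono) auto
    finally show ?thesis .
  qed
  moreover have "s * u \<le> s * q + s * v"
    using mult_left_mono[of u "q + v" s] qu assms by (simp add: algebra_simps)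
  moreover have "0 \<le> s * v" using assms by simp
  moreover have "s * (q - q\<^sub>0) = s * q - s * q\<^sub>0" by (simp add: right_diff_distrib)
  moreover have "s * (indicator (- S) x * q\<^sub>0) = 0" using True by simp
  moreover have "L \<le> s * (q - q\<^sub>0) / 4 - W / 32 + 10 * Y + s * v + 5 * Z"
    if "W \<le> 2 * M + 2 * N" "N \<le> s * v" "s * u \<le> s * q + s * v" "0 \<le> s * v"
      "s * (q - q\<^sub>0) = s * q - s * q\<^sub>0" "Z = 0" "L \<le> (s * u - s * q\<^sub>0) / 4 - M / 16 + 10 * Y"
    for L W Y Z M N :: real
    using that by (simp only: diff_divide_distrib)
  ultimately show ?thesis using 1 unfolding d_def[symmetric] e_def[symmetric] by blast
next
  case False
  define d e where "d = sqrt (s * q)" and "e = sqrt (s * q\<^sub>0)"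
  have de: "d\<^sup>2 = s * q" "e\<^sup>2 = s * q\<^sub>0" using assms by (auto simp: d_def e_def)
  have "exp (g / 32) - 1 \<le> 1 / 16"
    using exp_le_quadratic[of "g / 32"] False g by (simp add: power2_eq_square)
  then have "32 * (p * (exp (g / 32) - 1)) \<le> 2 * p"
    using mult_left_mono[of "exp (g / 32) - 1" "1 / 16" p] assms by simp
  also have "\<dots> \<le> 4 * e\<^sup>2 + 4 * (sqrt p - e)\<^sup>2"
    using zero_le_power2[of "sqrt p - 2 * e"] assms by (simp add: power2_eq_square algebra_simps)
  also have "\<dots> \<le> 4 * e\<^sup>2 + 10 * (sqrt p - e)\<^sup>2" by simp
  finally have 1: "32 * (p * (exp (g / 32) - 1)) \<le> 4 * e\<^sup>2 + 10 * (sqrt p - e)\<^sup>2" .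
  have "(e - d)\<^sup>2 \<le> 2 * d\<^sup>2 + 2 * e\<^sup>2"
    using zero_le_power2[of "d + e"] by (simp add: power2_eq_square algebra_simps)
  moreover have "s * (q - q\<^sub>0) = d\<^sup>2 - e\<^sup>2" by (simp add: de algebra_simps)
  moreover have "0 \<le> s * v" using assms by simp
  moreover have "s * (indicator (- S) x * q\<^sub>0) = e\<^sup>2" using False de by simp
  ultimately show ?thesis using 1 zero_le_power2[of d] zero_le_power2[of e]
    unfolding d_def[symmetric] e_def[symmetric] by linarith
qed

lemma lborel_prob_density_transfer:
  fixes f :: "real \<Rightarrow> real"
  assumes "sets \<nu> = sets borel" "s \<in> borel_measurable borel" "\<And>x. 0 \<le> s x" "lborel = density \<nu> (\<lambda>x. ennreal (s x))"
    "integrable lborel f" "\<And>x. 0 \<le> f x"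
  shows "integrable \<nu> (\<lambda>x. s x * f x)" "(\<integral>x. s x * f x \<partial>\<nu>) = (\<integral>x. f x \<partial>lborel)"
    "density lborel f = density \<nu> (\<lambda>x. s x * f x)"
proof -
  note B [simp] = borel_measurable_sets_eq[OF assms(1)]
  have [measurable]: "f \<in> borel_measurable borel" using borel_measurable_integrable[OF assms(5)] by simp
  show "integrable \<nu> (\<lambda>x. s x * f x)"
    using assms(5) unfolding assms(4)
    by (subst (asm) integrable_real_density) (use assms B in auto)
  show "(\<integral>x. s x * f x \<partial>\<nu>) = (\<integral>x. f x \<partial>lborel)"
    unfolding assms(4) by (subst integral_real_density) (use assms B in auto)
  show "density lborel f = density \<nu> (\<lambda>x. s x * f x)"
    unfolding assms(4) using assms B by (subst density_density_eq) (auto simp: ennreal_mult)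
qed

lemma bracket_exponential_moment:
  fixes q\<^sub>0 q u v :: "real \<Rightarrow> real"
  assumes P: "P \<in> real_distributions" and S [measurable]: "S \<in> sets borel"
    and q0: "integrable lborel q\<^sub>0" "\<And>x. 0 < q\<^sub>0 x" "integral\<^sup>L lborel q\<^sub>0 = 1"
    and q: "integrable lborel q" "\<And>x. 0 \<le> q x" "integral\<^sup>L lborel q = 1"
    and u [measurable]: "u \<in> borel_measurable borel" and u0: "\<And>x. 0 \<le> u x"
    and v: "integrable lborel v" "\<And>x. 0 \<le> v x"
    and bracket: "\<And>x. x \<in> S \<Longrightarrow> q x \<le> u x \<and> u x \<le> q x + v x"
  shows "32 * ((\<integral>x. exp (bracket_score S u q\<^sub>0 x / 32) \<partial>P) - 1)
    \<le> integral\<^sup>L lborel v + 5 * mass (- S) q\<^sub>0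
       + 20 * hellinger_sq P (density lborel q\<^sub>0)
       - hellinger_sq (density lborel q\<^sub>0) (density lborel q) / 16"
proof -
  obtain \<nu> p s where \<nu>: "sets \<nu> = sets borel" "p \<in> borel_measurable borel" "s \<in> borel_measurable borel"
    "\<And>x. 0 \<le> p x" "\<And>x. 0 \<le> s x" "P = density \<nu> (\<lambda>x. ennreal (p x))"
    "lborel = density \<nu> (\<lambda>x. ennreal (s x))"
    by (rule dominating_measure_lborel[OF P]; rule that)
  note B [simp] = borel_measurable_sets_eq[OF \<nu>(1)]
  note [measurable] = \<nu>(2,3)
  have [measurable]: "q\<^sub>0 \<in> borel_measurable borel" "q \<in> borel_measurable borel" "v \<in> borel_measurable borel"
    using q0 q v by auto
  interpret P: prob_space P using P by (rule real_distributionsD)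
  have pP: "prob_space (density \<nu> p)" using P.prob_space_axioms \<nu> by simp
  note ip = integrable_prob_density[OF _ \<nu>(4) pP, unfolded B, OF \<nu>(2)]
  note tr = lborel_prob_density_transfer[OF \<nu>(1,3,5,7)]
  have i0: "integrable lborel (\<lambda>x. indicator (- S) x * q\<^sub>0 x)"
    using q0(1) by (rule integrable_indicator_mult) simp
  have q0': "0 \<le> q\<^sub>0 x" for x using q0(2)[of x] by simp
  have i0': "0 \<le> indicator (- S) x * q\<^sub>0 x" for x using q0' by simp
  note t0 = tr[OF q0(1) q0'] and tq = tr[OF q(1,2)] and tv = tr[OF v]
    and ti = tr(1,2)[OF i0 i0']
  have pq: "prob_space (density \<nu> (\<lambda>x. s x * q\<^sub>0 x))" "prob_space (density \<nu> (\<lambda>x. s x * q x))"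
    using prob_space_densityI[OF q0(1) q0' q0(3)] prob_space_densityI[OF q] t0 tq by auto
  let ?g = "bracket_score S u q\<^sub>0"
  have gb: "\<bar>?g x\<bar> \<le> 1" for x using u0 q0 by (intro bracket_score_abs_le_1) auto
  have [measurable]: "?g \<in> borel_measurable borel" by measurable
  have gle: "?g x \<le> 32" for x using gb[of x] by linarith
  have ig: "integrable P (\<lambda>x. exp (?g x / 32))"
    using gle \<nu>(1,6) B
    by (intro P.integrable_const_bound[where B="exp 1"]) auto
  have h1: "(\<integral>x. (sqrt (s x * q\<^sub>0 x) - sqrt (s x * q x))\<^sup>2 \<partial>\<nu>) = 2 * hellinger_sq (density lborel q\<^sub>0) (density lborel q)"
    unfolding t0 tq using \<nu> B q0' q pq by (subst hellinger_sq_density) auto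
  have h2: "(\<integral>x. (sqrt (p x) - sqrt (s x * q\<^sub>0 x))\<^sup>2 \<partial>\<nu>) = 2 * hellinger_sq P (density lborel q\<^sub>0)"
    unfolding t0 \<nu>(6) using \<nu> B q0' pq pP by (subst hellinger_sq_density) auto
  have ih1: "integrable \<nu> (\<lambda>x. (sqrt (s x * q\<^sub>0 x) - sqrt (s x * q x))\<^sup>2)"
    using t0 tq q0' q \<nu> by (intro integrable_sqrt_diff_sq) auto
  have ih2: "integrable \<nu> (\<lambda>x. (sqrt (p x) - sqrt (s x * q\<^sub>0 x))\<^sup>2)"
    using ip t0 q0' \<nu> by (intro integrable_sqrt_diff_sq) auto
  have ig': "integrable \<nu> (\<lambda>x. p x * (exp (?g x / 32) - 1))"
  proof -
    have "integrable P (\<lambda>x. exp (?g x / 32) - 1)" using ig by simp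
    then show ?thesis unfolding \<nu>(6) using \<nu> B by (subst (asm) integrable_real_density) auto
  qed
  have "32 * ((\<integral>x. exp (?g x / 32) \<partial>P) - 1) = 32 * (\<integral>x. exp (?g x / 32) - 1 \<partial>P)"
    using ig by (simp add: P.prob_space)
  also have "(\<integral>x. exp (?g x / 32) - 1 \<partial>P) = (\<integral>x. p x * (exp (?g x / 32) - 1) \<partial>\<nu>)"
    unfolding \<nu>(6) using \<nu> B by (subst integral_real_density) auto
  also have "32 * \<dots> = (\<integral>x. 32 * (p x * (exp (?g x / 32) - 1)) \<partial>\<nu>)" by simp
  also have "\<dots> \<le> (\<integral>x. (s x * q x - s x * q\<^sub>0 x) / 4 - (sqrt (s x * q\<^sub>0 x) - sqrt (s x * q x))\<^sup>2 / 32
    + 10 * (sqrt (p x) - sqrt (s x * q\<^sub>0 x))\<^sup>2 + s x * v x + 5 * (s x * (indicator (- S) x * q\<^sub>0 x)) \<partial>\<nu>)"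
  proof (rule integral_mono)
    show "integrable \<nu> (\<lambda>x. 32 * (p x * (exp (?g x / 32) - 1)))" using ig' by (rule integrable_mult_right)
    show "integrable \<nu> (\<lambda>x. (s x * q x - s x * q\<^sub>0 x) / 4 - (sqrt (s x * q\<^sub>0 x) - sqrt (s x * q x))\<^sup>2 / 32
        + 10 * (sqrt (p x) - sqrt (s x * q\<^sub>0 x))\<^sup>2 + s x * v x + 5 * (s x * (indicator (- S) x * q\<^sub>0 x)))"
      by (intro Bochner_Integration.integrable_add Bochner_Integration.integrable_diff
         integrable_divide integrable_mult_right ih1 ih2 t0(1) tq(1) tv(1) ti(1))
    show "32 * (p x * (exp (?g x / 32) - 1))
      \<le> (s x * q x - s x * q\<^sub>0 x) / 4 - (sqrt (s x * q\<^sub>0 x) - sqrt (s x * q x))\<^sup>2 / 32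
        + 10 * (sqrt (p x) - sqrt (s x * q\<^sub>0 x))\<^sup>2 + s x * v x + 5 * (s x * (indicator (- S) x * q\<^sub>0 x))" for x
      using bracket_pointwise[OF \<nu>(4)[of x] \<nu>(5)[of x] q0(2)[of x] q(2)[of x] v(2)[of x] bracket
          bracket_score_def[of S u q\<^sub>0 x]]
      unfolding right_diff_distrib[of "s x"] .
  qed
  also have "\<dots> = integral\<^sup>L lborel v + 5 * mass (- S) q\<^sub>0
       + 20 * hellinger_sq P (density lborel q\<^sub>0)
       - hellinger_sq (density lborel q\<^sub>0) (density lborel q) / 16"
    by (simp add: ih1 ih2 t0(1) tq(1) tv(1) ti(1) h1 h2 t0(2) tq(2) tv(2) ti(2) q(3) q0(3)
        del: integral_indicator)
  finally show ?thesis .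
qed

section \<open>Uniform deviations over a finite family\<close>

lemma iid_Chernoff:
  fixes f :: "real \<Rightarrow> real"
  assumes P: "P \<in> real_distributions" and f [measurable]: "f \<in> borel_measurable borel"
    and bound: "\<And>x. \<bar>f x\<bar> \<le> 1"
  shows "measure (PiM {..<n} (\<lambda>_. P)) {X \<in> space (PiM {..<n} (\<lambda>_. P)).
      real n * ((\<integral>x. exp (f x) \<partial>P) - 1) + t \<le> (\<Sum>i<n. f (X i))} \<le> exp (- t)"
proof -
  note PD = real_distributionsD[OF P]
  interpret P: prob_space P by (rule PD)
  note B [simp] = borel_measurable_sets_eq[OF PD(3)]
  have [measurable]: "f \<in> borel_measurable P" using B by simp
  interpret product_sigma_finite "\<lambda>_::nat. P"
    by unfold_locales
  interpret Pn: prob_space "PiM {..<n} (\<lambda>_. P)" by (rule prob_space_PiM) (rule PD)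
  let ?M = "PiM {..<n} (\<lambda>_. P)"
  define m where "m = (\<integral>x. exp (f x) \<partial>P)"
  have ie: "integrable P (\<lambda>x. exp (f x))"
    using bound abs_le_D1[OF bound] by (intro P.integrable_const_bound[where B="exp 1"]) auto
  have prod: "(\<integral>X. (\<Prod>i<n. exp (f (X i))) \<partial>?M) = m ^ n"
    using product_integral_prod[of "{..<n}" "\<lambda>_ x. exp (f x)"] ie by (simp add: m_def)
  have sum_bd: "(\<Sum>i<n. f (X i)) \<le> real n" for X
    using sum_mono[of "{..<n}" "\<lambda>i. f (X i)" "\<lambda>_. 1"] abs_le_D1[OF bound] by simp
  have iS: "integrable ?M (\<lambda>X. exp (\<Sum>i<n. f (X i)))"
    using sum_bd by (intro Pn.integrable_const_bound[where B="exp (real n)"]) auto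
  let ?a = "real n * (m - 1) + t"
  have "measure ?M {X \<in> space ?M. ?a \<le> (\<Sum>i<n. f (X i))} \<le>
      exp (- 1 * ?a) * (\<integral>X\<in>space ?M. exp (1 * (\<Sum>i<n. f (X i))) \<partial>?M)"
    using iS by (intro Pn.Chernoff_ineq_ge) (auto simp: set_integrable_def cong: Bochner_Integration.integrable_cong)
  also have "(\<integral>X\<in>space ?M. exp (1 * (\<Sum>i<n. f (X i))) \<partial>?M) = (\<integral>X. (\<Prod>i<n. exp (f (X i))) \<partial>?M)"
    by (subst set_integral_space) (use iS in \<open>simp_all add: exp_sum\<close>)
  also have "exp (- 1 * ?a) * \<dots> \<le> exp (- 1 * ?a) * exp (real n * (m - 1))"
  proof -
    have "0 \<le> m" unfolding m_def by simp
    then have "m ^ n \<le> exp (m - 1) ^ n" using exp_ge_add_one_self[of "m - 1"] by (intro power_mono) auto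
    then show ?thesis unfolding prod by (simp add: exp_of_nat_mult[symmetric])
  qed
  also have "\<dots> = exp (- t)" by (simp add: exp_add[symmetric])
  finally show ?thesis unfolding m_def .
qed

lemma iid_uniform_deviation:
  fixes f :: "'b \<Rightarrow> real \<Rightarrow> real"
  assumes P: "P \<in> real_distributions" and f: "\<And>j. j \<in> J \<Longrightarrow> f j \<in> borel_measurable borel"
    and bound: "\<And>j x. j \<in> J \<Longrightarrow> \<bar>f j x\<bar> \<le> 1" and J: "finite J" "J \<noteq> {}"
  obtains E where "E \<in> sets (PiM {..<n} (\<lambda>_. P))" "measure (PiM {..<n} (\<lambda>_. P)) E \<ge> 1 - exp (- \<xi>)"
    "\<And>X j. X \<in> E \<Longrightarrow> j \<in> J \<Longrightarrow>
       (\<Sum>i<n. f j (X i)) \<le> real n * ((\<integral>x. exp (f j x) \<partial>P) - 1) + \<xi> + ln (real (card J))"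
proof -
  note PD = real_distributionsD[OF P]
  let ?M = "PiM {..<n} (\<lambda>_. P)"
  interpret Pn: prob_space ?M by (rule prob_space_PiM) (rule PD)
  note B [simp] = borel_measurable_sets_eq[OF PD(3)]
  define t where "t = \<xi> + ln (real (card J))"
  define bad where "bad j = {X \<in> space ?M. real n * ((\<integral>x. exp (f j x) \<partial>P) - 1) + t \<le> (\<Sum>i<n. f j (X i))}" for j
  have bad_m: "bad j \<in> sets ?M" if "j \<in> J" for j
  proof -
    have [measurable]: "f j \<in> borel_measurable P" using f[OF that] B by simp
    show ?thesis unfolding bad_def by measurable
  qed
  have cJ: "real (card J) > 0" using J by (simp add: card_gt_0_iff)
  have "measure ?M (\<Union>j\<in>J. bad j) \<le> (\<Sum>j\<in>J. measure ?M (bad j))"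
    using J bad_m by (intro Pn.finite_measure_subadditive_finite) auto
  also have "\<dots> \<le> (\<Sum>j\<in>J. exp (- t))"
    unfolding bad_def by (intro sum_mono iid_Chernoff[OF P f bound])
  also have "\<dots> = exp (- \<xi>)"
    using cJ by (simp add: t_def exp_diff exp_minus field_simps exp_add)
  finally have "measure ?M (\<Union>j\<in>J. bad j) \<le> exp (- \<xi>)" .
  moreover have U: "(\<Union>j\<in>J. bad j) \<in> sets ?M" using J bad_m by auto
  ultimately have "measure ?M (space ?M - (\<Union>j\<in>J. bad j)) \<ge> 1 - exp (- \<xi>)"
    by (simp add: Pn.prob_compl)
  then show thesis
    using U by (intro that[of "space ?M - (\<Union>j\<in>J. bad j)"]) (auto simp: bad_def t_def)
qed

section \<open>Gaussian densities: bounds, brackets and tails\<close>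

text \<open>
  The density with mean \<open>z\<close> and standard deviation \<open>1 / \<tau>\<close>. In this parametrisation the density is Lipschitz
  in \<open>\<tau>\<close> uniformly on the line, and the value at \<open>\<tau> = 0\<close> is the limit of flat densities.
\<close>

definition gauss_kernel :: "real \<Rightarrow> real \<Rightarrow> real \<Rightarrow> real" where
  "gauss_kernel \<tau> z x = \<tau> * std_normal_density (\<tau> * (x - z))"

lemma normal_density_eq_gauss_kernel:
  assumes "\<sigma> > 0" "s > 0"
  shows "normal_density z \<sigma> x = gauss_kernel (s / \<sigma>) ((z - l) / s) ((x - l) / s) / s"
proof -
  have "s / \<sigma> * ((x - l) / s - (z - l) / s) = (x - z) / \<sigma>"
    using assms by (simp add: field_simps)
  then show ?thesis
    using assms by (simp add: gauss_kernel_def normal_density_def real_sqrt_mult power_divide mult_ac)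
qed

lemma gauss_kernel_0 [simp]: "gauss_kernel 0 z x = 0"
  by (simp add: gauss_kernel_def)

lemma gauss_kernel_nonneg: "0 \<le> \<tau> \<Longrightarrow> 0 \<le> gauss_kernel \<tau> z x"
  by (simp add: gauss_kernel_def)

lemma std_normal_density_le_half: "std_normal_density t \<le> 1 / 2"
proof -
  have "2 = sqrt (2\<^sup>2)" by (simp only: real_sqrt_abs)
  also have "\<dots> \<le> sqrt (2 * pi)" using pi_ge_two by (intro real_sqrt_le_mono) simp
  finally have "std_normal_density t \<le> 1 / 2 * 1"
    unfolding std_normal_density_def by (intro mult_mono) (auto simp: field_simps)
  then show ?thesis by simp
qed

lemma sq_times_std_normal_density_le: "t\<^sup>2 * std_normal_density t \<le> 1"
proof -
  have "t\<^sup>2 / 2 \<le> exp (t\<^sup>2 / 2)" using exp_ge_add_one_self[of "t\<^sup>2 / 2"] by linarith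
  then have "t\<^sup>2 * exp (- t\<^sup>2 / 2) \<le> 2" by (simp add: exp_minus field_simps)
  moreover have "1 / sqrt (2 * pi) \<le> 1 / 2" using std_normal_density_le_half[of 0] by (simp add: std_normal_density_def)
  ultimately have "1 / sqrt (2 * pi) * (t\<^sup>2 * exp (- t\<^sup>2 / 2)) \<le> 1 / 2 * 2"
    by (intro mult_mono) auto
  then show ?thesis by (simp add: std_normal_density_def mult_ac)
qed

lemma DERIV_std_normal_density:
  "(std_normal_density has_real_derivative (- t * std_normal_density t)) (at t within A)"
proof -
  have "((\<lambda>t. c * exp (- t\<^sup>2 / 2)) has_real_derivative c * (exp (- t\<^sup>2 / 2) * (- t))) (at t within A)" for c
    by (auto intro!: derivative_eq_intros)
  from this[of "1 / sqrt (2 * pi)"]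
  have "((\<lambda>t. (1 / sqrt (2 * pi)) * exp (- t\<^sup>2 / 2)) has_real_derivative
      (1 / sqrt (2 * pi)) * (exp (- t\<^sup>2 / 2) * (- t))) (at t within A)" .
  moreover have "(1 / sqrt (2 * pi)) * (exp (- t\<^sup>2 / 2) * (- t)) = - t * std_normal_density t"
    by (simp only: std_normal_density_def mult_ac)
  ultimately show ?thesis by (simp only: std_normal_density_def[abs_def])
qed

lemma std_normal_density_Lipschitz: "\<bar>std_normal_density a - std_normal_density b\<bar> \<le> \<bar>a - b\<bar>"
proof -
  have "\<bar>- t * std_normal_density t\<bar> \<le> 1" for t
  proof -
    have "\<bar>t\<bar> \<le> (1 + t\<^sup>2) / 2" using zero_le_power2[of "\<bar>t\<bar> - 1"] by (simp add: power2_eq_square algebra_simps)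
    then have "\<bar>t\<bar> * std_normal_density t \<le> (1 + t\<^sup>2) / 2 * std_normal_density t"
      by (intro mult_right_mono) auto
    also have "\<dots> \<le> 1" using sq_times_std_normal_density_le[of t] std_normal_density_le_half[of t]
      by (simp add: algebra_simps)
    finally show ?thesis by (simp add: abs_mult)
  qed
  from field_differentiable_bound[OF convex_UNIV DERIV_std_normal_density, of 1 a b] this
  show ?thesis by simp
qed

lemma dilated_std_normal_density_Lipschitz:
  "\<bar>a * std_normal_density (a * y) - b * std_normal_density (b * y)\<bar> \<le> \<bar>a - b\<bar>"
proof -
  let ?d = "\<lambda>\<tau>. (1 - (\<tau> * y)\<^sup>2) * std_normal_density (\<tau> * y)"
  have "((\<lambda>\<tau>. \<tau> * std_normal_density (\<tau> * y)) has_real_derivative ?d \<tau>) (at \<tau>)" for \<tau>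
  proof -
    have "((\<lambda>\<tau>. std_normal_density (\<tau> * y)) has_real_derivative - (\<tau> * y) * std_normal_density (\<tau> * y) * y) (at \<tau>)"
      by (rule DERIV_chain2[OF DERIV_std_normal_density]) (auto intro!: derivative_eq_intros)
    from DERIV_mult[OF DERIV_ident this] show ?thesis
      by (rule DERIV_cong) (simp add: power2_eq_square algebra_simps)
  qed
  moreover have "\<bar>?d \<tau>\<bar> \<le> 1" for \<tau>
  proof -
    have "0 \<le> (\<tau> * y)\<^sup>2 * std_normal_density (\<tau> * y)" by simp
    with sq_times_std_normal_density_le[of "\<tau> * y"] std_normal_density_le_half[of "\<tau> * y"]
      normal_density_nonneg[of 0 1 "\<tau> * y"]
    show ?thesis unfolding abs_le_iff left_diff_distrib by linarith
  qed
  ultimately show ?thesis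
    using field_differentiable_bound[OF convex_UNIV, of "\<lambda>\<tau>. \<tau> * std_normal_density (\<tau> * y)" ?d 1 a b]
    by auto
qed

lemma gauss_kernel_Lipschitz:
  assumes "0 \<le> \<tau>"
  shows "\<bar>gauss_kernel \<tau> z x - gauss_kernel \<tau>' z' x\<bar> \<le> \<bar>\<tau> - \<tau>'\<bar> + \<tau>\<^sup>2 * \<bar>z - z'\<bar>"
proof -
  have "\<bar>gauss_kernel \<tau> z x - gauss_kernel \<tau> z' x\<bar> \<le> \<tau> * \<bar>\<tau> * (x - z) - \<tau> * (x - z')\<bar>"
    using mult_left_mono[OF std_normal_density_Lipschitz[of "\<tau> * (x - z)" "\<tau> * (x - z')"] assms] assms
    by (simp add: gauss_kernel_def right_diff_distrib[symmetric] abs_mult)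
  also have "\<dots> = \<tau>\<^sup>2 * \<bar>z - z'\<bar>"
    using assms by (simp add: right_diff_distrib[symmetric] abs_mult power2_eq_square abs_minus_commute mult.assoc)
  finally show ?thesis
    using dilated_std_normal_density_Lipschitz[of \<tau> "x - z'" \<tau>'] by (simp add: gauss_kernel_def)
qed

lemma gauss_kernel_le: "0 \<le> \<tau> \<Longrightarrow> gauss_kernel \<tau> z x \<le> \<tau>"
  using mult_left_mono[OF std_normal_density_le_half, of \<tau> "\<tau> * (x - z)"]
  by (simp add: gauss_kernel_def)

lemma gauss_kernel_le_inverse_square:
  assumes "0 < \<tau>\<^sub>0" "\<tau>\<^sub>0 \<le> \<tau>" "0 < r" "r \<le> \<bar>x - z\<bar>"
  shows "gauss_kernel \<tau> z x \<le> 1 / (\<tau>\<^sub>0 * r\<^sup>2)"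
proof -
  have r2: "r\<^sup>2 \<le> (x - z)\<^sup>2" using assms power_mono[of r "\<bar>x - z\<bar>" 2] by simp
  have "(\<tau>\<^sub>0 * r\<^sup>2) * gauss_kernel \<tau> z x \<le> (\<tau> * (x - z)\<^sup>2) * gauss_kernel \<tau> z x"
    using assms r2 by (intro mult_right_mono mult_mono gauss_kernel_nonneg) auto
  also have "\<dots> = (\<tau> * (x - z))\<^sup>2 * std_normal_density (\<tau> * (x - z))"
    by (simp add: gauss_kernel_def power2_eq_square)
  also have "\<dots> \<le> 1" by (rule sq_times_std_normal_density_le)
  finally show ?thesis using assms by (simp add: field_simps)
qed

text \<open>
  A polynomial number of brackets covers all Gaussian densities on \<open>[-N, N]\<close>. Very flat and very
  distant components are below the additive slack \<open>1 / N ^ 4\<close>; so is a very narrow component, except in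
  the immediate neighbourhood of its centre, which is removed; the remaining parameters lie in a compact
  set, where the kernel is Lipschitz. Removing a neighbourhood of the grid point in all cases
  keeps the form of the brackets uniform. The powers of \<open>N\<close> are not optimised, since only their logarithm matters;
  the condition \<open>8 \<le> N\<close> lets them absorb numerical constants.
\<close>

lemma gauss_kernel_bracket:
  fixes N :: nat
  assumes N: "8 \<le> N" and \<tau>: "0 < \<tau>"
  obtains i :: nat and j :: int where "i \<le> N ^ 15" "\<bar>j\<bar> \<le> int N ^ 30"
    "\<And>x. \<bar>x\<bar> \<le> real N \<Longrightarrow> 1 / (2 * real N ^ 2) < \<bar>x - of_int j / real N ^ 25\<bar> \<Longrightarrow>
      gauss_kernel \<tau> z x \<le> 1 / real N ^ 4 + gauss_kernel (real i / real N ^ 5) (of_int j / real N ^ 25) x \<and>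
      1 / real N ^ 4 + gauss_kernel (real i / real N ^ 5) (of_int j / real N ^ 25) x
        \<le> gauss_kernel \<tau> z x + 2 / real N ^ 4"
proof -
  define M where "M = real N"
  have M: "8 \<le> M" using N by (simp add: M_def)
  note bracketI = that
  \<comment> \<open>The constant bracket, with \<open>i = 0\<close>, serves whenever the density is small off the removed interval.\<close>
  have flat: thesis if "\<bar>j\<bar> \<le> int N ^ 30"
    "\<And>x. \<bar>x\<bar> \<le> M \<Longrightarrow> 1 / (2 * M ^ 2) < \<bar>x - of_int j / M ^ 25\<bar> \<Longrightarrow> gauss_kernel \<tau> z x \<le> 1 / M ^ 4"
    for j :: int
  proof (rule bracketI[of 0 j, OF _ that(1)])
    fix x assume "\<bar>x\<bar> \<le> real N" "1 / (2 * real N ^ 2) < \<bar>x - of_int j / real N ^ 25\<bar>"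
    with that(2)[of x] gauss_kernel_nonneg[of \<tau> z x] \<tau>
    have "gauss_kernel \<tau> z x \<le> 1 / real N ^ 4" "0 \<le> gauss_kernel \<tau> z x" "0 \<le> 1 / real N ^ 4"
      "2 / real N ^ 4 = 1 / real N ^ 4 + 1 / real N ^ 4"
      by (auto simp: M_def)
    then show "gauss_kernel \<tau> z x \<le> 1 / real N ^ 4 + gauss_kernel (real 0 / real N ^ 5) (of_int j / real N ^ 25) x \<and>
      1 / real N ^ 4 + gauss_kernel (real 0 / real N ^ 5) (of_int j / real N ^ 25) x
        \<le> gauss_kernel \<tau> z x + 2 / real N ^ 4" by simp
  qed simp
  define j where "j = \<lfloor>z * M ^ 25\<rfloor>"
  have zM: "\<bar>z * M ^ 25\<bar> < M ^ 30" if "\<bar>z\<bar> < M ^ 5" using that M mult_strict_right_mono[of "\<bar>z\<bar>" "M ^ 5" "M ^ 25"]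
    by (simp add: abs_mult power_add[symmetric])
  have j: "\<bar>j\<bar> \<le> int N ^ 30" if "\<bar>z\<bar> < M ^ 5"
  proof -
    have "z * M ^ 25 < of_int (int N ^ 30) + 1" "of_int (- (int N ^ 30)) \<le> z * M ^ 25"
      using zM[OF that] unfolding M_def by (auto simp: abs_less_iff)
    then have "j \<le> int N ^ 30" "- (int N ^ 30) \<le> j" unfolding j_def floor_le_iff le_floor_iff .
    then show ?thesis by simp
  qed
  have dz: "\<bar>z - of_int j / M ^ 25\<bar> \<le> 1 / M ^ 25"
  proof -
    have "\<bar>z * M ^ 25 - of_int j\<bar> \<le> 1" unfolding j_def by linarith
    moreover have "z - of_int j / M ^ 25 = (z * M ^ 25 - of_int j) / M ^ 25" using M by (simp add: field_simps)
    ultimately show ?thesis using M by (simp add: divide_right_mono)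
  qed
  consider "\<tau> \<le> 1 / M ^ 4" | "1 / M ^ 4 \<le> \<tau>" "M ^ 5 \<le> \<bar>z\<bar>" | "\<bar>z\<bar> < M ^ 5" "M ^ 10 \<le> \<tau>"
    | "\<bar>z\<bar> < M ^ 5" "\<tau> < M ^ 10" by linarith
  then show thesis
  proof cases
    case 1
    show thesis
      by (rule flat[of 0]) (use 1 gauss_kernel_le[of \<tau> z] \<tau> in \<open>auto intro: order.trans\<close>)
  next
    case 2
    have M4: "M ^ 4 \<le> M ^ 5 - M"
    proof -
      have "M * 1 \<le> M * M ^ 3" using M by (intro mult_left_mono one_le_power) auto
      moreover have "M * M ^ 3 = M ^ 4" by (simp add: power_numeral_reduce)
      moreover have "8 * M ^ 4 \<le> M * M ^ 4" using M by (intro mult_right_mono) auto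
      moreover have "M * M ^ 4 = M ^ 5" by (simp add: power_numeral_reduce)
      moreover have "0 \<le> M ^ 4" using M by simp
      ultimately show ?thesis by linarith
    qed
    show thesis
    proof (rule flat[of 0])
      fix x assume "\<bar>x\<bar> \<le> M"
      then have "M ^ 4 \<le> \<bar>x - z\<bar>" using 2 M4 by linarith
      then have "gauss_kernel \<tau> z x \<le> 1 / (1 / M ^ 4 * (M ^ 4)\<^sup>2)"
        using 2 M by (intro gauss_kernel_le_inverse_square) auto
      also have "1 / M ^ 4 * (M ^ 4)\<^sup>2 = M ^ 4"
      proof -
        have "1 / a * a\<^sup>2 = a" if "a \<noteq> 0" for a :: real using that by (simp add: power2_eq_square)
        from this[of "M ^ 4"] show ?thesis using M by simp
      qed
      finally show "gauss_kernel \<tau> z x \<le> 1 / M ^ 4" .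
    qed simp
  next
    case 3
    have small: "1 / M ^ 25 \<le> 1 / (4 * M\<^sup>2)"
    proof -
      have "4 * M\<^sup>2 \<le> M * M\<^sup>2" using M by (intro mult_right_mono) auto
      also have "\<dots> = M ^ 3" by (simp add: power_numeral_reduce)
      also have "\<dots> \<le> M ^ 25" using M by (intro power_increasing) auto
      finally show ?thesis using M by (intro divide_left_mono) auto
    qed
    show thesis
    proof (rule flat[OF j[OF 3(1)]])
      fix x assume "1 / (2 * M\<^sup>2) < \<bar>x - of_int j / M ^ 25\<bar>"
      moreover have "1 / (2 * M\<^sup>2) = 2 * (1 / (4 * M\<^sup>2))" by simp
      ultimately have "1 / (4 * M\<^sup>2) \<le> \<bar>x - z\<bar>" using dz small by linarith
      then have "gauss_kernel \<tau> z x \<le> 1 / (M ^ 10 * (1 / (4 * M\<^sup>2))\<^sup>2)"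
        using 3 M by (intro gauss_kernel_le_inverse_square) auto
      also have "\<dots> = 16 / M ^ 6"
        using M by (simp add: field_simps power2_eq_square power_numeral_reduce)
      also have "\<dots> \<le> M\<^sup>2 / M ^ 6"
        using M power_mono[of 4 M 2] by (intro divide_right_mono) auto
      also have "\<dots> = 1 / M ^ 4" using M by (simp add: field_simps power_add[symmetric])
      finally show "gauss_kernel \<tau> z x \<le> 1 / M ^ 4" .
    qed
  next
    case 4
    define i where "i = nat \<lfloor>\<tau> * M ^ 5\<rfloor>"
    have tM: "0 \<le> \<tau> * M ^ 5" "\<tau> * M ^ 5 \<le> M ^ 15"
      using 4 M \<tau> mult_right_mono[of \<tau> "M ^ 10" "M ^ 5"] by (auto simp: power_add[symmetric])
    have ri: "real i = of_int \<lfloor>\<tau> * M ^ 5\<rfloor>" using tM by (simp add: i_def)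
    have "real i \<le> real (N ^ 15)" using tM ri unfolding M_def by (auto intro: order.trans[OF of_int_floor_le])
    then have i: "i \<le> N ^ 15" by (simp only: of_nat_le_iff)
    have dt: "\<bar>\<tau> - real i / M ^ 5\<bar> \<le> 1 / M ^ 5"
    proof -
      have "\<bar>\<tau> * M ^ 5 - real i\<bar> \<le> 1" unfolding ri by linarith
      moreover have "\<tau> - real i / M ^ 5 = (\<tau> * M ^ 5 - real i) / M ^ 5" using M by (simp add: field_simps)
      ultimately show ?thesis using M by (simp add: divide_right_mono)
    qed
    have tz: "\<tau>\<^sup>2 * \<bar>z - of_int j / M ^ 25\<bar> \<le> 1 / M ^ 5"
    proof -
      have "\<tau>\<^sup>2 \<le> (M ^ 10)\<^sup>2" using 4 \<tau> by (intro power_mono) auto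
      then have "\<tau>\<^sup>2 * \<bar>z - of_int j / M ^ 25\<bar> \<le> (M ^ 10)\<^sup>2 * (1 / M ^ 25)"
        using dz by (intro mult_mono) auto
      also have "\<dots> = 1 / M ^ 5" using M by (simp add: field_simps power_add[symmetric] power_mult[symmetric])
      finally show ?thesis .
    qed
    have M5: "1 / M ^ 5 + 1 / M ^ 5 \<le> 1 / M ^ 4"
    proof -
      have "1 / M ^ 5 = 1 / M * (1 / M ^ 4)" by (simp add: power_numeral_reduce)
      also have "\<dots> \<le> 1 / 2 * (1 / M ^ 4)" using M by (intro mult_right_mono) (auto simp: field_simps)
      finally show ?thesis by simp
    qed
    have close: "\<bar>gauss_kernel \<tau> z x - gauss_kernel (real i / M ^ 5) (of_int j / M ^ 25) x\<bar> \<le> 1 / M ^ 4" for x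
      using gauss_kernel_Lipschitz[of \<tau> z x "real i / M ^ 5" "of_int j / M ^ 25"] \<tau> dt tz M5 by linarith
    have two: "2 / M ^ 4 = 1 / M ^ 4 + 1 / M ^ 4" by simp
    show thesis
    proof (rule bracketI[OF i j[OF 4(1)]])
      fix x
      show "gauss_kernel \<tau> z x \<le> 1 / real N ^ 4 + gauss_kernel (real i / real N ^ 5) (of_int j / real N ^ 25) x \<and>
        1 / real N ^ 4 + gauss_kernel (real i / real N ^ 5) (of_int j / real N ^ 25) x
        \<le> gauss_kernel \<tau> z x + 2 / real N ^ 4"
        using close[of x] two unfolding M_def[symmetric] abs_le_iff by linarith
    qed
  qed
qed

lemma normal_density_le_inverse: "0 < \<sigma> \<Longrightarrow> normal_density z \<sigma> x \<le> 1 / \<sigma>"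
  using normal_density_eq_gauss_kernel[of \<sigma> 1 z x 0] gauss_kernel_le[of "1 / \<sigma>" z x] by simp

lemma normal_interval_mass:
  assumes \<sigma>: "0 < \<sigma>" and J: "J \<in> sets borel" "J \<subseteq> {a..b}" "a \<le> b"
  shows "mass J (normal_density z \<sigma>) \<le> (b - a) / \<sigma>"
proof -
  have "mass J (normal_density z \<sigma>) \<le> (\<integral>x. indicator {a..b} x * (1 / \<sigma>) \<partial>lborel)"
  proof (rule integral_mono)
    show "integrable lborel (\<lambda>x. indicator J x * normal_density z \<sigma> x)"
      using J(1) \<sigma> by (intro integrable_indicator_mult) auto
    show "indicator J x * normal_density z \<sigma> x \<le> indicator {a..b} x * (1 / \<sigma>)" for x
      using J \<sigma> normal_density_le_inverse[OF \<sigma>] by (auto split: split_indicator)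
  qed (use J in simp)
  also have "\<dots> = (b - a) / \<sigma>" using J by simp
  finally show ?thesis .
qed

text \<open>
  Halving the exponent compares the density with that of the doubled variance, which integrates to one.
\<close>

lemma normal_tail:
  assumes \<sigma>: "0 < \<sigma>" and t: "0 \<le> t" and J: "J \<in> sets borel" "\<And>x. x \<in> J \<Longrightarrow> 4 * \<sigma>\<^sup>2 * t \<le> (x - z)\<^sup>2"
  shows "mass J (normal_density z \<sigma>) \<le> 2 * exp (- t)"
proof -
  let ?s = "sqrt 2 * \<sigma>"
  have pw: "normal_density z \<sigma> x \<le> 2 * exp (- t) * normal_density z ?s x" if "x \<in> J" for x
  proof -
    have e: "- (x - z)\<^sup>2 / (2 * \<sigma>\<^sup>2) \<le> - t + - (x - z)\<^sup>2 / (2 * ?s\<^sup>2)"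
    proof -
      have "t \<le> (x - z)\<^sup>2 / (4 * \<sigma>\<^sup>2)" using J(2)[OF that] \<sigma> by (simp add: field_simps)
      moreover have "- (x - z)\<^sup>2 / (2 * ?s\<^sup>2) = - ((x - z)\<^sup>2 / (4 * \<sigma>\<^sup>2))"
        by (simp add: power_mult_distrib)
      moreover have "- (x - z)\<^sup>2 / (2 * \<sigma>\<^sup>2) = - 2 * ((x - z)\<^sup>2 / (4 * \<sigma>\<^sup>2))" by simp
      ultimately show ?thesis by linarith
    qed
    have c: "1 / sqrt (2 * pi * \<sigma>\<^sup>2) \<le> 2 * (1 / sqrt (2 * pi * ?s\<^sup>2))"
    proof -
      have "sqrt (2 * pi * ?s\<^sup>2) = sqrt 2 * sqrt (2 * pi * \<sigma>\<^sup>2)"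
        by (simp add: power_mult_distrib real_sqrt_mult)
      moreover have "sqrt 2 \<le> 2" using sqrt2_less_2 by simp
      moreover have "sqrt (2 * pi * \<sigma>\<^sup>2) > 0" using \<sigma> by simp
      ultimately show ?thesis by (simp add: field_simps)
    qed
    have "normal_density z \<sigma> x \<le> 2 * (1 / sqrt (2 * pi * ?s\<^sup>2)) * exp (- t + - (x - z)\<^sup>2 / (2 * ?s\<^sup>2))"
      unfolding normal_density_def using c e by (intro mult_mono) auto
    then show ?thesis unfolding normal_density_def exp_add by (simp only: mult_ac)
  qed
  have "mass J (normal_density z \<sigma>) \<le> (\<integral>x. 2 * exp (- t) * normal_density z ?s x \<partial>lborel)"
  proof (rule integral_mono)
    show "integrable lborel (\<lambda>x. indicator J x * normal_density z \<sigma> x)"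
      using J(1) \<sigma> by (intro integrable_indicator_mult) auto
    show "indicator J x * normal_density z \<sigma> x \<le> 2 * exp (- t) * normal_density z ?s x" for x
      using pw[of x] by (auto split: split_indicator)
  qed (use \<sigma> in simp)
  also have "\<dots> = 2 * exp (- t)" using \<sigma> by simp
  finally show ?thesis .
qed

lemma exp_ge_power_fact:
  fixes x :: real
  assumes "0 \<le> x"
  shows "x ^ n / fact n \<le> exp x"
proof -
  have "(\<Sum>i\<in>{n}. x ^ i /\<^sub>R fact i) \<le> (\<Sum>i. x ^ i /\<^sub>R fact i)"
    using assms summable_exp_generic[of x] by (intro sum_le_suminf) auto
  then show ?thesis by (simp add: exp_def divide_inverse mult.commute)
qed

text \<open>
  The condition \<open>exp 3 * Y \<le> J\<close> makes \<open>y ^ J / J!\<close> at most \<open>exp (- 2 * J)\<close>, which outweighs the factor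
  \<open>exp y\<close> of the Lagrange remainder.
\<close>

lemma exp_Taylor_remainder:
  fixes y Y :: real
  assumes y: "0 \<le> y" "y \<le> Y" and J: "exp 3 * Y \<le> real J" "0 < J"
  shows "\<bar>exp (- y) - (\<Sum>i<J. (- y) ^ i / fact i)\<bar> \<le> exp (- real J)"
proof -
  obtain t where t: "\<bar>t\<bar> \<le> \<bar>- y\<bar>" and e: "exp (- y) = (\<Sum>i<J. (- y) ^ i / fact i) + exp t / fact J * (- y) ^ J"
    using Maclaurin_exp_le[of "- y" J] by blast
  have "exp 3 * y \<le> real J" using y J by (intro order.trans[OF mult_left_mono[of y Y "exp 3"]]) auto
  then have yJ: "y \<le> exp (- 3) * real J" by (simp add: exp_minus field_simps)
  have yJ': "y \<le> real J"
  proof -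
    have "exp (- 3) * real J \<le> 1 * real J" by (intro mult_right_mono) auto
    with yJ show ?thesis by simp
  qed
  have "\<bar>exp (- y) - (\<Sum>i<J. (- y) ^ i / fact i)\<bar> = exp t * (y ^ J / fact J)"
    using y by (simp add: e abs_mult power_abs)
  also have "\<dots> \<le> exp (real J) * ((exp (- 3) * real J) ^ J / fact J)"
    using t y yJ yJ' by (intro mult_mono divide_right_mono power_mono) auto
  also have "\<dots> = exp (real J) * exp (- 3) ^ J * (real J ^ J / fact J)"
    by (simp add: power_mult_distrib)
  also have "\<dots> \<le> exp (real J) * exp (- 3) ^ J * exp (real J)"
    by (intro mult_left_mono exp_ge_power_fact) auto
  also have "\<dots> = exp (- real J)"
    by (simp add: exp_of_nat_mult[symmetric] exp_add[symmetric])
  finally show ?thesis .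
qed

section \<open>Reduction to finitely many atoms\<close>

lemma homogeneous_system_nontrivial_solution:
  fixes m :: "nat \<Rightarrow> 'a \<Rightarrow> real"
  assumes "finite S" "d < card S"
  shows "\<exists>c. (\<exists>s\<in>S. c s \<noteq> 0) \<and> (\<forall>j<d. (\<Sum>s\<in>S. c s * m j s) = 0)"
  using assms
proof (induction d arbitrary: S m)
  case 0
  then have "S \<noteq> {}" by auto
  then show ?case by (intro exI[of _ "\<lambda>_. 1"]) auto
next
  case (Suc d)
  show ?case
  proof (cases "\<forall>s\<in>S. m d s = 0")
    case True
    obtain c where "\<exists>s\<in>S. c s \<noteq> 0" "\<forall>j<d. (\<Sum>s\<in>S. c s * m j s) = 0"
      using Suc.IH[of S m] Suc.prems by auto
    with True show ?thesis by (intro exI[of _ c]) (auto simp: less_Suc_eq)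
  next
    case False
    then obtain a where a: "a \<in> S" "m d a \<noteq> 0" by auto
    define m' where "m' j s = m j s - m j a / m d a * m d s" for j s
    have "d < card (S - {a})" using Suc.prems a by simp
    then obtain c where c: "\<exists>s\<in>S - {a}. c s \<noteq> 0" "\<forall>j<d. (\<Sum>s\<in>S - {a}. c s * m' j s) = 0"
      using Suc.IH[of "S - {a}" m'] Suc.prems by auto
    define W where "W = (\<Sum>s\<in>S - {a}. c s * m d s)"
    define c' where "c' = c(a := - W / m d a)"
    have split: "(\<Sum>s\<in>S. c' s * m j s) = (\<Sum>s\<in>S - {a}. c s * m j s) - W / m d a * m j a" for j
      using Suc.prems(1) a by (subst sum.remove[of S a]) (auto simp: c'_def intro!: sum.cong)
    have "(\<Sum>s\<in>S. c' s * m j s) = 0" if "j < Suc d" for j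
    proof (cases "j = d")
      case True
      then show ?thesis unfolding split using a by (simp add: W_def)
    next
      case False
      then have "0 = (\<Sum>s\<in>S - {a}. c s * m' j s)" using c(2) that by simp
      also have "\<dots> = (\<Sum>s\<in>S - {a}. c s * m j s) - m j a / m d a * W"
        by (simp add: m'_def W_def right_diff_distrib sum_subtractf sum_distrib_left mult_ac)
      finally show ?thesis unfolding split by (simp add: mult_ac)
    qed
    moreover have "\<exists>s\<in>S. c' s \<noteq> 0" using c(1) by (auto simp: c'_def)
    ultimately show ?thesis by blast
  qed
qed

text \<open>
  Caratheodory's theorem for a finitely supported measure: as long as there are more than \<open>d\<close> atoms,
  move the weights along a signed measure that is invisible to the \<open>d\<close> given functions, until an atom
  disappears.
\<close>

lemma moment_preserving_reduction:
  fixes m :: "nat \<Rightarrow> 'a \<Rightarrow> real" and w :: "'a \<Rightarrow> real"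
  assumes "finite S" "\<And>s. s \<in> S \<Longrightarrow> 0 \<le> w s"
  shows "\<exists>T w'. T \<subseteq> S \<and> card T \<le> d \<and> (\<forall>s\<in>T. 0 \<le> w' s) \<and>
           (\<forall>j<d. (\<Sum>s\<in>T. w' s * m j s) = (\<Sum>s\<in>S. w s * m j s))"
  using assms
proof (induction "card S" arbitrary: S w rule: less_induct)
  case less
  show ?case
  proof (cases "card S \<le> d")
    case True
    with less.prems show ?thesis by (intro exI[of _ S] exI[of _ w]) auto
  next
    case False
    obtain c0 where c0: "\<exists>s\<in>S. c0 s \<noteq> 0" "\<forall>j<d. (\<Sum>s\<in>S. c0 s * m j s) = 0"
      using homogeneous_system_nontrivial_solution[of S d m] less.prems False by auto
    obtain c where c: "\<exists>s\<in>S. 0 < c s" "\<forall>j<d. (\<Sum>s\<in>S. c s * m j s) = 0"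
    proof (cases "\<exists>s\<in>S. 0 < c0 s")
      case True then show ?thesis using c0 that by blast
    next
      case False
      with c0(1) have "\<exists>s\<in>S. 0 < - c0 s" by force
      moreover have "\<forall>j<d. (\<Sum>s\<in>S. - c0 s * m j s) = 0" using c0(2) by (simp add: sum_negf)
      ultimately show ?thesis by (rule that)
    qed
    define Q where "Q = {s \<in> S. 0 < c s}"
    have Q: "finite Q" "Q \<noteq> {}" using c less.prems by (auto simp: Q_def)
    obtain a where a: "a \<in> Q" "\<And>s. s \<in> Q \<Longrightarrow> w a / c a \<le> w s / c s"
      using arg_min_if_finite(1)[OF Q, of "\<lambda>s. w s / c s"] arg_min_least[OF Q, of _ "\<lambda>s. w s / c s"]
      by blast
    define t where "t = w a / c a"
    define v where "v s = w s - t * c s" for s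
    have aS: "a \<in> S" "0 < c a" using a by (auto simp: Q_def)
    have va: "v a = 0" using aS by (simp add: v_def t_def)
    have t0: "0 \<le> t" unfolding t_def using aS less.prems(2)[of a] by simp
    have v: "0 \<le> v s" if "s \<in> S" for s
    proof (cases "0 < c s")
      case True
      then have "t \<le> w s / c s" using a(2)[of s] that by (simp add: t_def Q_def)
      then show ?thesis using True by (simp add: v_def field_simps)
    next
      case False
      then have "t * c s \<le> 0" using t0 by (simp add: mult_nonneg_nonpos)
      then show ?thesis using less.prems(2)[OF that] by (simp add: v_def)
    qed
    have "card (S - {a}) < card S" by (rule card_Diff1_less[OF less.prems(1) aS(1)])
    then obtain T w' where T: "T \<subseteq> S - {a}" "card T \<le> d" "\<forall>s\<in>T. 0 \<le> w' s"
      "\<forall>j<d. (\<Sum>s\<in>T. w' s * m j s) = (\<Sum>s\<in>S - {a}. v s * m j s)"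
      using less.hyps[of "S - {a}" v] less.prems v by auto
    have "(\<Sum>s\<in>S - {a}. v s * m j s) = (\<Sum>s\<in>S. w s * m j s)" if "j < d" for j
    proof -
      have "(\<Sum>s\<in>S - {a}. v s * m j s) = (\<Sum>s\<in>S. v s * m j s)"
        using aS less.prems va by (subst sum.remove[of S a]) auto
      also have "\<dots> = (\<Sum>s\<in>S. w s * m j s) - t * (\<Sum>s\<in>S. c s * m j s)"
        by (simp add: v_def left_diff_distrib sum_subtractf sum_distrib_left mult.assoc)
      also have "\<dots> = (\<Sum>s\<in>S. w s * m j s)" using c(2) that by simp
      finally show ?thesis .
    qed
    with T show ?thesis by (intro exI[of _ T] exI[of _ w']) auto
  qed
qed

definition Taylor_normal :: "nat \<Rightarrow> real \<Rightarrow> real \<Rightarrow> real poly" where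
  "Taylor_normal J z \<sigma> = smult (1 / sqrt (2 * pi * \<sigma>\<^sup>2))
     (\<Sum>i<J. smult (1 / fact i) (smult (- 1 / (2 * \<sigma>\<^sup>2)) ([:- z, 1:]\<^sup>2) ^ i))"

lemma poly_Taylor_normal:
  "poly (Taylor_normal J z \<sigma>) x =
     1 / sqrt (2 * pi * \<sigma>\<^sup>2) * (\<Sum>i<J. (- ((x - z)\<^sup>2 / (2 * \<sigma>\<^sup>2))) ^ i / fact i)"
  by (simp add: Taylor_normal_def poly_sum poly_power)

lemma degree_Taylor_normal:
  assumes "0 < J"
  shows "degree (Taylor_normal J z \<sigma>) < 2 * J"
proof -
  have "degree (\<Sum>i<J. smult (1 / fact i) (smult (- 1 / (2 * \<sigma>\<^sup>2)) ([:- z, 1:]\<^sup>2) ^ i)) \<le> 2 * (J - 1)"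
  proof (rule degree_sum_le)
    fix i assume "i \<in> {..<J}"
    have "degree (smult (1 / fact i) (smult (- 1 / (2 * \<sigma>\<^sup>2)) ([:- z, 1:]\<^sup>2) ^ i))
      \<le> degree (smult (- 1 / (2 * \<sigma>\<^sup>2)) ([:- z, 1:]\<^sup>2)) * i"
      by (rule order.trans[OF degree_smult_le degree_power_le])
    also have "\<dots> \<le> 2 * i"
      using order.trans[OF degree_smult_le[of "- 1 / (2 * \<sigma>\<^sup>2)" "[:- z, 1:]\<^sup>2"] degree_power_le[of "[:- z, 1:]" 2]]
      by (intro mult_right_mono) auto
    also have "\<dots> \<le> 2 * (J - 1)" using \<open>i \<in> {..<J}\<close> by auto
    finally show "degree (smult (1 / fact i) (smult (- 1 / (2 * \<sigma>\<^sup>2)) ([:- z, 1:]\<^sup>2) ^ i)) \<le> 2 * (J - 1)" .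
  qed simp
  then have "degree (Taylor_normal J z \<sigma>) \<le> 2 * (J - 1)"
    unfolding Taylor_normal_def using degree_smult_le order.trans by blast
  with assms show ?thesis by simp
qed

lemma poly_eq_sum_coeff:
  fixes p :: "real poly"
  assumes "degree p < n"
  shows "poly p x = (\<Sum>j<n. coeff p j * x ^ j)"
proof -
  have "(\<Sum>j\<le>degree p. coeff p j * x ^ j) = (\<Sum>j<n. coeff p j * x ^ j)"
    using assms by (intro sum.mono_neutral_left) (auto simp: coeff_eq_0)
  then show ?thesis by (simp add: poly_altdef)
qed

lemma Taylor_normal_error:
  assumes \<sigma>: "0 < s" "s \<le> \<sigma>" and x: "\<bar>x - z\<bar> \<le> s * D" and J: "exp 3 * (D\<^sup>2 / 2) \<le> real J" "0 < J"
  shows "\<bar>normal_density z \<sigma> x - poly (Taylor_normal J z \<sigma>) x\<bar> \<le> exp (- real J) / s"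
proof -
  let ?y = "(x - z)\<^sup>2 / (2 * \<sigma>\<^sup>2)" and ?c = "1 / sqrt (2 * pi * \<sigma>\<^sup>2)"
  have "\<bar>x - z\<bar>\<^sup>2 \<le> (s * D)\<^sup>2" using x by (intro power_mono) auto
  then have xz: "(x - z)\<^sup>2 \<le> (s * D)\<^sup>2" by simp
  have "?y \<le> (s * D)\<^sup>2 / (2 * s\<^sup>2)"
  proof (rule frac_le)
    show "2 * s\<^sup>2 \<le> 2 * \<sigma>\<^sup>2" using \<sigma> by (intro mult_left_mono power_mono) auto
  qed (use \<sigma> xz in simp_all)
  also have "\<dots> = D\<^sup>2 / 2" using \<sigma> by (simp add: power_mult_distrib)
  finally have y: "?y \<le> D\<^sup>2 / 2" .
  have "normal_density z \<sigma> x - poly (Taylor_normal J z \<sigma>) x = ?c * (exp (- ?y) - (\<Sum>i<J. (- ?y) ^ i / fact i))"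
    unfolding normal_density_def poly_Taylor_normal right_diff_distrib by simp
  then have "\<bar>normal_density z \<sigma> x - poly (Taylor_normal J z \<sigma>) x\<bar>
      = ?c * \<bar>exp (- ?y) - (\<Sum>i<J. (- ?y) ^ i / fact i)\<bar>"
    by (simp add: abs_mult)
  also have "\<dots> \<le> 1 / s * exp (- real J)"
  proof (rule mult_mono)
    have "?c = normal_density z \<sigma> z" by (simp add: normal_density_def)
    also have "\<dots> \<le> 1 / \<sigma>" using \<sigma> by (intro normal_density_le_inverse) auto
    also have "\<dots> \<le> 1 / s" using \<sigma> by (simp add: frac_le)
    finally show "?c \<le> 1 / s" .
    show "\<bar>exp (- ?y) - (\<Sum>i<J. (- ?y) ^ i / fact i)\<bar> \<le> exp (- real J)"
      by (rule exp_Taylor_remainder[OF _ y J]) simp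
  qed (use \<sigma> in auto)
  finally show ?thesis by simp
qed

text \<open>
  Near the centre all densities with parameters in the box agree, up to \<open>exp (- J) / s\<close>, with
  polynomials in \<open>x\<close> of degree less than \<open>2 * J\<close>; matching the coefficients together with the total
  mass takes \<open>2 * J + 1\<close> linear conditions, hence as many atoms.
\<close>

lemma finite_mixture_reduction:
  fixes G :: "(real \<times> real) set" and v :: "real \<times> real \<Rightarrow> real"
  assumes G: "finite G" "G \<subseteq> {l - s * A..l + s * A} \<times> {s..s * R}" and s: "0 < s"
    and v: "\<And>g. g \<in> G \<Longrightarrow> 0 \<le> v g" "(\<Sum>g\<in>G. v g) = 1"
    and J: "exp 3 * ((B + A)\<^sup>2 / 2) \<le> real J" "0 < J" and K: "2 * J + 1 \<le> K"
  obtains w :: "nat \<Rightarrow> real" and z \<sigma> :: "nat \<Rightarrow> real"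
  where "\<And>k. k < K \<Longrightarrow> 0 \<le> w k" "(\<Sum>k<K. w k) = 1"
    "\<And>k. z k \<in> {l - s * A..l + s * A}" "\<And>k. \<sigma> k \<in> {s..s * R}"
    "\<And>x. \<bar>x - l\<bar> \<le> s * B \<Longrightarrow> \<bar>(\<Sum>g\<in>G. v g * normal_density (fst g) (snd g) x)
       - (\<Sum>k<K. w k * normal_density (z k) (\<sigma> k) x)\<bar> \<le> 2 * exp (- real J) / s"
proof -
  define m where "m j g = (case j of 0 \<Rightarrow> 1 | Suc i \<Rightarrow> coeff (Taylor_normal J (fst g) (snd g)) i)"
    for j :: nat and g :: "real \<times> real"
  obtain T w' where T: "T \<subseteq> G" "card T \<le> 2 * J + 1" "\<forall>g\<in>T. 0 \<le> w' g"
    "\<forall>j<2 * J + 1. (\<Sum>g\<in>T. w' g * m j g) = (\<Sum>g\<in>G. v g * m j g)"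
    using moment_preserving_reduction[of G v "2 * J + 1" m] G v by auto
  have mass: "(\<Sum>g\<in>T. w' g) = 1" using T(4)[rule_format, of 0] v by (simp add: m_def)
  have coef: "(\<Sum>g\<in>T. w' g * coeff (Taylor_normal J (fst g) (snd g)) i)
      = (\<Sum>g\<in>G. v g * coeff (Taylor_normal J (fst g) (snd g)) i)" if "i < 2 * J" for i
    using T(4)[rule_format, of "Suc i"] that by (simp add: m_def)
  have fT: "finite T" using T G finite_subset by blast
  have pol: "(\<Sum>g\<in>S. u g * poly (Taylor_normal J (fst g) (snd g)) x)
      = (\<Sum>j<2 * J. (\<Sum>g\<in>S. u g * coeff (Taylor_normal J (fst g) (snd g)) j) * x ^ j)" for S u x
    unfolding poly_eq_sum_coeff[OF degree_Taylor_normal[OF J(2)]] sum_distrib_left sum_distrib_right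
    by (subst sum.swap) (simp add: mult_ac)
  have same: "(\<Sum>g\<in>T. w' g * poly (Taylor_normal J (fst g) (snd g)) x)
      = (\<Sum>g\<in>G. v g * poly (Taylor_normal J (fst g) (snd g)) x)" for x
    unfolding pol using coef by simp
  have err: "\<bar>(\<Sum>g\<in>S. u g * normal_density (fst g) (snd g) x)
      - (\<Sum>g\<in>S. u g * poly (Taylor_normal J (fst g) (snd g)) x)\<bar> \<le> exp (- real J) / s"
    if x: "\<bar>x - l\<bar> \<le> s * B" and S: "S \<subseteq> G" "\<And>g. g \<in> S \<Longrightarrow> 0 \<le> u g" "(\<Sum>g\<in>S. u g) = 1" for S u x
  proof -
    have "\<bar>(\<Sum>g\<in>S. u g * normal_density (fst g) (snd g) x)
      - (\<Sum>g\<in>S. u g * poly (Taylor_normal J (fst g) (snd g)) x)\<bar>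
      = \<bar>\<Sum>g\<in>S. u g * (normal_density (fst g) (snd g) x - poly (Taylor_normal J (fst g) (snd g)) x)\<bar>"
      by (simp add: right_diff_distrib sum_subtractf)
    also have "\<dots> \<le> (\<Sum>g\<in>S. u g * (exp (- real J) / s))"
    proof (rule order.trans[OF sum_abs sum_mono])
      fix g assume g: "g \<in> S"
      then have gb: "\<bar>fst g - l\<bar> \<le> s * A" "s \<le> snd g" using S(1) G(2) by (auto simp: abs_le_iff algebra_simps)
      have "\<bar>x - fst g\<bar> \<le> s * (B + A)" using x gb by (simp add: distrib_left)
      then have "\<bar>normal_density (fst g) (snd g) x - poly (Taylor_normal J (fst g) (snd g)) x\<bar> \<le> exp (- real J) / s"
        using s gb J by (intro Taylor_normal_error)
      then show "\<bar>u g * (normal_density (fst g) (snd g) x - poly (Taylor_normal J (fst g) (snd g)) x)\<bar>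
        \<le> u g * (exp (- real J) / s)"
        using mult_left_mono[OF _ S(2)[OF g]] S(2)[OF g] by (simp only: abs_mult abs_of_nonneg)
    qed
    also have "\<dots> = exp (- real J) / s" using S(3) by (simp only: sum_distrib_right[symmetric])
    finally show ?thesis .
  qed
  have "T \<noteq> {}" using mass by auto
  then obtain g0 where g0: "g0 \<in> T" by auto
  obtain h where h: "bij_betw h {..<card T} T"
    using ex_bij_betw_nat_finite[OF fT] by (auto simp: atLeast0LessThan)
  define \<theta> where "\<theta> k = (if k < card T then h k else g0)" for k
  define w where "w k = (if k < card T then w' (h k) else 0)" for k
  have \<theta>: "\<theta> k \<in> T" for k using h g0 by (auto simp: \<theta>_def bij_betw_def)
  have sumK: "(\<Sum>k<K. w k * F (\<theta> k)) = (\<Sum>g\<in>T. w' g * F g)" for F :: "real \<times> real \<Rightarrow> real"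
  proof -
    have "(\<Sum>k<K. w k * F (\<theta> k)) = (\<Sum>k<card T. w k * F (\<theta> k))"
      using T(2) K by (intro sum.mono_neutral_right) (auto simp: w_def)
    also have "\<dots> = (\<Sum>k<card T. w' (h k) * F (h k))" by (simp add: w_def \<theta>_def)
    also have "\<dots> = (\<Sum>g\<in>T. w' g * F g)" by (rule sum.reindex_bij_betw[OF h])
    finally show ?thesis .
  qed
  show thesis
  proof (rule that[of w "\<lambda>k. fst (\<theta> k)" "\<lambda>k. snd (\<theta> k)"])
    show "0 \<le> w k" for k using T(3) \<theta>[of k] by (auto simp: w_def \<theta>_def split: if_splits)
    show "(\<Sum>k<K. w k) = 1" using sumK[of "\<lambda>_. 1"] mass by simp
    show "fst (\<theta> k) \<in> {l - s * A..l + s * A}" "snd (\<theta> k) \<in> {s..s * R}" for k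
      using subsetD[OF order.trans[OF T(1) G(2)] \<theta>[of k]] by (simp_all add: mem_Times_iff)
    fix x assume x: "\<bar>x - l\<bar> \<le> s * B"
    have two: "2 * exp (- real J) / s = exp (- real J) / s + exp (- real J) / s" by simp
    show "\<bar>(\<Sum>g\<in>G. v g * normal_density (fst g) (snd g) x)
       - (\<Sum>k<K. w k * normal_density (fst (\<theta> k)) (snd (\<theta> k)) x)\<bar> \<le> 2 * exp (- real J) / s"
      unfolding sumK[of "\<lambda>g. normal_density (fst g) (snd g) x"] two
      using err[OF x, of G v] err[OF x, of T w'] v mass T same[of x] by auto
  qed
qed

section \<open>Mixtures with bounded mixing support\<close>

lemma mixing_distributionsD:
  assumes "H \<in> mixing_distributions"
  shows "prob_space H" "space H = half_plane"
    "f \<in> measurable borel N \<Longrightarrow> f \<in> measurable H N"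
    "X \<in> sets borel \<Longrightarrow> X \<inter> half_plane \<in> sets H"
proof -
  have s: "sets H = sets (restrict_space borel half_plane)" and "prob_space H"
    using assms by (auto simp: mixing_distributions_def)
  show "prob_space H" by fact
  show "space H = half_plane" using sets_eq_imp_space_eq[OF s] by (simp add: space_restrict_space)
  show "f \<in> measurable H N" if "f \<in> measurable borel N"
    using measurable_restrict_space1[OF that, of half_plane] measurable_cong_sets[OF s refl, of N] by simp
  show "X \<inter> half_plane \<in> sets H" if "X \<in> sets borel"
    using that by (auto simp: s sets_restrict_space)
qed

text \<open>
  The complement of the support is a union of open null sets; by Lindeloef's theorem countably many of them suffice.
\<close>

lemma AE_in_superset_of_supp:
  assumes H: "H \<in> mixing_distributions" and D: "supp H \<subseteq> D"
  shows "AE \<theta> in H. \<theta> \<in> D"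
proof -
  note HD = mixing_distributionsD[OF H]
  define \<F> where "\<F> = {U :: (real \<times> real) set. open U \<and> emeasure H (U \<inter> space H) = 0}"
  obtain \<F>' where F': "\<F>' \<subseteq> \<F>" "countable \<F>'" "\<Union>\<F>' = \<Union>\<F>"
    using Lindelof[of \<F>] by (auto simp: \<F>_def)
  have "(\<Union>U\<in>\<F>'. U \<inter> space H) \<in> null_sets H"
  proof (rule null_sets_UN')
    fix U assume "U \<in> \<F>'"
    then have "open U" "emeasure H (U \<inter> space H) = 0" using F'(1) by (auto simp: \<F>_def)
    then show "U \<inter> space H \<in> null_sets H"
      using HD(4)[of U] by (auto simp: HD(2) null_sets_def)
  qed fact
  moreover have "{\<theta> \<in> space H. \<theta> \<notin> D} \<subseteq> (\<Union>U\<in>\<F>'. U \<inter> space H)"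
  proof safe
    fix \<theta> assume \<theta>: "\<theta> \<in> space H" "\<theta> \<notin> D"
    then have "\<theta> \<notin> supp H" using D by auto
    then obtain U where "open U" "\<theta> \<in> U" "emeasure H (U \<inter> space H) = 0"
      using \<theta> by (auto simp: supp_def)
    then have "\<theta> \<in> \<Union>\<F>" by (auto simp: \<F>_def)
    then show "\<theta> \<in> (\<Union>U\<in>\<F>'. U \<inter> space H)" using F'(3) \<theta> by auto
  qed
  ultimately show ?thesis by (rule AE_I')
qed

lemma normal_density_joint_measurable [measurable]:
  "(\<lambda>\<theta> :: (real \<times> real) \<times> real. normal_density (fst (fst \<theta>)) (snd (fst \<theta>)) (snd \<theta>)) \<in> borel_measurable borel"
  unfolding normal_density_def borel_prod[symmetric] by measurable

lemma normal_density_parameter_measurable [measurable]: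
  "(\<lambda>\<theta> :: real \<times> real. normal_density (fst \<theta>) (snd \<theta>) x) \<in> borel_measurable borel"
  unfolding normal_density_def borel_prod[symmetric] by measurable

lemma mixture_density_bounded_support:
  assumes H: "H \<in> mixing_distributions" and D: "supp H \<subseteq> {a..b} \<times> {s..c}" and s: "0 < s"
  shows "integrable H (\<lambda>\<theta>. normal_density (fst \<theta>) (snd \<theta>) x)"
    and "0 \<le> mixture_density H x"
    and "mixture_density H \<in> borel_measurable borel"
    and "B \<in> sets borel \<Longrightarrow> emeasure (density lborel (mixture_density H)) B =
      (\<integral>\<^sup>+\<theta>. emeasure (density lborel (normal_density (fst \<theta>) (snd \<theta>))) B \<partial>H)"
proof -
  note HD = mixing_distributionsD[OF H]
  interpret H: prob_space H by (rule HD)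
  have ae: "AE \<theta> in H. \<theta> \<in> {a..b} \<times> {s..c}" by (rule AE_in_superset_of_supp[OF H D])
  have md: "mixture_density H x = (\<integral>\<theta>. normal_density (fst \<theta>) (snd \<theta>) x \<partial>H)" for x
    by (simp add: mixture_density_def case_prod_unfold)
  have m [measurable]: "(\<lambda>\<theta>. normal_density (fst \<theta>) (snd \<theta>) x) \<in> borel_measurable H" for x
    by (rule HD(3)) measurable
  have int: "integrable H (\<lambda>\<theta>. normal_density (fst \<theta>) (snd \<theta>) x)" for x
  proof (rule H.integrable_const_bound[where B = "1 / s"])
    show "AE \<theta> in H. norm (normal_density (fst \<theta>) (snd \<theta>) x) \<le> 1 / s"
      using ae
    proof eventually_elim
      case (elim \<theta>)
      then have "s \<le> snd \<theta>" by auto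
      then have "normal_density (fst \<theta>) (snd \<theta>) x \<le> 1 / snd \<theta>" "1 / snd \<theta> \<le> 1 / s"
        using s by (auto intro!: normal_density_le_inverse frac_le)
      then show ?case by simp
    qed
  qed measurable
  show "integrable H (\<lambda>\<theta>. normal_density (fst \<theta>) (snd \<theta>) x)" by (rule int)
  show "0 \<le> mixture_density H x" unfolding md by simp
  have fm: "fst \<in> measurable (H \<Otimes>\<^sub>M lborel) borel"
    by (rule measurable_compose[OF measurable_fst]) (rule HD(3), simp)
  have sm: "snd \<in> measurable (H \<Otimes>\<^sub>M lborel) borel"
    by (rule measurable_compose[OF measurable_snd]) simp
  have "(\<lambda>y. (fst y, snd y)) \<in> measurable (H \<Otimes>\<^sub>M lborel) (borel \<Otimes>\<^sub>M borel)"
    using fm sm by (rule measurable_Pair)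
  then have "(\<lambda>y. y) \<in> measurable (H \<Otimes>\<^sub>M lborel) (borel :: ((real \<times> real) \<times> real) measure)"
    by (simp add: borel_prod)
  from measurable_compose[OF this normal_density_joint_measurable]
  have jm [measurable]: "(\<lambda>y. normal_density (fst (fst y)) (snd (fst y)) (snd y)) \<in> borel_measurable (H \<Otimes>\<^sub>M lborel)" .
  interpret HL: pair_sigma_finite H lborel ..
  have "(\<lambda>x. \<integral>\<theta>. normal_density (fst \<theta>) (snd \<theta>) x \<partial>H) \<in> borel_measurable lborel"
  proof (rule H.borel_measurable_lebesgue_integral)
    have "(\<lambda>y. normal_density (fst (snd y)) (snd (snd y)) (fst y)) \<in> borel_measurable (lborel \<Otimes>\<^sub>M H)"
      using measurable_compose[OF measurable_pair_swap' jm] by (simp add: case_prod_unfold)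
    then show "case_prod (\<lambda>x \<theta>. normal_density (fst \<theta>) (snd \<theta>) x) \<in> borel_measurable (lborel \<Otimes>\<^sub>M H)"
      by (simp add: case_prod_unfold)
  qed
  then show mm: "mixture_density H \<in> borel_measurable borel" unfolding md[abs_def] by simp
  show "emeasure (density lborel (mixture_density H)) B =
      (\<integral>\<^sup>+\<theta>. emeasure (density lborel (normal_density (fst \<theta>) (snd \<theta>))) B \<partial>H)"
    if B: "B \<in> sets borel"
  proof -
    have "emeasure (density lborel (mixture_density H)) B
        = (\<integral>\<^sup>+x. ennreal (mixture_density H x) * indicator B x \<partial>lborel)"
      using mm B by (subst emeasure_density) auto
    also have "\<dots> = (\<integral>\<^sup>+x. (\<integral>\<^sup>+\<theta>. ennreal (normal_density (fst \<theta>) (snd \<theta>) x) * indicator B x \<partial>H) \<partial>lborel)"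
      unfolding md using int by (simp add: nn_integral_eq_integral[symmetric] nn_integral_multc)
    also have "\<dots> = (\<integral>\<^sup>+\<theta>. (\<integral>\<^sup>+x. ennreal (normal_density (fst \<theta>) (snd \<theta>) x) * indicator B x \<partial>lborel) \<partial>H)"
    proof (rule HL.Fubini')
      have "(\<lambda>y. ennreal (normal_density (fst (fst y)) (snd (fst y)) (snd y)) * indicator B (snd y))
          \<in> borel_measurable (H \<Otimes>\<^sub>M lborel)"
        using B by measurable
      then show "(\<lambda>(\<theta>, x). ennreal (normal_density (fst \<theta>) (snd \<theta>) x) * indicator B x)
          \<in> borel_measurable (H \<Otimes>\<^sub>M lborel)"
        by (simp add: case_prod_unfold)
    qed
    also have "\<dots> = (\<integral>\<^sup>+\<theta>. emeasure (density lborel (normal_density (fst \<theta>) (snd \<theta>))) B \<partial>H)"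
      using B by (intro nn_integral_cong) (simp add: emeasure_density)
    finally show ?thesis .
  qed
qed

lemma mixture_density_prob:
  assumes H: "H \<in> mixing_distributions" and D: "supp H \<subseteq> {a..b} \<times> {s..c}" and s: "0 < s"
  shows "integrable lborel (mixture_density H)" "integral\<^sup>L lborel (mixture_density H) = 1"
proof -
  note mb = mixture_density_bounded_support[OF assms]
  note HD = mixing_distributionsD[OF H]
  interpret H: prob_space H by (rule HD)
  have "AE \<theta> in H. emeasure (density lborel (normal_density (fst \<theta>) (snd \<theta>))) UNIV = 1"
    using AE_in_superset_of_supp[OF H D]
  proof eventually_elim
    case (elim \<theta>)
    then have "0 < snd \<theta>" using s by auto
    from prob_space.emeasure_space_1[OF prob_space_normal_density[OF this, of "fst \<theta>"]] show ?case by simp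
  qed
  then have "(\<integral>\<^sup>+\<theta>. emeasure (density lborel (normal_density (fst \<theta>) (snd \<theta>))) UNIV \<partial>H) = 1"
    using H.emeasure_space_1 by (simp cong: nn_integral_cong_AE)
  with mb(4)[of UNIV] have "prob_space (density lborel (mixture_density H))"
    by (intro prob_spaceI) simp
  from integrable_prob_density[OF _ mb(2) this] mb(3)
  show "integrable lborel (mixture_density H)" "integral\<^sup>L lborel (mixture_density H) = 1" by auto
qed

lemma emeasure_density_indicator:
  fixes f :: "real \<Rightarrow> real"
  assumes "integrable lborel f" "\<And>x. 0 \<le> f x" "B \<in> sets borel"
  shows "emeasure (density lborel f) B = ennreal (mass B f)"
proof -
  have [measurable]: "f \<in> borel_measurable borel" using assms by auto
  note integrable_indicator_mult[OF assms(1,3)]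
  then show ?thesis
    using assms by (simp add: emeasure_density nn_integral_eq_integral[symmetric] ennreal_mult''
      ennreal_indicator mult.commute)
qed

lemma mixture_density_mass_le:
  assumes H: "H \<in> mixing_distributions" and D: "supp H \<subseteq> {a..b} \<times> {s..c}" and s: "0 < s"
    and B: "B \<in> sets borel" and e: "0 \<le> e"
    "\<And>z \<sigma>. z \<in> {a..b} \<Longrightarrow> \<sigma> \<in> {s..c} \<Longrightarrow> mass B (normal_density z \<sigma>) \<le> e"
  shows "mass B (mixture_density H) \<le> e"
proof -
  note mb = mixture_density_bounded_support[OF H D s]
  note HD = mixing_distributionsD[OF H]
  interpret H: prob_space H by (rule HD)
  have "ennreal (mass B (mixture_density H))
      = (\<integral>\<^sup>+\<theta>. emeasure (density lborel (normal_density (fst \<theta>) (snd \<theta>))) B \<partial>H)"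
    using emeasure_density_indicator[OF mixture_density_prob(1)[OF H D s] mb(2) B] mb(4)[OF B] by simp
  also have "\<dots> \<le> (\<integral>\<^sup>+\<theta>. ennreal e \<partial>H)"
  proof (rule nn_integral_mono_AE)
    show "AE \<theta> in H. emeasure (density lborel (normal_density (fst \<theta>) (snd \<theta>))) B \<le> ennreal e"
      using AE_in_superset_of_supp[OF H D]
    proof eventually_elim
      case (elim \<theta>)
      then have "0 < snd \<theta>" "fst \<theta> \<in> {a..b}" "snd \<theta> \<in> {s..c}" using s by auto
      with e(2) show ?case
        using B by (subst emeasure_density_indicator) (auto simp: ennreal_leI)
    qed
  qed
  also have "\<dots> = ennreal e" using H.emeasure_space_1 by simp
  finally show ?thesis using e(1) by simp
qed

text \<open>
  Rounding the parameters to a fine grid replaces the mixing distribution by a finitely supported one. The densities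
  move little, uniformly on the line, because the Gaussian kernel is Lipschitz in the location and the inverse scale.
\<close>

lemma mixture_density_discretization:
  assumes H: "H \<in> mixing_distributions" and D: "supp H \<subseteq> {a..b} \<times> {s..c}" and s: "0 < s" and e: "0 < e"
  obtains G :: "(real \<times> real) set" and v :: "real \<times> real \<Rightarrow> real"
  where "finite G" "G \<subseteq> {a..b} \<times> {s..c}" "\<And>g. g \<in> G \<Longrightarrow> 0 \<le> v g" "(\<Sum>g\<in>G. v g) = 1"
    "\<And>x. \<bar>mixture_density H x - (\<Sum>g\<in>G. v g * normal_density (fst g) (snd g) x)\<bar> \<le> e"
proof -
  note mb = mixture_density_bounded_support[OF H D s]
  note HD = mixing_distributionsD[OF H]
  interpret H: prob_space H by (rule HD)
  have ae: "AE \<theta> in H. \<theta> \<in> {a..b} \<times> {s..c}" by (rule AE_in_superset_of_supp[OF H D])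
  define h where "h = e * s\<^sup>2 / 2"
  have h: "0 < h" using s e by (simp add: h_def)
  define r where "r \<theta> = (a + h * of_int \<lfloor>(fst \<theta> - a) / h\<rfloor>, s + h * of_int \<lfloor>(snd \<theta> - s) / h\<rfloor>)"
    for \<theta> :: "real \<times> real"
  have floor: "u \<le> u + h * of_int \<lfloor>(y - u) / h\<rfloor>" "u + h * of_int \<lfloor>(y - u) / h\<rfloor> \<le> y"
    "y - (u + h * of_int \<lfloor>(y - u) / h\<rfloor>) \<le> h" if "u \<le> y" for u y
  proof -
    have "0 \<le> (y - u) / h" using that h by simp
    then show "u \<le> u + h * of_int \<lfloor>(y - u) / h\<rfloor>" using h by simp
    have "h * of_int \<lfloor>(y - u) / h\<rfloor> \<le> h * ((y - u) / h)" using h by (intro mult_left_mono) auto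
    then show "u + h * of_int \<lfloor>(y - u) / h\<rfloor> \<le> y" using h by simp
    have "h * ((y - u) / h) \<le> h * (of_int \<lfloor>(y - u) / h\<rfloor> + 1)"
      using h by (intro mult_left_mono) linarith+
    moreover have "h * ((y - u) / h) = y - u" using h by simp
    ultimately show "y - (u + h * of_int \<lfloor>(y - u) / h\<rfloor>) \<le> h" unfolding distrib_left by linarith
  qed
  have rD: "r \<theta> \<in> {a..b} \<times> {s..c}" if "\<theta> \<in> {a..b} \<times> {s..c}" for \<theta>
  proof -
    have \<theta>: "a \<le> fst \<theta>" "fst \<theta> \<le> b" "s \<le> snd \<theta>" "snd \<theta> \<le> c" using that by auto
    show ?thesis unfolding r_def
      using floor[OF \<theta>(1)] floor[OF \<theta>(3)] \<theta> by auto
  qed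
  define G where "G = r ` ({a..b} \<times> {s..c})"
  have finG: "finite G"
  proof (rule finite_subset)
    show "G \<subseteq> (\<lambda>(i, j). (a + h * of_int i, s + h * of_int j)) ` ({0..\<lfloor>(b - a) / h\<rfloor>} \<times> {0..\<lfloor>(c - s) / h\<rfloor>})"
      unfolding G_def
    proof (rule image_subsetI)
      fix \<theta> assume \<theta>: "\<theta> \<in> {a..b} \<times> {s..c}"
      show "r \<theta> \<in> (\<lambda>(i, j). (a + h * of_int i, s + h * of_int j)) ` ({0..\<lfloor>(b - a) / h\<rfloor>} \<times> {0..\<lfloor>(c - s) / h\<rfloor>})"
        using \<theta> h by (intro image_eqI[of _ _ "(\<lfloor>(fst \<theta> - a) / h\<rfloor>, \<lfloor>(snd \<theta> - s) / h\<rfloor>)"])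
          (auto simp: r_def intro!: floor_mono divide_right_mono)
    qed
  qed auto
  have close: "\<bar>normal_density (fst \<theta>) (snd \<theta>) x - normal_density (fst (r \<theta>)) (snd (r \<theta>)) x\<bar> \<le> e"
    if \<theta>: "\<theta> \<in> {a..b} \<times> {s..c}" for \<theta> x
  proof -
    define z \<sigma> z' \<sigma>' where "z = fst \<theta>" and "\<sigma> = snd \<theta>" and "z' = fst (r \<theta>)" and "\<sigma>' = snd (r \<theta>)"
    have p: "s \<le> \<sigma>" "s \<le> \<sigma>'" "a \<le> z" using \<theta> rD[OF \<theta>] by (auto simp: z_def \<sigma>_def \<sigma>'_def mem_Times_iff)
    have d: "\<bar>z - z'\<bar> \<le> h" "\<bar>\<sigma> - \<sigma>'\<bar> \<le> h"
      using floor[of a z] floor[of s \<sigma>] p by (auto simp: z'_def \<sigma>'_def r_def z_def \<sigma>_def)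
    have "1 / \<sigma> - 1 / \<sigma>' = (\<sigma>' - \<sigma>) / (\<sigma> * \<sigma>')"
      using p s by (simp add: diff_frac_eq)
    then have "\<bar>1 / \<sigma> - 1 / \<sigma>'\<bar> = \<bar>\<sigma> - \<sigma>'\<bar> / (\<sigma> * \<sigma>')"
      using p s by (simp add: abs_mult abs_minus_commute)
    also have "\<dots> \<le> h / (s * s)" using d p s h by (intro frac_le mult_mono) auto
    finally have 1: "\<bar>1 / \<sigma> - 1 / \<sigma>'\<bar> \<le> h / s\<^sup>2" by (simp add: power2_eq_square)
    have "(1 / \<sigma>)\<^sup>2 * \<bar>z - z'\<bar> \<le> (1 / s)\<^sup>2 * h"
      using d p s h by (intro mult_mono power_mono frac_le) auto
    also have "\<dots> = h / s\<^sup>2" by (simp add: power_divide)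
    finally have 2: "(1 / \<sigma>)\<^sup>2 * \<bar>z - z'\<bar> \<le> h / s\<^sup>2" .
    have "\<bar>gauss_kernel (1 / \<sigma>) z x - gauss_kernel (1 / \<sigma>') z' x\<bar> \<le> h / s\<^sup>2 + h / s\<^sup>2"
      using gauss_kernel_Lipschitz[of "1 / \<sigma>" z x "1 / \<sigma>'" z'] 1 2 p s by simp
    also have "\<dots> = e" using s by (simp add: h_def)
    finally show ?thesis
      using normal_density_eq_gauss_kernel[of \<sigma> 1 z x 0] normal_density_eq_gauss_kernel[of \<sigma>' 1 z' x 0] p s
      unfolding z_def[symmetric] \<sigma>_def[symmetric] z'_def[symmetric] \<sigma>'_def[symmetric] by simp
  qed
  have r_meas: "r \<in> measurable H borel"
  proof (rule HD(3))
    show "r \<in> borel_measurable borel" unfolding r_def[abs_def] borel_prod[symmetric] by measurable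
  qed
  define v where "v g = measure H {\<theta> \<in> space H. r \<theta> = g}" for g
  have ev: "{\<theta> \<in> space H. r \<theta> = g} \<in> sets H" for g
    using measurable_sets[OF r_meas, of "{g}"] by (simp add: vimage_def Int_def conj_commute)
  have rep: "(\<integral>\<theta>. F (r \<theta>) \<partial>H) = (\<Sum>g\<in>G. v g * F g)" and rep_int: "integrable H (\<lambda>\<theta>. F (r \<theta>))"
    if F: "F \<in> borel_measurable borel" for F :: "real \<times> real \<Rightarrow> real"
  proof -
    have *: "AE \<theta> in H. F (r \<theta>) = (\<Sum>g\<in>G. indicator {\<theta> \<in> space H. r \<theta> = g} \<theta> * F g)"
      using ae AE_space
    proof eventually_elim
      case (elim \<theta>)
      then have "r \<theta> \<in> G" by (auto simp: G_def)
      have "(\<Sum>g\<in>G. indicator {\<theta> \<in> space H. r \<theta> = g} \<theta> * F g) = (\<Sum>g\<in>G. if r \<theta> = g then F g else 0)"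
        using elim by (intro sum.cong) (auto split: split_indicator)
      also have "\<dots> = F (r \<theta>)" using \<open>r \<theta> \<in> G\<close> finG by simp
      finally show ?case by simp
    qed
    have Fm: "(\<lambda>\<theta>. F (r \<theta>)) \<in> borel_measurable H" using measurable_compose[OF r_meas F] .
    have i: "integrable H (\<lambda>\<theta>. indicator {\<theta> \<in> space H. r \<theta> = g} \<theta> * F g)" for g
      using ev[of g] by (intro integrable_mult_left integrable_real_indicator) (auto simp: H.emeasure_eq_measure)
    have im: "(\<lambda>\<theta>. \<Sum>g\<in>G. indicator {\<theta> \<in> space H. r \<theta> = g} \<theta> * F g) \<in> borel_measurable H"
      by (rule borel_measurable_sum) (rule borel_measurable_integrable[OF i])
    show "(\<integral>\<theta>. F (r \<theta>) \<partial>H) = (\<Sum>g\<in>G. v g * F g)"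
      using i ev unfolding integral_cong_AE[OF Fm im *] by (simp add: v_def)
    show "integrable H (\<lambda>\<theta>. F (r \<theta>))"
      unfolding integrable_cong_AE[OF Fm im *] by (rule Bochner_Integration.integrable_sum) (rule i)
  qed
  show thesis
  proof (rule that[of G v])
    show "finite G" by fact
    show "G \<subseteq> {a..b} \<times> {s..c}" unfolding G_def using rD by blast
    show "0 \<le> v g" for g by (simp add: v_def)
    show "(\<Sum>g\<in>G. v g) = 1" using rep[of "\<lambda>_. 1"] by (simp add: H.prob_space)
    fix x
    let ?f = "\<lambda>\<theta> :: real \<times> real. normal_density (fst \<theta>) (snd \<theta>) x"
    have fm: "?f \<in> borel_measurable borel" by measurable
    have "\<bar>(\<integral>\<theta>. ?f \<theta> \<partial>H) - (\<integral>\<theta>. ?f (r \<theta>) \<partial>H)\<bar> = \<bar>\<integral>\<theta>. ?f \<theta> - ?f (r \<theta>) \<partial>H\<bar>"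
      using mb(1) rep_int[OF fm] by simp
    also have "\<dots> \<le> (\<integral>\<theta>. \<bar>?f \<theta> - ?f (r \<theta>)\<bar> \<partial>H)" by (rule integral_abs_bound)
    also have "\<dots> \<le> (\<integral>\<theta>. e \<partial>H)"
    proof (rule integral_mono_AE)
      show "AE \<theta> in H. \<bar>?f \<theta> - ?f (r \<theta>)\<bar> \<le> e" using ae close by (auto elim!: eventually_mono)
    qed (use mb(1) rep_int[OF fm] in auto)
    also have "\<dots> = e" by (simp add: H.prob_space)
    finally show "\<bar>mixture_density H x - (\<Sum>g\<in>G. v g * normal_density (fst g) (snd g) x)\<bar> \<le> e"
      unfolding rep[OF fm] by (simp add: mixture_density_def case_prod_unfold)
  qed
qed

lemma normal_mixture_mass:
  fixes f :: "nat \<Rightarrow> real \<Rightarrow> real"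
  assumes "\<And>k. k < K \<Longrightarrow> 0 \<le> w k" "(\<Sum>k<K. w k) = 1" "\<And>k. k < K \<Longrightarrow> integrable lborel (f k)"
    "B \<in> sets borel" "\<And>k. k < K \<Longrightarrow> mass B (f k) \<le> e"
  shows "mass B (\<lambda>x. \<Sum>k<K. w k * f k x) \<le> (e :: real)"
proof -
  have i: "integrable lborel (\<lambda>x. indicator B x * f k x)" if "k < K" for k
    using assms(3)[OF that] assms(4) by (rule integrable_indicator_mult)
  have "mass B (\<lambda>x. \<Sum>k<K. w k * f k x)
      = (\<integral>x. (\<Sum>k<K. w k * (indicator B x * f k x)) \<partial>lborel)"
    by (simp add: sum_distrib_left mult_ac)
  also have "\<dots> = (\<Sum>k<K. w k * mass B (f k))"
    using i by (subst Bochner_Integration.integral_sum) auto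
  also have "\<dots> \<le> (\<Sum>k<K. w k * e)" using assms by (intro sum_mono mult_left_mono) auto
  also have "\<dots> = e" using assms(2) by (simp add: sum_distrib_right[symmetric])
  finally show ?thesis .
qed

lemma normal_outside_window:
  assumes "0 < s" "0 \<le> t" "z \<in> {l - s * A..l + s * A}" "\<sigma> \<in> {s..s * R}" "0 \<le> R"
  shows "mass (- {l - s * (A + 2 * R * sqrt t)..l + s * (A + 2 * R * sqrt t)}) (normal_density z \<sigma>) \<le> 2 * exp (- t)"
proof (rule normal_tail)
  show "0 < \<sigma>" "0 \<le> t" using assms by auto
  fix x assume "x \<in> - {l - s * (A + 2 * R * sqrt t)..l + s * (A + 2 * R * sqrt t)}"
  then have "s * (A + 2 * R * sqrt t) \<le> \<bar>x - l\<bar>" by auto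
  moreover have "\<bar>z - l\<bar> \<le> s * A" using assms by (auto simp: abs_le_iff)
  ultimately have "s * (2 * R * sqrt t) \<le> \<bar>x - z\<bar>" by (simp add: distrib_left)
  moreover have "2 * \<sigma> * sqrt t \<le> 2 * (s * R) * sqrt t" using assms by (intro mult_right_mono) auto
  ultimately have "2 * \<sigma> * sqrt t \<le> \<bar>x - z\<bar>" by (simp add: mult_ac)
  then have "(2 * \<sigma> * sqrt t)\<^sup>2 \<le> \<bar>x - z\<bar>\<^sup>2" using assms by (intro power_mono) auto
  then show "4 * \<sigma>\<^sup>2 * t \<le> (x - z)\<^sup>2" using assms by (simp add: power_mult_distrib)
qed auto

text \<open>
  In the window of half-width \<open>s * B\<close> the discretised and the reduced mixture differ by the Taylor error;
  outside it, the given and the reduced mixture have tails of mass at most \<open>2 * exp (- t)\<close> each.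
\<close>

lemma finite_mixture_approximation:
  assumes H: "H \<in> mixing_distributions" and D: "supp H \<subseteq> {l - s * A..l + s * A} \<times> {s..s * R}"
    and s: "0 < s" and AR: "0 \<le> A" "0 \<le> R" and t: "0 \<le> t" and B: "B = A + 2 * R * sqrt t"
    and J: "exp 3 * ((B + A)\<^sup>2 / 2) \<le> real J" "0 < J" and K: "2 * J + 1 \<le> K"
  obtains w :: "nat \<Rightarrow> real" and z \<sigma> :: "nat \<Rightarrow> real"
  where "\<And>k. k < K \<Longrightarrow> 0 \<le> w k" "(\<Sum>k<K. w k) = 1"
    "\<And>k. z k \<in> {l - s * A..l + s * A}" "\<And>k. \<sigma> k \<in> {s..s * R}"
    "(\<integral>x. \<bar>mixture_density H x - (\<Sum>k<K. w k * normal_density (z k) (\<sigma> k) x)\<bar> \<partial>lborel)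
       \<le> 6 * B * exp (- real J) + 4 * exp (- t)"
proof -
  note mb = mixture_density_bounded_support[OF H D s] and mp = mixture_density_prob[OF H D s]
  have e: "0 < exp (- real J) / s" using s by simp
  obtain G v where G: "finite G" "G \<subseteq> {l - s * A..l + s * A} \<times> {s..s * R}"
    "\<And>g. g \<in> G \<Longrightarrow> 0 \<le> v g" "(\<Sum>g\<in>G. v g) = 1"
    "\<And>x. \<bar>mixture_density H x - (\<Sum>g\<in>G. v g * normal_density (fst g) (snd g) x)\<bar> \<le> exp (- real J) / s"
    by (rule mixture_density_discretization[OF H D s e]; rule that)
  obtain w z \<sigma> where w: "\<And>k. k < K \<Longrightarrow> 0 \<le> w k" "(\<Sum>k<K. w k) = 1"
    "\<And>k. z k \<in> {l - s * A..l + s * A}" "\<And>k. \<sigma> k \<in> {s..s * R}"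
    "\<And>x. \<bar>x - l\<bar> \<le> s * B \<Longrightarrow> \<bar>(\<Sum>g\<in>G. v g * normal_density (fst g) (snd g) x)
       - (\<Sum>k<K. w k * normal_density (z k) (\<sigma> k) x)\<bar> \<le> 2 * exp (- real J) / s"
    using finite_mixture_reduction[OF G(1,2) s G(3,4) J K] by blast
  let ?p = "mixture_density H" and ?q = "\<lambda>x. \<Sum>k<K. w k * normal_density (z k) (\<sigma> k) x"
  let ?I = "{l - s * B..l + s * B}" and ?c = "3 * exp (- real J) / s"
  have \<sigma>: "0 < \<sigma> k" for k using w(4)[of k] s by auto
  have iq: "integrable lborel ?q" using \<sigma> by (intro Bochner_Integration.integrable_sum integrable_mult_right) auto
  have q0: "0 \<le> ?q x" for x using w(1) by (intro sum_nonneg mult_nonneg_nonneg) auto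
  have B0: "0 \<le> B" using B AR t by simp
  have tail: "mass (- ?I) (normal_density z \<sigma>) \<le> 2 * exp (- t)"
    if "z \<in> {l - s * A..l + s * A}" "\<sigma> \<in> {s..s * R}" for z \<sigma>
    unfolding B using s t that AR(2) by (rule normal_outside_window)
  have tp: "mass (- ?I) ?p \<le> 2 * exp (- t)"
    by (rule mixture_density_mass_le[OF H D s]) (use tail in auto)
  have tq: "mass (- ?I) ?q \<le> 2 * exp (- t)"
    by (rule normal_mixture_mass[OF w(1,2)]) (use tail w(3,4) \<sigma> in auto)
  have ip': "integrable lborel (\<lambda>x. indicator (- ?I) x * ?p x)"
    by (rule integrable_indicator_mult[OF mp(1)]) auto
  have iq': "integrable lborel (\<lambda>x. indicator (- ?I) x * ?q x)"
    by (rule integrable_indicator_mult[OF iq]) auto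
  have ic: "integrable lborel (\<lambda>x. indicator ?I x * ?c)"
    by (rule integrable_mult_left, rule integrable_real_indicator) (simp_all add: emeasure_lborel_Icc_eq)
  have "(\<integral>x. \<bar>?p x - ?q x\<bar> \<partial>lborel)
      \<le> (\<integral>x. indicator ?I x * ?c + (indicator (- ?I) x * ?p x + indicator (- ?I) x * ?q x) \<partial>lborel)"
  proof (rule integral_mono)
    show "integrable lborel (\<lambda>x. \<bar>?p x - ?q x\<bar>)" using mp(1) iq by simp
    show "integrable lborel (\<lambda>x. indicator ?I x * ?c + (indicator (- ?I) x * ?p x + indicator (- ?I) x * ?q x))"
      by (intro Bochner_Integration.integrable_add ic ip' iq')
    show "\<bar>?p x - ?q x\<bar> \<le> indicator ?I x * ?c + (indicator (- ?I) x * ?p x + indicator (- ?I) x * ?q x)" for x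
    proof (cases "x \<in> ?I")
      case True
      then have "\<bar>x - l\<bar> \<le> s * B" by (auto simp: abs_le_iff)
      from w(5)[OF this] G(5)[of x] have "\<bar>?p x - ?q x\<bar> \<le> exp (- real J) / s + 2 * exp (- real J) / s"
        by linarith
      also have "\<dots> = ?c" by simp
      finally show ?thesis using True by simp
    next
      case False
      then show ?thesis using mb(2)[of x] q0[of x] by simp
    qed
  qed
  also have "\<dots> = (\<integral>x. indicator ?I x * ?c \<partial>lborel)
      + (mass (- ?I) ?p + mass (- ?I) ?q)"
    by (simp only: Bochner_Integration.integral_add[OF ic Bochner_Integration.integrable_add[OF ip' iq']]
      Bochner_Integration.integral_add[OF ip' iq'])
  also have "(\<integral>x. indicator ?I x * ?c \<partial>lborel) = 6 * B * exp (- real J)"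
    using B0 s by simp
  finally have "(\<integral>x. \<bar>?p x - ?q x\<bar> \<partial>lborel) \<le> 6 * B * exp (- real J) + 4 * exp (- t)"
    using tp tq by linarith
  with w that show thesis by blast
qed

text \<open>
  A convex combination with the uniform weights raises all weights to the threshold. Rounding up to rational
  numbers keeps them there; the excess is taken from one weight that is at least \<open>1 / K\<close> and hence has room.
\<close>

lemma rational_weights:
  fixes w :: "nat \<Rightarrow> real"
  assumes w: "\<And>k. k < K \<Longrightarrow> 0 \<le> w k" "(\<Sum>k<K. w k) = 1" and \<delta>: "0 \<le> \<delta>" "real K * \<delta> < 1" and e: "0 < e"
  obtains w' :: "nat \<Rightarrow> real"
  where "\<And>k. k < K \<Longrightarrow> w' k \<in> \<rat>" "\<And>k. k < K \<Longrightarrow> \<delta> \<le> w' k" "(\<Sum>k<K. w' k) = 1"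
    "(\<Sum>k<K. \<bar>w' k - w k\<bar>) \<le> 2 * real K * \<delta> + e"
proof -
  have K: "0 < K" using w(2) by (cases K) auto
  define v where "v k = (1 - real K * \<delta>) * w k + \<delta>" for k
  have vsum: "(\<Sum>k<K. v k) = 1"
    by (simp add: v_def sum.distrib sum_distrib_left[symmetric] w(2))
  have "\<exists>k0<K. 1 / real K \<le> w k0"
  proof (rule ccontr)
    assume "\<not> ?thesis"
    then have "(\<Sum>k<K. w k) < (\<Sum>k<K. 1 / real K)" using K by (intro sum_strict_mono) auto
    then show False using w(2) K by simp
  qed
  then obtain k0 where k0: "k0 < K" "1 / real K \<le> w k0" by auto
  \<comment> \<open>The total excess, at most \<open>K * \<eta>\<close>, must fit into the slack of the weight at \<open>k0\<close> and into the error \<open>e\<close>.\<close>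
  define \<eta> where "\<eta> = min (e / (2 * real K)) ((1 - real K * \<delta>) / (real K)\<^sup>2)"
  have \<eta>: "0 < \<eta>" "\<eta> \<le> e / (2 * real K)" "\<eta> \<le> (1 - real K * \<delta>) / (real K)\<^sup>2"
    using K e \<delta> by (auto simp: \<eta>_def)
  have "\<exists>r. r \<in> \<rat> \<and> v k < r \<and> r < v k + \<eta>" for k
    using Rats_dense_in_real[of "v k" "v k + \<eta>"] \<eta>(1) by auto
  then obtain r where r: "r k \<in> \<rat>" "v k < r k" "r k < v k + \<eta>" for k by metis
  define S where "S = {..<K} - {k0}"
  have S: "finite S" "card S \<le> K" "\<And>k. k \<in> S \<Longrightarrow> k < K \<and> k \<noteq> k0"
    using k0 by (auto simp: S_def card_Diff_singleton_if)
  have split: "(\<Sum>k<K. f k) = f k0 + (\<Sum>k\<in>S. f k)" for f :: "nat \<Rightarrow> real"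
    unfolding S_def using k0 by (intro sum.remove) auto
  define w' where "w' k = (if k = k0 then 1 - (\<Sum>k\<in>S. r k) else r k)" for k
  have w'S: "(\<Sum>k\<in>S. w' k) = (\<Sum>k\<in>S. r k)" using S by (intro sum.cong) (auto simp: w'_def)
  have diffS: "0 \<le> (\<Sum>k\<in>S. r k - v k)" "(\<Sum>k\<in>S. r k - v k) \<le> real K * \<eta>"
  proof -
    show "0 \<le> (\<Sum>k\<in>S. r k - v k)" using r(2) by (intro sum_nonneg) (simp add: less_imp_le)
    have "(\<Sum>k\<in>S. r k - v k) \<le> (\<Sum>k\<in>S. \<eta>)" using r(3) by (intro sum_mono) (simp add: less_imp_le add.commute diff_le_eq)
    also have "\<dots> \<le> real K * \<eta>" using S \<eta> by (simp add: mult_right_mono)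
    finally show "(\<Sum>k\<in>S. r k - v k) \<le> real K * \<eta>" .
  qed
  have w'k0: "w' k0 = v k0 - (\<Sum>k\<in>S. r k - v k)"
    using split[of v] vsum by (simp add: w'_def sum_subtractf)
  have Kn: "real K * \<eta> \<le> (1 - real K * \<delta>) * (1 / real K)" "real K * \<eta> \<le> e / 2"
  proof -
    have "real K * \<eta> \<le> real K * ((1 - real K * \<delta>) / (real K)\<^sup>2)" using \<eta> by (intro mult_left_mono) auto
    also have "\<dots> = (1 - real K * \<delta>) * (1 / real K)" using K by (simp add: power2_eq_square)
    finally show "real K * \<eta> \<le> (1 - real K * \<delta>) * (1 / real K)" .
    have "real K * \<eta> \<le> real K * (e / (2 * real K))" using \<eta> by (intro mult_left_mono) auto
    also have "\<dots> = e / 2" using K by simp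
    finally show "real K * \<eta> \<le> e / 2" .
  qed
  have "(1 - real K * \<delta>) * (1 / real K) \<le> (1 - real K * \<delta>) * w k0" using k0 \<delta> by (intro mult_left_mono) auto
  then have w'0: "\<delta> \<le> w' k0" unfolding w'k0 using diffS Kn by (simp add: v_def)
  show thesis
  proof (rule that[of w'])
    show "w' k \<in> \<rat>" for k unfolding w'_def using r(1) S by (auto intro!: Rats_diff Rats_sum)
    show "\<delta> \<le> w' k" if "k < K" for k
    proof (cases "k = k0")
      case False
      have "\<delta> \<le> v k" using w(1)[OF that] \<delta> by (simp add: v_def)
      then show ?thesis using False r(2)[of k] by (simp add: w'_def)
    qed (use w'0 in simp)
    show "(\<Sum>k<K. w' k) = 1" unfolding split w'S by (simp add: w'_def)
    have "(\<Sum>k<K. \<bar>w' k - w k\<bar>) \<le> (\<Sum>k<K. \<bar>w' k - v k\<bar> + \<bar>v k - w k\<bar>)" by (intro sum_mono) linarith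
    also have "\<dots> = (\<Sum>k<K. \<bar>w' k - v k\<bar>) + (\<Sum>k<K. \<bar>v k - w k\<bar>)" by (rule sum.distrib)
    also have "(\<Sum>k<K. \<bar>w' k - v k\<bar>) \<le> e"
    proof -
      have "(\<Sum>k\<in>S. \<bar>w' k - v k\<bar>) = (\<Sum>k\<in>S. r k - v k)"
        using S r(2) by (intro sum.cong) (auto simp: w'_def less_imp_le)
      moreover have "\<bar>w' k0 - v k0\<bar> = (\<Sum>k\<in>S. r k - v k)" unfolding w'k0 using diffS by simp
      ultimately show ?thesis unfolding split using diffS Kn by linarith
    qed
    also have "(\<Sum>k<K. \<bar>v k - w k\<bar>) \<le> (\<Sum>k<K. \<delta> + real K * \<delta> * w k)"
    proof (rule sum_mono)
      fix k assume "k \<in> {..<K}"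
      then have "0 \<le> real K * \<delta> * w k" using w(1) \<delta> by simp
      then show "\<bar>v k - w k\<bar> \<le> \<delta> + real K * \<delta> * w k" using \<delta> by (simp add: v_def algebra_simps)
    qed
    also have "\<dots> = 2 * real K * \<delta>" by (simp add: sum.distrib sum_distrib_left[symmetric] w(2))
    finally show "(\<Sum>k<K. \<bar>w' k - w k\<bar>) \<le> 2 * real K * \<delta> + e" by simp
  qed
qed

text \<open>
  Raising the weights of a Gaussian mixture to the threshold costs \<open>2 * K * \<delta>\<close>. Making them rational and replacing the
  components by elements of the dense set costs arbitrarily little, since the Hellinger distance controls the
  \<open>L\<^sup>1\<close> distance.
\<close>

lemma approximation_in_model:
  fixes w z \<sigma> :: "nat \<Rightarrow> real"
  assumes F: "countable_dense_gaussians F" and \<sigma>: "\<And>k. 0 < \<sigma> k"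
    and w: "\<And>k. k < K \<Longrightarrow> 0 \<le> w k" "(\<Sum>k<K. w k) = 1" and \<delta>: "0 \<le> \<delta>" "real K * \<delta> < 1" and e: "0 < e"
  obtains w' f
  where "\<And>k. k < K \<Longrightarrow> 0 \<le> w' k" "(\<Sum>k<K. w' k) = 1"
    "\<And>k. f k \<in> gaussian_densities" "\<And>k. (\<integral>x. \<bar>f k x - normal_density (z k) (\<sigma> k) x\<bar> \<partial>lborel) \<le> e"
    "(\<lambda>x. \<Sum>k<K. w' k * f k x) \<in> finite_mixture_densities F K \<delta>"
    "(\<integral>x. \<bar>(\<Sum>k<K. w' k * f k x) - (\<Sum>k<K. w k * normal_density (z k) (\<sigma> k) x)\<bar> \<partial>lborel)
       \<le> 2 * real K * \<delta> + 2 * e"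
proof -
  obtain w' :: "nat \<Rightarrow> real" where w': "\<And>k. k < K \<Longrightarrow> w' k \<in> \<rat>" "\<And>k. k < K \<Longrightarrow> \<delta> \<le> w' k"
    "(\<Sum>k<K. w' k) = 1" "(\<Sum>k<K. \<bar>w' k - w k\<bar>) \<le> 2 * real K * \<delta> + e"
    using rational_weights[OF w \<delta> e] by blast
  have w0: "0 \<le> w' k" if "k < K" for k using w'(2)[OF that] \<delta> by linarith
  let ?g = "\<lambda>k. normal_density (z k) (\<sigma> k)"
  have "\<exists>f. f \<in> gaussian_densities \<and> density lborel f \<in> F \<and> (\<integral>x. \<bar>f x - ?g k x\<bar> \<partial>lborel) \<le> e" for k
  proof -
    have "density lborel (?g k) \<in> distributions_of gaussian_densities"
      unfolding distributions_of_def gaussian_densities_def using \<sigma>[of k] by auto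
    then obtain Q where Q: "Q \<in> F" "hellinger (density lborel (?g k)) Q < e / 3"
      using F e unfolding countable_dense_gaussians_def by (meson divide_pos_pos zero_less_numeral)
    then have "Q \<in> distributions_of gaussian_densities" using F by (auto simp: countable_dense_gaussians_def)
    then obtain f where f: "Q = density lborel (\<lambda>x. ennreal (f x))" "f \<in> gaussian_densities" by (auto simp: distributions_of_def)
    then obtain z' \<sigma>' where f': "f = normal_density z' \<sigma>'" "0 < \<sigma>'" by (auto simp: gaussian_densities_def)
    have "(\<integral>x. \<bar>?g k x - f x\<bar> \<partial>lborel) \<le> 3 * (e / 3)"
      using Q(2) e \<sigma>[of k] f' f(1) by (intro L1_le_hellinger) auto
    then show ?thesis using Q f by (intro exI[of _ f]) (auto simp: abs_minus_commute)
  qed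
  then obtain f where f: "f k \<in> gaussian_densities" "density lborel (f k) \<in> F"
    "(\<integral>x. \<bar>f k x - ?g k x\<bar> \<partial>lborel) \<le> e" for k by metis
  have fi: "integrable lborel (f k)" for k using f(1)[of k] by (auto simp: gaussian_densities_def)
  have gi: "integrable lborel (?g k)" "integral\<^sup>L lborel (?g k) = 1" for k using \<sigma>[of k] by auto
  show thesis
  proof (rule that[of w' f])
    show "0 \<le> w' k" if "k < K" for k by (rule w0[OF that])
    show "(\<Sum>k<K. w' k) = 1" "f k \<in> gaussian_densities" "(\<integral>x. \<bar>f k x - ?g k x\<bar> \<partial>lborel) \<le> e" for k
      using w' f by auto
    have le1: "w' k \<le> 1" if "k < K" for k
      using member_le_sum[of k "{..<K}" w'] w0 w'(3) that by auto
    show "(\<lambda>x. \<Sum>k<K. w' k * f k x) \<in> finite_mixture_densities F K \<delta>"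
      unfolding finite_mixture_densities_def mem_Collect_eq
      using w' w0 le1 f by (intro exI[of _ w'] exI[of _ f]) auto
    have "(\<integral>x. \<bar>(\<Sum>k<K. w' k * f k x) - (\<Sum>k<K. w k * ?g k x)\<bar> \<partial>lborel)
        \<le> (\<integral>x. (\<Sum>k<K. w' k * \<bar>f k x - ?g k x\<bar> + \<bar>w' k - w k\<bar> * ?g k x) \<partial>lborel)"
    proof (rule integral_mono)
      show "integrable lborel (\<lambda>x. \<bar>(\<Sum>k<K. w' k * f k x) - (\<Sum>k<K. w k * ?g k x)\<bar>)"
        using fi gi by (intro integrable_abs Bochner_Integration.integrable_diff
          Bochner_Integration.integrable_sum integrable_mult_right)
      show "integrable lborel (\<lambda>x. \<Sum>k<K. w' k * \<bar>f k x - ?g k x\<bar> + \<bar>w' k - w k\<bar> * ?g k x)"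
        using fi gi by (intro integrable_abs Bochner_Integration.integrable_diff Bochner_Integration.integrable_add
          Bochner_Integration.integrable_sum integrable_mult_right)
      fix x
      have "\<bar>(\<Sum>k<K. w' k * f k x) - (\<Sum>k<K. w k * ?g k x)\<bar>
          = \<bar>\<Sum>k<K. w' k * (f k x - ?g k x) + (w' k - w k) * ?g k x\<bar>"
        by (simp add: algebra_simps sum_subtractf)
      also have "\<dots> \<le> (\<Sum>k<K. w' k * \<bar>f k x - ?g k x\<bar> + \<bar>w' k - w k\<bar> * ?g k x)"
        using w0 by (intro order.trans[OF sum_abs] sum_mono order.trans[OF abs_triangle_ineq]) (auto simp: abs_mult)
      finally show "\<bar>(\<Sum>k<K. w' k * f k x) - (\<Sum>k<K. w k * ?g k x)\<bar>
          \<le> (\<Sum>k<K. w' k * \<bar>f k x - ?g k x\<bar> + \<bar>w' k - w k\<bar> * ?g k x)" .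
    qed
    also have "\<dots> = (\<Sum>k<K. w' k * (\<integral>x. \<bar>f k x - ?g k x\<bar> \<partial>lborel) + \<bar>w' k - w k\<bar>)"
      using fi gi by (simp add: Bochner_Integration.integral_sum)
    also have "\<dots> \<le> (\<Sum>k<K. w' k * e + \<bar>w' k - w k\<bar>)"
      using w0 f(3) by (intro sum_mono add_right_mono mult_left_mono) auto
    also have "\<dots> = e + (\<Sum>k<K. \<bar>w' k - w k\<bar>)"
      by (simp add: sum.distrib sum_distrib_right[symmetric] w'(3))
    also have "\<dots> \<le> 2 * real K * \<delta> + 2 * e" using w'(4) by simp
    finally show "(\<integral>x. \<bar>(\<Sum>k<K. w' k * f k x) - (\<Sum>k<K. w k * ?g k x)\<bar> \<partial>lborel) \<le> 2 * real K * \<delta> + 2 * e" .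
  qed
qed

section \<open>Uniform deviation bound over the model\<close>

definition gaussian_mixture :: "nat \<Rightarrow> (real \<Rightarrow> real) \<Rightarrow> bool" where
  "gaussian_mixture K q \<longleftrightarrow> (\<exists>w f. (\<forall>k<K. 0 \<le> w k) \<and> (\<Sum>k<K. w k) = 1 \<and>
     (\<forall>k<K. f k \<in> gaussian_densities) \<and> q = (\<lambda>x. \<Sum>k<K. w k * f k x))"

lemma finite_mixture_densities_gaussian_mixture:
  assumes "q \<in> finite_mixture_densities F K \<delta>"
  shows "gaussian_mixture K q"
proof -
  obtain w f where "\<forall>k<K. w k \<in> {0..1} \<and> \<delta> \<le> w k \<and> w k \<in> \<rat>" "(\<Sum>k<K. w k) = 1"
    "\<forall>k<K. f k \<in> gaussian_densities \<and> density lborel (\<lambda>x. ennreal (f k x)) \<in> F"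
    "q = (\<lambda>x. \<Sum>k<K. w k * f k x)"
    using assms unfolding finite_mixture_densities_def mem_Collect_eq by (elim exE conjE) (rule that)
  then show ?thesis unfolding gaussian_mixture_def by (intro exI[of _ w] exI[of _ f]) simp
qed

lemma gaussian_densitiesD:
  assumes "f \<in> gaussian_densities"
  shows "integrable lborel f" "integral\<^sup>L lborel f = 1" "0 < f x"
  using assms by (auto simp: gaussian_densities_def normal_density_pos)

lemma gaussian_mixtureD:
  assumes "gaussian_mixture K q"
  shows "integrable lborel q" "integral\<^sup>L lborel q = 1" "0 < q x"
proof -
  obtain w f where w: "\<forall>k<K. 0 \<le> w k" "(\<Sum>k<K. w k) = 1" "\<forall>k<K. f k \<in> gaussian_densities"
    and q: "q = (\<lambda>x. \<Sum>k<K. w k * f k x)"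
    using assms by (auto simp: gaussian_mixture_def)
  note f = gaussian_densitiesD[OF w(3)[rule_format]]
  have i: "integrable lborel (\<lambda>x. w k * f k x)" if "k < K" for k using f[OF that] by simp
  show "integrable lborel q" unfolding q using i by (intro Bochner_Integration.integrable_sum) auto
  have "integral\<^sup>L lborel q = (\<Sum>k<K. w k * integral\<^sup>L lborel (f k))"
    unfolding q using i by (subst Bochner_Integration.integral_sum) auto
  also have "\<dots> = 1" using f w(2) by simp
  finally show "integral\<^sup>L lborel q = 1" .
  have "\<exists>k<K. 0 < w k"
  proof (rule ccontr)
    assume "\<not> ?thesis"
    then have "w k \<le> 0" if "k < K" for k using that by (meson not_less)
    then have "(\<Sum>k<K. w k) \<le> 0" by (intro sum_nonpos) simp
    then show False using w(2) by simp
  qed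
  then obtain k where "k < K" "0 < w k" by auto
  then show "0 < q x" unfolding q using w f
    by (intro sum_pos2[of _ k] mult_nonneg_nonneg mult_pos_pos) (auto intro: less_imp_le)
qed

text \<open>
  Simultaneous upper brackets for all mixtures: the weights are rounded up to multiples of \<open>1 / N\<^sup>2\<close>, the
  components are taken from the Gaussian brackets, in the coordinate \<open>(x - l) / s\<close>.
\<close>

definition bracket_indices :: "nat \<Rightarrow> nat \<Rightarrow> (nat \<Rightarrow> nat \<times> nat \<times> int) set" where
  "bracket_indices N K = PiE {..<K} (\<lambda>_. {..N ^ 2} \<times> {..N ^ 15} \<times> {- (int N ^ 30)..int N ^ 30})"

definition bracket_component :: "nat \<Rightarrow> real \<Rightarrow> real \<Rightarrow> nat \<Rightarrow> int \<Rightarrow> real \<Rightarrow> real" where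
  "bracket_component N l s i j x =
     (1 / real N ^ 4 + gauss_kernel (real i / real N ^ 5) (of_int j / real N ^ 25) ((x - l) / s)) / s"

definition bracket_upper :: "nat \<Rightarrow> nat \<Rightarrow> real \<Rightarrow> real \<Rightarrow> (nat \<Rightarrow> nat \<times> nat \<times> int) \<Rightarrow> real \<Rightarrow> real" where
  "bracket_upper N K l s \<omega> x = (\<Sum>k<K. real (fst (\<omega> k)) / real N ^ 2 *
     bracket_component N l s (fst (snd (\<omega> k))) (snd (snd (\<omega> k))) x)"

definition bracket_spike :: "nat \<Rightarrow> real \<Rightarrow> real \<Rightarrow> int \<Rightarrow> real set" where
  "bracket_spike N l s j = {x. \<bar>(x - l) / s - of_int j / real N ^ 25\<bar> \<le> 1 / (2 * real N ^ 2)}"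

definition bracket_domain :: "nat \<Rightarrow> nat \<Rightarrow> real \<Rightarrow> real \<Rightarrow> (nat \<Rightarrow> nat \<times> nat \<times> int) \<Rightarrow> real set" where
  "bracket_domain N K l s \<omega> =
     {l - s * real N..l + s * real N} - (\<Union>k<K. bracket_spike N l s (snd (snd (\<omega> k))))"

lemma bracket_measurable [measurable]:
  "bracket_component N l s i j \<in> borel_measurable borel"
  "bracket_upper N K l s \<omega> \<in> borel_measurable borel"
  "bracket_spike N l s j' \<in> sets borel"
  "bracket_domain N K l s \<omega> \<in> sets borel"
proof -
  show c [measurable]: "bracket_component N l s i j \<in> borel_measurable borel" for i j
    unfolding bracket_component_def[abs_def] gauss_kernel_def by measurable
  show "bracket_upper N K l s \<omega> \<in> borel_measurable borel"
    unfolding bracket_upper_def[abs_def] by measurable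
  show sp [measurable]: "bracket_spike N l s j' \<in> sets borel" for j'
    unfolding bracket_spike_def by measurable
  show "bracket_domain N K l s \<omega> \<in> sets borel"
    unfolding bracket_domain_def by measurable
qed

lemma bracket_component_nonneg: "0 < s \<Longrightarrow> 0 \<le> bracket_component N l s i j x"
  unfolding bracket_component_def
  by (intro divide_nonneg_nonneg add_nonneg_nonneg gauss_kernel_nonneg) auto

lemma bracket_upper_nonneg: "0 < s \<Longrightarrow> 0 \<le> bracket_upper N K l s \<omega> x"
  unfolding bracket_upper_def
  by (intro sum_nonneg mult_nonneg_nonneg bracket_component_nonneg) auto

lemma finite_bracket_indices: "finite (bracket_indices N K)"
  unfolding bracket_indices_def by (intro finite_PiE) auto

lemma ln_card_bracket_indices:
  assumes "8 \<le> N"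
  shows "ln (real (card (bracket_indices N K))) \<le> 50 * real K * ln (real N)"
proof -
  let ?A = "{..N ^ 2} \<times> {..N ^ 15} \<times> {- (int N ^ 30)..int N ^ 30}"
  have card: "card (bracket_indices N K) = card ?A ^ K"
    unfolding bracket_indices_def by (simp only: card_PiE finite_lessThan prod_constant card_lessThan)
  have "card {- int a..int a} = 2 * a + 1" for a by simp
  from this[of "N ^ 30"] have "card ?A = (N ^ 2 + 1) * ((N ^ 15 + 1) * (2 * N ^ 30 + 1))"
    by (simp only: card_cartesian_product card_atMost of_nat_power Suc_eq_plus1)
  also have "\<dots> \<le> N ^ 3 * (N ^ 16 * N ^ 31)"
  proof (intro mult_le_mono)
    have step: "c * N ^ m + 1 \<le> N ^ m'" if "c \<le> 2" "m' = Suc m" for c m m'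
    proof -
      have "1 \<le> N ^ m" using assms by simp
      then have "c * N ^ m + 1 \<le> 3 * N ^ m" using mult_le_mono1[OF that(1), of "N ^ m"] by linarith
      also have "\<dots> \<le> N * N ^ m" using assms by (intro mult_le_mono) auto
      finally show ?thesis using that(2) by simp
    qed
    show "N ^ 2 + 1 \<le> N ^ 3" using step[where c=1 and m=2 and m'=3] by simp
    show "N ^ 15 + 1 \<le> N ^ 16" using step[where c=1 and m=15 and m'=16] by simp
    show "2 * N ^ 30 + 1 \<le> N ^ 31" using step[where c=2 and m=30 and m'=31] by simp
  qed
  also have "\<dots> = N ^ 50" by (simp flip: power_add)
  finally have le: "card ?A \<le> N ^ 50" .
  have pos: "0 < card ?A"
    unfolding \<open>card ?A = (N ^ 2 + 1) * ((N ^ 15 + 1) * (2 * N ^ 30 + 1))\<close> by simp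
  have "ln (real (card (bracket_indices N K))) = real K * ln (real (card ?A))"
    unfolding card using pos by (simp only: of_nat_power ln_realpow of_nat_0_less_iff)
  also have "\<dots> \<le> real K * ln (real (N ^ 50))"
  proof (rule mult_left_mono)
    have "ln (real a) \<le> ln (real b)" if "0 < a" "a \<le> b" for a b :: nat using that by simp
    from this[OF pos le] show "ln (real (card ?A)) \<le> ln (real (N ^ 50))" .
  qed simp
  also have "ln (real (N ^ 50)) = 50 * ln (real N)"
    using assms by (simp add: ln_realpow)
  finally show ?thesis by simp
qed

text \<open>
  The slack \<open>v\<close> collects the additive error of the component brackets, spread over the window, and the
  rounding of the weights, which adds at most \<open>1 / N\<^sup>2\<close> times each component.
\<close>

lemma mixture_bracket:
  assumes q: "gaussian_mixture K q" and N: "8 \<le> N" and K: "K \<le> N" and s: "0 < s"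
  obtains \<omega> v where "\<omega> \<in> bracket_indices N K" "integrable lborel v" "\<And>x. 0 \<le> v x"
    "integral\<^sup>L lborel v \<le> 2 / real N"
    "\<And>x. x \<in> bracket_domain N K l s \<omega> \<Longrightarrow>
       q x \<le> bracket_upper N K l s \<omega> x \<and> bracket_upper N K l s \<omega> x \<le> q x + v x"
proof -
  obtain w f where w: "\<forall>k<K. 0 \<le> w k" "(\<Sum>k<K. w k) = 1" "\<forall>k<K. f k \<in> gaussian_densities"
    and q: "q = (\<lambda>x. \<Sum>k<K. w k * f k x)"
    using q by (auto simp: gaussian_mixture_def)
  note f = gaussian_densitiesD[OF w(3)[rule_format]]
  define M where "M = real N"
  have M: "8 \<le> M" using N by (simp add: M_def)
  define Q where "Q k ij \<longleftrightarrow> fst ij \<le> N ^ 15 \<and> \<bar>snd ij\<bar> \<le> int N ^ 30 \<and>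
      (\<forall>x. \<bar>x - l\<bar> \<le> s * M \<longrightarrow> x \<notin> bracket_spike N l s (snd ij) \<longrightarrow>
        f k x \<le> bracket_component N l s (fst ij) (snd ij) x \<and>
        bracket_component N l s (fst ij) (snd ij) x \<le> f k x + 2 / M ^ 4 / s)" for k and ij :: "nat \<times> int"
  have "\<exists>ij. Q k ij" if k: "k < K" for k
  proof -
    obtain z \<sigma> where zs: "f k = normal_density z \<sigma>" "0 < \<sigma>"
      using w(3) k by (auto simp: gaussian_densities_def)
    obtain i j where ij: "i \<le> N ^ 15" "\<bar>j\<bar> \<le> int N ^ 30"
      "\<And>x. \<bar>x\<bar> \<le> real N \<Longrightarrow> 1 / (2 * real N ^ 2) < \<bar>x - of_int j / real N ^ 25\<bar> \<Longrightarrow>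
        gauss_kernel (s / \<sigma>) ((z - l) / s) x \<le> 1 / real N ^ 4 + gauss_kernel (real i / real N ^ 5) (of_int j / real N ^ 25) x \<and>
        1 / real N ^ 4 + gauss_kernel (real i / real N ^ 5) (of_int j / real N ^ 25) x
          \<le> gauss_kernel (s / \<sigma>) ((z - l) / s) x + 2 / real N ^ 4"
      using gauss_kernel_bracket[OF N, of "s / \<sigma>" "(z - l) / s"] divide_pos_pos[OF s zs(2)] by blast
    show ?thesis unfolding Q_def
    proof (intro exI[of _ "(i, j)"] conjI allI impI)
      fix x assume x: "\<bar>x - l\<bar> \<le> s * M" "x \<notin> bracket_spike N l s (snd (i, j))"
      have "\<bar>(x - l) / s\<bar> \<le> real N" using x(1) s by (simp add: abs_divide M_def pos_divide_le_eq mult.commute)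
      moreover have "1 / (2 * real N ^ 2) < \<bar>(x - l) / s - of_int j / real N ^ 25\<bar>"
        using x(2) by (simp add: bracket_spike_def)
      ultimately have b: "gauss_kernel (s / \<sigma>) ((z - l) / s) ((x - l) / s)
          \<le> 1 / real N ^ 4 + gauss_kernel (real i / real N ^ 5) (of_int j / real N ^ 25) ((x - l) / s)"
        "1 / real N ^ 4 + gauss_kernel (real i / real N ^ 5) (of_int j / real N ^ 25) ((x - l) / s)
          \<le> gauss_kernel (s / \<sigma>) ((z - l) / s) ((x - l) / s) + 2 / real N ^ 4"
        using ij(3) by blast+
      have fk: "f k x = gauss_kernel (s / \<sigma>) ((z - l) / s) ((x - l) / s) / s"
        unfolding zs(1) by (rule normal_density_eq_gauss_kernel[OF zs(2) s])
      show "f k x \<le> bracket_component N l s (fst (i, j)) (snd (i, j)) x"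
        unfolding fk bracket_component_def using b(1) s by (simp add: divide_right_mono)
      show "bracket_component N l s (fst (i, j)) (snd (i, j)) x \<le> f k x + 2 / M ^ 4 / s"
        unfolding fk bracket_component_def add_divide_distrib[symmetric]
        using b(2) s by (simp add: divide_right_mono M_def)
    qed (use ij in auto)
  qed
  then obtain ij where "\<And>k. k < K \<Longrightarrow> Q k (ij k)" by metis
  then have ij: "\<And>k. k < K \<Longrightarrow> fst (ij k) \<le> N ^ 15" "\<And>k. k < K \<Longrightarrow> \<bar>snd (ij k)\<bar> \<le> int N ^ 30"
    "\<And>k x. k < K \<Longrightarrow> \<bar>x - l\<bar> \<le> s * M \<Longrightarrow> x \<notin> bracket_spike N l s (snd (ij k)) \<Longrightarrow>
        f k x \<le> bracket_component N l s (fst (ij k)) (snd (ij k)) x \<and>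
        bracket_component N l s (fst (ij k)) (snd (ij k)) x \<le> f k x + 2 / M ^ 4 / s"
    unfolding Q_def by blast+
  define m where "m k = nat \<lceil>w k * M\<^sup>2\<rceil>" for k
  have wle: "w k \<le> 1" if "k < K" for k
    using member_le_sum[of k "{..<K}" w] w that by auto
  have m: "m k \<le> N ^ 2" "w k \<le> real (m k) / M\<^sup>2" "real (m k) / M\<^sup>2 \<le> w k + 1 / M\<^sup>2" if k: "k < K" for k
  proof -
    have wM: "0 \<le> w k * M\<^sup>2" "w k * M\<^sup>2 \<le> M\<^sup>2" using w(1) k wle[OF k] M by (auto intro: mult_left_le_one_le)
    have "\<lceil>w k * M\<^sup>2\<rceil> \<le> int (N ^ 2)" using wM unfolding ceiling_le_iff M_def by simp
    then show "m k \<le> N ^ 2" unfolding m_def by linarith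
    have rm: "real (m k) = of_int \<lceil>w k * M\<^sup>2\<rceil>" unfolding m_def using wM by simp
    have "w k * M\<^sup>2 \<le> real (m k)" "real (m k) \<le> w k * M\<^sup>2 + 1" unfolding rm by linarith+
    then show "w k \<le> real (m k) / M\<^sup>2" "real (m k) / M\<^sup>2 \<le> w k + 1 / M\<^sup>2"
      using M by (auto simp: field_simps)
  qed
  define \<omega> where "\<omega> = (\<lambda>k\<in>{..<K}. (m k, ij k))"
  define v where "v x = indicator {l - s * M..l + s * M} x * (4 / M ^ 4 / s) + (\<Sum>k<K. f k x / M\<^sup>2)" for x
  have upper: "bracket_upper N K l s \<omega> x = (\<Sum>k<K. real (m k) / M\<^sup>2 * bracket_component N l s (fst (ij k)) (snd (ij k)) x)" for x
    unfolding bracket_upper_def by (intro sum.cong) (auto simp: \<omega>_def M_def)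
  have i1: "integrable lborel (\<lambda>x. indicator {l - s * M..l + s * M} x * (4 / M ^ 4 / s))"
    by (rule integrable_mult_left, rule integrable_real_indicator) (simp_all add: emeasure_lborel_Icc_eq)
  have i2: "integrable lborel (\<lambda>x. \<Sum>k<K. f k x / M\<^sup>2)"
    using f by (intro Bochner_Integration.integrable_sum integrable_divide) auto
  have MM: "(\<Sum>k<K. 1 / M\<^sup>2) \<le> 1 / M"
  proof -
    have "real K / M\<^sup>2 \<le> M / M\<^sup>2" using K by (intro divide_right_mono) (auto simp: M_def)
    then show ?thesis using M by (simp add: power2_eq_square)
  qed
  show thesis
  proof (rule that[of \<omega> v])
    show "\<omega> \<in> bracket_indices N K"
      unfolding bracket_indices_def \<omega>_def restrict_PiE_iff
    proof
      fix k assume "k \<in> {..<K}"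
      with m(1)[of k] ij(1,2)[of k]
      show "(m k, ij k) \<in> {..N ^ 2} \<times> {..N ^ 15} \<times> {- (int N ^ 30)..int N ^ 30}"
        by (simp add: mem_Times_iff abs_le_iff)
    qed
    show "integrable lborel v" unfolding v_def[abs_def] using i1 i2 by (rule Bochner_Integration.integrable_add)
    show "0 \<le> v x" for x unfolding v_def using s M f(3) less_imp_le
      by (intro add_nonneg_nonneg sum_nonneg mult_nonneg_nonneg divide_nonneg_nonneg) (auto simp: less_imp_le)
    have "integral\<^sup>L lborel v = (\<integral>x. indicator {l - s * M..l + s * M} x * (4 / M ^ 4 / s) \<partial>lborel)
        + (\<integral>x. (\<Sum>k<K. f k x / M\<^sup>2) \<partial>lborel)"
      unfolding v_def[abs_def] by (rule Bochner_Integration.integral_add[OF i1 i2])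
    also have "(\<integral>x. indicator {l - s * M..l + s * M} x * (4 / M ^ 4 / s) \<partial>lborel) = 8 / M ^ 3"
      using s M by (simp add: field_simps power_numeral_reduce)
    also have "(\<integral>x. (\<Sum>k<K. f k x / M\<^sup>2) \<partial>lborel) = (\<Sum>k<K. 1 / M\<^sup>2)"
      using f by (subst Bochner_Integration.integral_sum) auto
    also have "8 / M ^ 3 \<le> 1 / M"
    proof -
      have "8 * M \<le> M\<^sup>2 * M" using M power_mono[of 8 M 2] by (intro mult_right_mono) auto
      then have "8 * M \<le> M ^ 3" by (simp add: power_numeral_reduce power2_eq_square)
      then show ?thesis using M by (simp add: field_simps)
    qed
    finally show "integral\<^sup>L lborel v \<le> 2 / real N" using MM by (simp add: M_def)
    fix x assume x: "x \<in> bracket_domain N K l s \<omega>"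
    then have xI: "x \<in> {l - s * M..l + s * M}" by (auto simp: bracket_domain_def M_def)
    have xI': "\<bar>x - l\<bar> \<le> s * M" using xI by (auto simp: abs_le_iff)
    have xS: "x \<notin> bracket_spike N l s (snd (ij k))" if "k < K" for k
      using x that by (auto simp: bracket_domain_def \<omega>_def)
    note b = ij(3)[OF _ xI' xS]
    show "q x \<le> bracket_upper N K l s \<omega> x \<and> bracket_upper N K l s \<omega> x \<le> q x + v x"
    proof
      show "q x \<le> bracket_upper N K l s \<omega> x"
        unfolding q upper using b m(2) w(1) f(3) less_imp_le
        by (intro sum_mono mult_mono) (auto intro: less_imp_le)
      have "bracket_upper N K l s \<omega> x \<le> (\<Sum>k<K. (w k + 1 / M\<^sup>2) * (f k x + 2 / M ^ 4 / s))"
        unfolding upper using b m(3) w(1) bracket_component_nonneg[OF s] M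
        by (intro sum_mono mult_mono) (auto intro!: add_nonneg_nonneg)
      also have "\<dots> = (\<Sum>k<K. w k * f k x + f k x / M\<^sup>2 + (w k + 1 / M\<^sup>2) * (2 / M ^ 4 / s))"
        by (intro sum.cong refl) (simp add: algebra_simps)
      also have "\<dots> = q x + (\<Sum>k<K. f k x / M\<^sup>2) + (\<Sum>k<K. w k + 1 / M\<^sup>2) * (2 / M ^ 4 / s)"
        unfolding q sum_distrib_right by (simp only: sum.distrib)
      also have "(\<Sum>k<K. w k + 1 / M\<^sup>2) * (2 / M ^ 4 / s) \<le> 2 * (2 / M ^ 4 / s)"
      proof (rule mult_right_mono)
        have "1 / M \<le> 1" using M by simp
        then show "(\<Sum>k<K. w k + 1 / M\<^sup>2) \<le> 2" using MM w(2) unfolding sum.distrib by linarith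
      qed (use s M in auto)
      also have "q x + (\<Sum>k<K. f k x / M\<^sup>2) + 2 * (2 / M ^ 4 / s) = q x + v x"
        unfolding v_def using xI by simp
      finally show "bracket_upper N K l s \<omega> x \<le> q x + v x" by simp
    qed
  qed
qed

lemma psi_sqrt_ratio:
  assumes "0 < a" "0 < b"
  shows "psi (sqrt_ratio a b) = (sqrt a - sqrt b) / (sqrt a + sqrt b)"
proof -
  have "sqrt a / sqrt b + 1 \<noteq> 0" "sqrt a + sqrt b \<noteq> 0" using assms
    by (metis add_pos_pos divide_pos_pos less_numeral_extra(3) real_sqrt_gt_zero zero_less_one)+
  with assms show ?thesis
    by (simp add: psi_def sqrt_ratio_def real_sqrt_divide divide_simps)
qed

lemma score_mono:
  fixes a b c :: real
  assumes "0 \<le> a" "a \<le> b" "0 < c"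
  shows "(a - c) / (a + c) \<le> (b - c) / (b + c)"
proof -
  have "(a - c) * (b + c) \<le> (b - c) * (a + c)"
    using mult_right_mono[of a b c] assms by (simp add: algebra_simps)
  then show ?thesis using assms by (simp add: divide_simps)
qed

text \<open>
  The score of any mixture is dominated by the score of its bracket, so the deviation inequality over the finite set
  of brackets is uniform over all mixtures. Outside the domain of a bracket the reference has mass at most
  \<open>e\<^sub>1\<close> from the window and \<open>e\<^sub>2\<close> from each of the \<open>K\<close> removed intervals.
\<close>

lemma model_uniform_deviation:
  assumes P: "P \<in> real_distributions" and q0: "gaussian_mixture K q\<^sub>0"
    and n: "8 \<le> n" and K: "K \<le> n" and s: "0 < s"
    and window: "mass (- {l - s * real n..l + s * real n}) q\<^sub>0 \<le> e\<^sub>1"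
    and spike: "\<And>j. mass (bracket_spike n l s j) q\<^sub>0 \<le> e\<^sub>2"
  obtains E where "E \<in> sets (PiM {..<n} (\<lambda>_. P))" "measure (PiM {..<n} (\<lambda>_. P)) E \<ge> 1 - exp (- \<xi>)"
    "\<And>X q. X \<in> E \<Longrightarrow> gaussian_mixture K q \<Longrightarrow> rho_T n X q\<^sub>0 q \<le>
       real n * (2 / real n + 5 * (e\<^sub>1 + real K * e\<^sub>2) + 20 * hellinger_sq P (density lborel q\<^sub>0)
         - hellinger_sq (density lborel q\<^sub>0) (density lborel q) / 16)
       + 32 * (\<xi> + 50 * real K * ln (real n))"
proof -
  note q0D = gaussian_mixtureD[OF q0]
  have q0m [measurable]: "q\<^sub>0 \<in> borel_measurable borel" using q0D(1) by auto
  define S where "S = bracket_domain n K l s"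
  define u where "u = bracket_upper n K l s"
  define g where "g \<omega> x = bracket_score (S \<omega>) (u \<omega>) q\<^sub>0 x / 32" for \<omega> x
  let ?J = "bracket_indices n K"
  obtain \<omega>0 :: "nat \<Rightarrow> nat \<times> nat \<times> int" where "\<omega>0 \<in> ?J"
    by (rule mixture_bracket[OF q0 n K s]) (rule that)
  then have Jne: "?J \<noteq> {}" by auto
  have gm: "g \<omega> \<in> borel_measurable borel" for \<omega>
    unfolding g_def[abs_def] S_def u_def by measurable
  have gb: "\<bar>g \<omega> x\<bar> \<le> 1" for \<omega> x
    using bracket_score_abs_le_1[of "u \<omega>" x q\<^sub>0 "S \<omega>"] bracket_upper_nonneg[OF s] q0D(3)
    by (simp add: g_def u_def)
  show thesis
  proof (rule iid_uniform_deviation[OF P gm gb finite_bracket_indices Jne, of n \<xi>])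
    fix E assume E: "E \<in> sets (PiM {..<n} (\<lambda>_. P))" "measure (PiM {..<n} (\<lambda>_. P)) E \<ge> 1 - exp (- \<xi>)"
      "\<And>X \<omega>. X \<in> E \<Longrightarrow> \<omega> \<in> ?J \<Longrightarrow>
         (\<Sum>i<n. g \<omega> (X i)) \<le> real n * ((\<integral>x. exp (g \<omega> x) \<partial>P) - 1) + \<xi> + ln (real (card ?J))"
    show thesis
    proof (rule that[OF E(1,2)])
      fix X q assume X: "X \<in> E" and q: "gaussian_mixture K q"
      note qD = gaussian_mixtureD[OF q]
      show "rho_T n X q\<^sub>0 q \<le> real n * (2 / real n + 5 * (e\<^sub>1 + real K * e\<^sub>2) + 20 * hellinger_sq P (density lborel q\<^sub>0)
           - hellinger_sq (density lborel q\<^sub>0) (density lborel q) / 16)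
         + 32 * (\<xi> + 50 * real K * ln (real n))" (is "_ \<le> ?rhs")
      proof (rule mixture_bracket[OF q n K s])
        fix \<omega> v assume "\<omega> \<in> ?J" "integrable lborel v" "\<And>x. 0 \<le> v x" "integral\<^sup>L lborel v \<le> 2 / real n"
          "\<And>x. x \<in> bracket_domain n K l s \<omega> \<Longrightarrow>
            q x \<le> bracket_upper n K l s \<omega> x \<and> bracket_upper n K l s \<omega> x \<le> q x + v x"
        then have \<omega>: "\<omega> \<in> ?J" "integrable lborel v" "\<And>x. 0 \<le> v x" "integral\<^sup>L lborel v \<le> 2 / real n"
          "\<And>x. x \<in> S \<omega> \<Longrightarrow> q x \<le> u \<omega> x \<and> u \<omega> x \<le> q x + v x"
          unfolding S_def u_def by auto
        have q_nn: "0 \<le> q x" for x using qD(3)[of x] by simp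
        have q0_nn: "0 \<le> q\<^sub>0 x" for x using q0D(3)[of x] by simp
        have Sm: "S \<omega> \<in> sets borel" and um: "u \<omega> \<in> borel_measurable borel"
          unfolding S_def u_def by measurable
        have "rho_T n X q\<^sub>0 q \<le> (\<Sum>i<n. 32 * g \<omega> (X i))"
          unfolding rho_T_def
        proof (rule sum_mono)
          fix i
          have "psi (sqrt_ratio (q (X i)) (q\<^sub>0 (X i))) \<le> bracket_score (S \<omega>) (u \<omega>) q\<^sub>0 (X i)"
          proof (cases "X i \<in> S \<omega>")
            case True
            have "sqrt (q (X i)) \<le> sqrt (u \<omega> (X i))" using \<omega>(5)[OF True] by (intro real_sqrt_le_mono) auto
            with q_nn have "(sqrt (q (X i)) - sqrt (q\<^sub>0 (X i))) / (sqrt (q (X i)) + sqrt (q\<^sub>0 (X i)))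
              \<le> (sqrt (u \<omega> (X i)) - sqrt (q\<^sub>0 (X i))) / (sqrt (u \<omega> (X i)) + sqrt (q\<^sub>0 (X i)))"
              using q0D(3)[of "X i"] by (intro score_mono) auto
            then show ?thesis unfolding psi_sqrt_ratio[OF qD(3) q0D(3)] bracket_score_def using True by simp
          next
            case False
            have "(a - b) / (a + b) \<le> 1" if "0 < a" "0 < b" for a b :: real
              using that by (simp add: divide_simps)
            from this[of "sqrt (q (X i))" "sqrt (q\<^sub>0 (X i))"] False show ?thesis
              unfolding psi_sqrt_ratio[OF qD(3) q0D(3)] bracket_score_def using qD(3) q0D(3) by simp
          qed
          then show "psi (sqrt_ratio (q (X i)) (q\<^sub>0 (X i))) \<le> 32 * g \<omega> (X i)" by (simp add: g_def)
        qed
        also have "\<dots> = 32 * (\<Sum>i<n. g \<omega> (X i))" by (simp add: sum_distrib_left)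
        also have "\<dots> \<le> 32 * (real n * ((\<integral>x. exp (g \<omega> x) \<partial>P) - 1) + \<xi> + ln (real (card ?J)))"
          using E(3)[OF X \<omega>(1)] by simp
        also have "\<dots> = real n * (32 * ((\<integral>x. exp (g \<omega> x) \<partial>P) - 1)) + 32 * (\<xi> + ln (real (card ?J)))"
          by (simp add: algebra_simps)
        also have "\<dots> \<le> ?rhs"
        proof (intro add_mono mult_left_mono)
          have combine: "y \<le> a' + 5 * b' + 20 * c - d" if "y \<le> a + 5 * b + 20 * c - d" "b \<le> b'" "a \<le> a'"
            for y a a' b b' c d :: real using that by linarith
          have "32 * ((\<integral>x. exp (g \<omega> x) \<partial>P) - 1)
            \<le> integral\<^sup>L lborel v + 5 * mass (- S \<omega>) q\<^sub>0
               + 20 * hellinger_sq P (density lborel q\<^sub>0)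
               - hellinger_sq (density lborel q\<^sub>0) (density lborel q) / 16"
            unfolding g_def
            by (rule bracket_exponential_moment[OF P Sm q0D(1,3,2) qD(1) q_nn qD(2) um _ \<omega>(2,3,5)])
              (use bracket_upper_nonneg[OF s] in \<open>auto simp: u_def\<close>)
          moreover have "mass (- S \<omega>) q\<^sub>0 \<le> e\<^sub>1 + real K * e\<^sub>2"
          proof -
            let ?I = "- {l - s * real n..l + s * real n}" and ?s = "\<lambda>k. bracket_spike n l s (snd (snd (\<omega> k)))"
            have iI: "integrable lborel (\<lambda>x. indicator ?I x * q\<^sub>0 x)"
              by (rule integrable_indicator_mult[OF q0D(1)]) auto
            have isp: "integrable lborel (\<lambda>x. indicator (?s k) x * q\<^sub>0 x)" for k
              by (rule integrable_indicator_mult[OF q0D(1)]) measurable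
            have "mass (- S \<omega>) q\<^sub>0
                \<le> (\<integral>x. indicator ?I x * q\<^sub>0 x + (\<Sum>k<K. indicator (?s k) x * q\<^sub>0 x) \<partial>lborel)"
            proof (rule integral_mono)
              show "integrable lborel (\<lambda>x. indicator (- S \<omega>) x * q\<^sub>0 x)"
                by (rule integrable_indicator_mult[OF q0D(1)]) (use Sm in auto)
              show "integrable lborel (\<lambda>x. indicator ?I x * q\<^sub>0 x + (\<Sum>k<K. indicator (?s k) x * q\<^sub>0 x))"
                by (intro Bochner_Integration.integrable_add Bochner_Integration.integrable_sum iI isp)
              fix x
              have nn: "0 \<le> (\<Sum>k<K. indicator (?s k) x * q\<^sub>0 x)" using q0_nn by (intro sum_nonneg) auto
              show "indicator (- S \<omega>) x * q\<^sub>0 x \<le> indicator ?I x * q\<^sub>0 x + (\<Sum>k<K. indicator (?s k) x * q\<^sub>0 x)"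
              proof (cases "x \<in> S \<omega> \<or> x \<in> ?I")
                case True
                then show ?thesis using nn q0_nn[of x] by (auto split: split_indicator)
              next
                case False
                then obtain k where k: "k < K" "x \<in> ?s k" by (auto simp: S_def bracket_domain_def)
                have "q\<^sub>0 x = indicator (?s k) x * q\<^sub>0 x" using k by simp
                also have "\<dots> \<le> (\<Sum>k<K. indicator (?s k) x * q\<^sub>0 x)"
                  using k q0_nn by (intro member_le_sum) auto
                finally show ?thesis using False q0_nn[of x] by (auto split: split_indicator)
              qed
            qed
            also have "\<dots> = mass ?I q\<^sub>0 + (\<integral>x. (\<Sum>k<K. indicator (?s k) x * q\<^sub>0 x) \<partial>lborel)"
              by (rule Bochner_Integration.integral_add[OF iI Bochner_Integration.integrable_sum[OF isp]])
            also have "(\<integral>x. (\<Sum>k<K. indicator (?s k) x * q\<^sub>0 x) \<partial>lborel) = (\<Sum>k<K. mass (?s k) q\<^sub>0)"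
              by (rule Bochner_Integration.integral_sum) (rule isp)
            also have "mass ?I q\<^sub>0 + (\<Sum>k<K. mass (?s k) q\<^sub>0)
              \<le> e\<^sub>1 + (\<Sum>k<K. e\<^sub>2)" by (intro add_mono sum_mono window spike)
            finally show ?thesis by simp
          qed
          ultimately show "32 * ((\<integral>x. exp (g \<omega> x) \<partial>P) - 1) \<le> 2 / real n + 5 * (e\<^sub>1 + real K * e\<^sub>2)
              + 20 * hellinger_sq P (density lborel q\<^sub>0) - hellinger_sq (density lborel q\<^sub>0) (density lborel q) / 16"
            using \<omega>(4) combine by blast
          show "ln (real (card ?J)) \<le> 50 * real K * ln (real n)" by (rule ln_card_bracket_indices[OF n])
        qed auto
        finally show "rho_T n X q\<^sub>0 q \<le> ?rhs" .
      qed
    qed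
  qed
qed

section \<open>Near minimisers of the test statistic\<close>

lemma rho_T_antisym:
  assumes "\<And>x. 0 < q x" "\<And>x. 0 < q' x"
  shows "rho_T n X q q' = - rho_T n X q' q"
proof -
  have "(a - b) / (a + b) = - ((b - a) / (b + a))" for a b :: real
    by (simp only: minus_divide_left minus_diff_eq add.commute)
  then show ?thesis
    unfolding rho_T_def psi_sqrt_ratio[OF assms(2) assms(1)] psi_sqrt_ratio[OF assms(1) assms(2)] sum_negf[symmetric]
    by (intro sum.cong refl)
qed

lemma rho_T_bound:
  assumes "\<And>x. 0 < q x" "\<And>x. 0 < q' x"
  shows "\<bar>rho_T n X q q'\<bar> \<le> real n"
proof -
  have "\<bar>(a - b) / (a + b)\<bar> \<le> 1" if "0 < a" "0 < b" for a b :: real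
    using that by (auto simp: abs_le_iff divide_simps)
  then have "\<bar>psi (sqrt_ratio (q' (X i)) (q (X i)))\<bar> \<le> 1" for i
    unfolding psi_sqrt_ratio[OF assms(2) assms(1)] using assms by (meson real_sqrt_gt_zero)
  then have "(\<Sum>i<n. \<bar>psi (sqrt_ratio (q' (X i)) (q (X i)))\<bar>) \<le> (\<Sum>i<n. 1)" by (intro sum_mono)
  then show ?thesis unfolding rho_T_def by (intro order.trans[OF sum_abs]) simp
qed

text \<open>
  A near minimiser \<open>q\<close> does not lose against \<open>q\<^sub>0\<close> by more than \<open>q\<^sub>0\<close> loses against its worst
  competitor. By antisymmetry of the test statistic, both quantities are controlled by upper bounds for
  the tests of \<open>q\<^sub>0\<close> alone; one of these bounds contains the negative term that measures the
  distance from \<open>q\<^sub>0\<close> to \<open>q\<close>. The tolerance \<open>8.24\<close>, rounded up to \<open>9\<close>, contributes \<open>144 = 16 * 9\<close>.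
\<close>

lemma near_minimizer_close_to_reference:
  assumes G: "\<And>q. q \<in> G \<Longrightarrow> gaussian_mixture K q" and q0: "q\<^sub>0 \<in> G" and n: "0 < n"
    and dev: "\<And>q. q \<in> G \<Longrightarrow> rho_T n X q\<^sub>0 q \<le>
      real n * (a - hellinger_sq (density lborel q\<^sub>0) (density lborel q) / 16) + b"
    and Q: "Q \<in> hellinger_closure (distributions_of {q \<in> G. rho_Upsilon n G X q < (INF q'\<in>G. rho_Upsilon n G X q') + 8.24})"
  shows "hellinger_sq (density lborel q\<^sub>0) Q \<le> 32 * a + (32 * b + 144) / real n"
proof -
  note GD = gaussian_mixtureD[OF G]
  have rd: "density lborel q \<in> real_distributions" if "q \<in> G" for q
    using GD[OF that] by (intro density_lborel_real_distribution) (auto intro: less_imp_le)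
  have pos: "0 < q x" if "q \<in> G" for q x by (rule gaussian_mixtureD(3)[OF G[OF that]])
  have bdd: "bdd_above (rho_T n X q ` G)" if "q \<in> G" for q
    by (rule bdd_aboveI2[where M="real n"]) (rule abs_le_D1[OF rho_T_bound], use pos that in auto)
  have ge: "rho_T n X q q' \<le> rho_Upsilon n G X q" if "q \<in> G" "q' \<in> G" for q q'
    unfolding rho_Upsilon_def using that by (intro cSUP_upper bdd) auto
  have "bdd_below (rho_Upsilon n G X ` G)"
  proof (rule bdd_belowI2)
    fix q assume "q \<in> G"
    then show "- real n \<le> rho_Upsilon n G X q"
      using ge[of q q] rho_T_bound[of q q n X] pos[of q] by (simp add: abs_le_iff)
  qed
  then have inf: "(INF q'\<in>G. rho_Upsilon n G X q') \<le> rho_Upsilon n G X q\<^sub>0"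
    using q0 by (rule cINF_lower)
  have up0: "rho_Upsilon n G X q\<^sub>0 \<le> real n * a + b"
    unfolding rho_Upsilon_def
  proof (rule cSUP_least)
    fix q assume "q \<in> G"
    have "real n * (a - hellinger_sq (density lborel q\<^sub>0) (density lborel q) / 16) \<le> real n * a"
      using hellinger_sq_nonneg by (intro mult_left_mono) auto
    with dev[OF \<open>q \<in> G\<close>] show "rho_T n X q\<^sub>0 q \<le> real n * a + b" by linarith
  qed (use q0 in auto)
  define c where "c = 32 * a + (32 * b + 144) / real n"
  have near: "hellinger_sq (density lborel q\<^sub>0) (density lborel q) \<le> c"
    if q: "q \<in> G" "rho_Upsilon n G X q < (INF q'\<in>G. rho_Upsilon n G X q') + 8.24" for q
  proof -
    define h where "h = hellinger_sq (density lborel q\<^sub>0) (density lborel q)"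
    have "- rho_T n X q\<^sub>0 q = rho_T n X q q\<^sub>0"
      using rho_T_antisym[of q q\<^sub>0 n X] GD(3)[OF q(1)] GD(3)[OF q0] by simp
    also have "\<dots> \<le> rho_Upsilon n G X q" using q q0 by (intro ge)
    also have "\<dots> \<le> real n * a + b + 9" using q(2) inf up0 by simp
    finally have "- (real n * (a - h / 16) + b) \<le> real n * a + b + 9"
      using dev[OF q(1)] unfolding h_def by linarith
    moreover have "real n * (a - h / 16) = real n * a - real n * h / 16" by (simp add: right_diff_distrib)
    ultimately have "real n * h \<le> 32 * (real n * a) + 32 * b + 144" by linarith
    then have "h * real n \<le> (32 * a) * real n + (32 * b + 144)" by (simp add: mult_ac)
    then show ?thesis unfolding c_def h_def[symmetric] using n by (simp add: field_simps)
  qed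
  have Qr: "Q \<in> real_distributions" using Q by (simp add: hellinger_closure_def)
  obtain q1 where "q1 \<in> G" "rho_Upsilon n G X q1 < (INF q'\<in>G. rho_Upsilon n G X q') + 8.24"
    using Q zero_less_one unfolding hellinger_closure_def distributions_of_def by blast
  then have c0: "0 \<le> c" using near[of q1] hellinger_sq_nonneg order.trans by blast
  have "hellinger (density lborel q\<^sub>0) Q \<le> sqrt c + e" if e: "0 < e" for e
  proof -
    obtain Q' where Q': "Q' \<in> distributions_of {q \<in> G. rho_Upsilon n G X q < (INF q'\<in>G. rho_Upsilon n G X q') + 8.24}"
      "hellinger Q Q' < e"
      using Q e unfolding hellinger_closure_def by auto
    then obtain q where q: "q \<in> G" "rho_Upsilon n G X q < (INF q'\<in>G. rho_Upsilon n G X q') + 8.24"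
      and Q'q: "Q' = density lborel (\<lambda>x. ennreal (q x))"
      unfolding distributions_of_def by auto
    have "hellinger (density lborel q\<^sub>0) Q \<le> hellinger (density lborel q\<^sub>0) Q' + hellinger Q' Q"
      using rd[OF q0] rd[OF q(1)] Qr unfolding Q'q by (rule hellinger_triangle)
    also have "hellinger Q' Q = hellinger Q Q'"
      unfolding hellinger_def using rd[OF q(1)] Qr unfolding Q'q by (subst hellinger_sq_commute) auto
    also have "hellinger (density lborel q\<^sub>0) Q' \<le> sqrt c"
      unfolding hellinger_def Q'q using near[OF q] by (rule real_sqrt_le_mono)
    finally show ?thesis using Q'(2) by linarith
  qed
  then have "hellinger (density lborel q\<^sub>0) Q \<le> sqrt c" by (rule field_le_epsilon)
  then have "(hellinger (density lborel q\<^sub>0) Q)\<^sup>2 \<le> (sqrt c)\<^sup>2" by (intro power_mono hellinger_nonneg)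
  then show ?thesis using c0 by (simp add: hellinger_sq_eq c_def)
qed

section \<open>The reference density\<close>

lemma mixture_densities_nonempty:
  assumes "0 \<le> A" "1 \<le> R"
  shows "mixture_densities A R \<noteq> {}"
proof -
  let ?M = "restrict_space borel half_plane :: (real \<times> real) measure"
  let ?x = "(0, 1) :: real \<times> real" and ?H = "return ?M (0, 1)"
  have x: "?x \<in> space ?M" by (simp add: space_restrict_space half_plane_def)
  have "prob_space ?H" using x by (rule prob_space_return)
  then have H: "?H \<in> mixing_distributions" by (simp add: mixing_distributions_def)
  have "supp ?H \<subseteq> {?x}"
  proof
    fix y assume y: "y \<in> supp ?H"
    show "y \<in> {?x}"
    proof (rule ccontr)
      assume "y \<notin> {?x}"
      moreover have "open (- {?x})" by auto
      ultimately have "0 < emeasure ?H (- {?x} \<inter> space ?H)" using y unfolding supp_def by blast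
      moreover have eq: "- {?x} \<inter> space ?H = half_plane \<inter> - {?x}"
        by (simp add: space_restrict_space Int_commute)
      have "half_plane \<inter> - {?x} \<in> sets ?M" unfolding sets_restrict_space by (intro imageI) auto
      then have "emeasure ?H (- {?x} \<inter> space ?H) = 0" unfolding eq by (subst emeasure_return) simp_all
      ultimately show False by simp
    qed
  qed
  also have "{?x} \<subseteq> {0 - 1 * A..0 + 1 * A} \<times> {1..1 * R}" using assms by auto
  finally have "mixture_density ?H \<in> mixture_densities A R"
    unfolding mixture_densities_def mem_Collect_eq
    by (intro exI[of _ ?H] exI[of _ 0] exI[of _ 1] conjI refl H zero_less_one)
  then show ?thesis by auto
qed

text \<open>
  The half-width \<open>s * B\<close> of the window is chosen such that the Gaussian tails outside it have mass of order \<open>1 / n\<close>. There the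
  exponents are at most \<open>(B + A)\<^sup>2 / 2 \<le> 6 * R\<^sup>2 * ln n\<close>, so \<open>J = 126 * R\<^sup>2 * ln n\<close> Taylor terms suffice, as
  \<open>exp 3 \<le> 21\<close>. The \<open>2 * J + 1\<close> atoms are then fewer than \<open>2 * R ^ 4 * (ln n)\<^sup>2 / 27\<close>, once \<open>ln n\<close> is at least
  \<open>4000\<close>.
\<close>

lemma reference_density_exists:
  fixes n :: nat and A R l s \<delta> :: real
  assumes H: "H \<in> mixing_distributions" and D: "supp H \<subseteq> {l - s * A..l + s * A} \<times> {s..s * R}"
    and s: "0 < s" and A: "0 < A" and R: "1 \<le> R" and F: "countable_dense_gaussians F"
    and L: "4000 \<le> ln (real n)" and nA: "A\<^sup>2 \<le> R\<^sup>2 * ln (real n) / 2"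
    and K: "2 * R ^ 4 * (ln (real n))\<^sup>2 / 27 \<le> real K"
    and win: "3 * R * sqrt (ln (real n)) \<le> real n" and \<delta>: "0 \<le> \<delta>" "real K * \<delta> < 1"
  obtains q\<^sub>0 where "q\<^sub>0 \<in> finite_mixture_densities F K \<delta>"
    "hellinger_sq (density lborel (mixture_density H)) (density lborel q\<^sub>0) \<le> 6 / real n + real K * \<delta>"
    "mass (- {l - s * real n..l + s * real n}) q\<^sub>0 \<le> 3 / real n"
    "\<And>j. mass (bracket_spike n l s j) q\<^sub>0 \<le> 2 / real n ^ 2"
proof -
  define t where "t = ln (real n)"
  have t: "4000 \<le> t" using L by (simp add: t_def)
  have n1: "1 < real n"
  proof (rule ccontr)
    assume "\<not> 1 < real n"
    then have "n = 0 \<or> n = 1" by linarith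
    then show False using t by (auto simp: t_def)
  qed
  have n: "0 < n" "8 \<le> n"
  proof -
    show "0 < n" using n1 by simp
    have "t \<le> real n" unfolding t_def using n1 by (intro less_imp_le ln_less_self) simp
    then show "8 \<le> n" using t by linarith
  qed
  have en: "exp (- t) = 1 / real n" using n by (simp add: t_def exp_minus exp_ln inverse_eq_divide)
  have R0: "0 \<le> R" and t0: "0 \<le> t" using R t by auto
  define B where "B = A + 2 * R * sqrt t"
  define J where "J = nat \<lceil>126 * R\<^sup>2 * t\<rceil>"
  have R2: "1 \<le> R\<^sup>2" using R by (simp add: one_le_power)
  have R2t: "4000 \<le> R\<^sup>2 * t" using mult_mono[of 1 "R\<^sup>2" 4000 t] R2 t by simp
  have J: "126 * R\<^sup>2 * t \<le> real J" "real J \<le> 127 * R\<^sup>2 * t" "0 < J"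
    using R2t unfolding J_def by linarith+
  have e3: "exp 3 \<le> (21::real)"
  proof -
    have "exp 3 = (exp 1 :: real) ^ 3" by (simp add: exp_of_nat_mult[symmetric])
    also have "\<dots> \<le> (272 / 100) ^ 3" using e_less_272 by (intro power_mono) auto
    finally show ?thesis by (simp add: power3_eq_cube)
  qed
  have BA: "exp 3 * ((B + A)\<^sup>2 / 2) \<le> real J"
  proof -
    have "(B + A)\<^sup>2 = (2 * A + 2 * (R * sqrt t))\<^sup>2" by (simp add: B_def mult.assoc)
    also have "\<dots> \<le> 8 * A\<^sup>2 + 8 * (R * sqrt t)\<^sup>2"
    proof -
      have "(2 * a + 2 * b)\<^sup>2 \<le> 8 * a\<^sup>2 + 8 * b\<^sup>2" for a b :: real
        using zero_le_power2[of "2 * a - 2 * b"] by (simp add: power2_eq_square algebra_simps)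
      then show ?thesis .
    qed
    also have "\<dots> \<le> 12 * (R\<^sup>2 * t)" using nA t by (simp add: power_mult_distrib t_def mult.commute)
    finally have "(B + A)\<^sup>2 / 2 \<le> 6 * (R\<^sup>2 * t)" by simp
    then have "exp 3 * ((B + A)\<^sup>2 / 2) \<le> 21 * (6 * (R\<^sup>2 * t))" using e3 by (intro mult_mono) auto
    then show ?thesis using J(1) by simp
  qed
  have JK: "2 * J + 1 \<le> K"
  proof -
    have "4000 * (R\<^sup>2 * t) \<le> (R\<^sup>2 * t) * (R\<^sup>2 * t)" using R2t by (intro mult_right_mono) auto
    also have "\<dots> = R ^ 4 * t\<^sup>2" by (simp add: power2_eq_square power4_eq_xxxx)
    finally have sq: "4000 * (R\<^sup>2 * t) \<le> R ^ 4 * t\<^sup>2" .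
    have "2 * (R ^ 4 * t\<^sup>2) / 27 \<le> real K" using K by (simp only: t_def mult.assoc)
    moreover have "real J \<le> 127 * (R\<^sup>2 * t)" using J(2) by (simp only: mult.assoc)
    ultimately have "2 * real J + 1 \<le> real K" using sq R2t by linarith
    then show ?thesis by linarith
  qed
  have Bn: "B \<le> real n"
  proof -
    have "A\<^sup>2 \<le> (R * sqrt t)\<^sup>2" using nA R2t t by (simp add: power_mult_distrib t_def)
    then have "A \<le> R * sqrt t" by (rule power2_le_imp_le) (use R t in simp)
    then show ?thesis using win by (simp add: B_def t_def)
  qed
  obtain w z \<sigma> where w: "\<And>k. k < K \<Longrightarrow> 0 \<le> w k" "(\<Sum>k<K. w k) = 1"
    and z\<sigma>: "\<And>k. z k \<in> {l - s * A..l + s * A}" "\<And>k. \<sigma> k \<in> {s..s * R}"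
    and L1: "(\<integral>x. \<bar>mixture_density H x - (\<Sum>k<K. w k * normal_density (z k) (\<sigma> k) x)\<bar> \<partial>lborel)
       \<le> 6 * B * exp (- real J) + 4 * exp (- t)"
    by (rule finite_mixture_approximation[OF H D s less_imp_le[OF A] R0 t0 B_def BA J(3) JK]) (rule that; (assumption | simp))
  have \<sigma>: "0 < \<sigma> k" "s \<le> \<sigma> k" for k using z\<sigma>(2)[of k] s by auto
  define e where "e = 1 / real n ^ 2"
  have e: "0 < e" "e \<le> 1 / real n"
  proof -
    show "0 < e" using n by (simp add: e_def)
    show "e \<le> 1 / real n" using n1 by (simp add: e_def power2_eq_square field_simps)
  qed
  obtain w' f where w': "\<And>k. k < K \<Longrightarrow> 0 \<le> w' k" "(\<Sum>k<K. w' k) = 1"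
    and f: "\<And>k. f k \<in> gaussian_densities" "\<And>k. (\<integral>x. \<bar>f k x - normal_density (z k) (\<sigma> k) x\<bar> \<partial>lborel) \<le> e"
    and mem: "(\<lambda>x. \<Sum>k<K. w' k * f k x) \<in> finite_mixture_densities F K \<delta>"
    and L1': "(\<integral>x. \<bar>(\<Sum>k<K. w' k * f k x) - (\<Sum>k<K. w k * normal_density (z k) (\<sigma> k) x)\<bar> \<partial>lborel)
       \<le> 2 * real K * \<delta> + 2 * e"
    by (rule approximation_in_model[where z = z and \<sigma> = \<sigma>, OF F \<sigma>(1) w \<delta> e(1)], assumption) (rule that; (assumption | simp))
  define q0 where "q0 = (\<lambda>x. \<Sum>k<K. w' k * f k x)"
  have "gaussian_mixture K q0"
    unfolding q0_def by (rule finite_mixture_densities_gaussian_mixture[OF mem])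
  note q0D = gaussian_mixtureD[OF this]
  note fD = gaussian_densitiesD[OF f(1)]
  have mass: "mass C q0 \<le> c + e"
    if C: "C \<in> sets borel" "\<And>k. mass C (normal_density (z k) (\<sigma> k)) \<le> c" for C c
    unfolding q0_def
  proof (rule normal_mixture_mass[OF w' fD(1) C(1)])
    fix k
    have i1: "integrable lborel (\<lambda>x. indicator C x * normal_density (z k) (\<sigma> k) x)"
      using \<sigma>(1) C(1) by (intro integrable_indicator_mult) auto
    have i2: "integrable lborel (\<lambda>x. \<bar>f k x - normal_density (z k) (\<sigma> k) x\<bar>)"
      using \<sigma>(1) fD(1) by auto
    have "mass C (f k)
        \<le> (\<integral>x. indicator C x * normal_density (z k) (\<sigma> k) x + \<bar>f k x - normal_density (z k) (\<sigma> k) x\<bar> \<partial>lborel)"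
      using i1 i2 fD(1) C(1) \<sigma>(1)[of k]
      by (intro integral_mono integrable_indicator_mult Bochner_Integration.integrable_add) (auto split: split_indicator)
    also have "\<dots> = mass C (normal_density (z k) (\<sigma> k))
        + (\<integral>x. \<bar>f k x - normal_density (z k) (\<sigma> k) x\<bar> \<partial>lborel)"
      by (rule Bochner_Integration.integral_add[OF i1 i2])
    also have "\<dots> \<le> c + e" using C(2) f(2) by (rule add_mono)
    finally show "mass C (f k) \<le> c + e" .
  qed
  show thesis
  proof (rule that[of q0])
    show "q0 \<in> finite_mixture_densities F K \<delta>" using mem by (simp add: q0_def)
    note mp = mixture_density_prob[OF H D s] and mb = mixture_density_bounded_support[OF H D s]
    let ?p = "mixture_density H" and ?g = "\<lambda>x. \<Sum>k<K. w k * normal_density (z k) (\<sigma> k) x"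
    have ig: "integrable lborel ?g" using \<sigma> by (intro Bochner_Integration.integrable_sum integrable_mult_right) auto
    have "hellinger_sq (density lborel ?p) (density lborel q0) \<le> 1 / 2 * (\<integral>x. \<bar>?p x - q0 x\<bar> \<partial>lborel)"
      using q0D mp mb(2) by (intro hellinger_sq_le_L1) (auto intro: less_imp_le)
    also have "(\<integral>x. \<bar>?p x - q0 x\<bar> \<partial>lborel) \<le> (\<integral>x. \<bar>?p x - ?g x\<bar> + \<bar>q0 x - ?g x\<bar> \<partial>lborel)"
      using mp(1) ig q0D(1) by (intro integral_mono) (auto simp del: sum_mult_indicator)
    also have "\<dots> = (\<integral>x. \<bar>?p x - ?g x\<bar> \<partial>lborel) + (\<integral>x. \<bar>q0 x - ?g x\<bar> \<partial>lborel)"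
      using mp(1) ig q0D(1) by (intro Bochner_Integration.integral_add) auto
    also have "\<dots> \<le> (6 * B * exp (- real J) + 4 * exp (- t)) + (2 * real K * \<delta> + 2 * e)"
      using L1 L1' unfolding q0_def by (rule add_mono)
    also have "6 * B * exp (- real J) \<le> 6 / real n"
    proof -
      have "2 * t \<le> 126 * R\<^sup>2 * t" using R2 t by (intro mult_right_mono) auto
      then have "2 * t \<le> real J" using J(1) by (rule order.trans)
      then have "exp (- real J) \<le> exp (- t) * exp (- t)" by (simp flip: exp_add)
      then have "B * exp (- real J) \<le> real n * (exp (- t) * exp (- t))"
        using Bn n by (intro mult_mono) auto
      also have "\<dots> = 1 / real n" using n unfolding en by simp
      finally show ?thesis by simp
    qed
    finally show "hellinger_sq (density lborel ?p) (density lborel q0) \<le> 6 / real n + real K * \<delta>"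
      using e(2) unfolding en by simp
    have "mass (- {l - s * real n..l + s * real n}) q0 \<le> 2 * exp (- t) + e"
    proof (rule mass)
      fix k
      have sB: "s * B \<le> s * real n" using Bn s by simp
      have "mass (- {l - s * real n..l + s * real n}) (normal_density (z k) (\<sigma> k))
          \<le> mass (- {l - s * B..l + s * B}) (normal_density (z k) (\<sigma> k))"
        using \<sigma> sB by (intro integral_mono integrable_indicator_mult) (auto split: split_indicator)
      also have "\<dots> \<le> 2 * exp (- t)"
        unfolding B_def using s t z\<sigma> R by (intro normal_outside_window) auto
      finally show "mass (- {l - s * real n..l + s * real n}) (normal_density (z k) (\<sigma> k))
          \<le> 2 * exp (- t)" .
    qed auto
    then show "mass (- {l - s * real n..l + s * real n}) q0 \<le> 3 / real n"
      using e(2) unfolding en by simp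
    fix j
    define c h where "c = l + s * (of_int j / real n ^ 25)" and "h = s * (1 / (2 * real n ^ 2))"
    have sub: "bracket_spike n l s j \<subseteq> {c - h..c + h}"
    proof
      fix x assume "x \<in> bracket_spike n l s j"
      then have "\<bar>(x - l) / s - of_int j / real n ^ 25\<bar> \<le> 1 / (2 * real n ^ 2)" by (simp add: bracket_spike_def)
      then have "s * \<bar>(x - l) / s - of_int j / real n ^ 25\<bar> \<le> h" unfolding h_def using s by (intro mult_left_mono) auto
      moreover have "s * \<bar>(x - l) / s - of_int j / real n ^ 25\<bar> = \<bar>s * ((x - l) / s - of_int j / real n ^ 25)\<bar>"
        using s by (simp add: abs_mult)
      moreover have "s * ((x - l) / s - of_int j / real n ^ 25) = x - c"
        using s by (simp add: c_def field_simps)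
      ultimately show "x \<in> {c - h..c + h}" by (auto simp: abs_le_iff)
    qed
    have h0: "0 \<le> h" using s by (simp add: h_def)
    have "mass (bracket_spike n l s j) q0 \<le> 1 / real n ^ 2 + e"
    proof (rule mass)
      fix k
      have "mass (bracket_spike n l s j) (normal_density (z k) (\<sigma> k)) \<le> ((c + h) - (c - h)) / \<sigma> k"
        using h0 by (intro normal_interval_mass \<sigma> sub bracket_measurable) auto
      also have "\<dots> \<le> 2 * h / s" using \<sigma>[of k] s h0 by (simp add: frac_le)
      also have "\<dots> = 1 / real n ^ 2" using s by (simp add: h_def)
      finally show "mass (bracket_spike n l s j) (normal_density (z k) (\<sigma> k)) \<le> 1 / real n ^ 2" .
    qed (rule bracket_measurable)
    then show "mass (bracket_spike n l s j) q0 \<le> 2 / real n ^ 2"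
      by (simp add: e_def)
  qed
qed

section \<open>Risk bound\<close>

text \<open>
  Since the squared Hellinger distance is at most one, the risk bound is trivial unless its remainder term
  \<open>R ^ 4 * ln n ^ 3 / n\<close> is small. A small remainder makes \<open>ln n\<close> large and keeps \<open>K\<close> times the threshold, which is at
  most \<open>2 * V * K / n\<close>, below one.
\<close>

lemma nontrivial_regime:
  fixes n :: nat and R :: real
  defines "L \<equiv> ln (real n)" and "K \<equiv> mixture_order R n"
  defines "E \<equiv> R ^ 4 * L ^ 3 / real n" and "V \<equiv> real (vc_index gaussian_densities)"
  assumes n: "2 \<le> n" and R: "1 \<le> R" and E: "E < exp (- 4000) / 8" "E < 1 / (2 * V + 1)"
  shows "4000 \<le> L" "1 / real n \<le> E" "2 * R ^ 4 * L\<^sup>2 / 27 \<le> real K" "real K * L \<le> E * real n"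
    "K \<le> n" "0 \<le> weight_threshold n K" "real K * weight_threshold n K \<le> 2 * V * E"
    "real K * weight_threshold n K < 1" "3 * R * sqrt L \<le> real n"
proof -
  have V: "0 \<le> V" by (simp add: V_def)
  have n0: "0 < real n" using n by simp
  have R4: "1 \<le> R ^ 4" using R by (rule one_le_power)
  have L2: "1 / 2 \<le> L"
  proof -
    have "ln (1 / 2 :: real) \<le> 1 / 2 - 1" by (rule ln_le_minus_one) simp
    then have "1 / 2 \<le> ln (2 :: real)" by (simp add: ln_div)
    also have "\<dots> \<le> L" unfolding L_def using n by simp
    finally show ?thesis .
  qed
  show L: "4000 \<le> L"
  proof (rule ccontr)
    assume "\<not> ?thesis"
    then have "exp L \<le> exp 4000" by simp
    then have "real n \<le> exp 4000" unfolding L_def using n0 by simp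
    have "1 / 8 \<le> L ^ 3" using power_mono[OF L2, of 3] by (simp add: power3_eq_cube)
    then have "1 / 8 \<le> R ^ 4 * L ^ 3" using mult_mono[OF R4, of "1 / 8" "L ^ 3"] R4 by simp
    then have "(1 / 8) / exp 4000 \<le> E"
      unfolding E_def using \<open>real n \<le> exp 4000\<close> n0 by (intro frac_le) auto
    then show False using E(1) by (simp add: exp_minus field_simps)
  qed
  define x where "x = R ^ 4 * L\<^sup>2"
  have En: "R ^ 4 * L ^ 3 = E * real n" using n0 by (simp add: E_def)
  have xL: "x * L = E * real n" unfolding En[symmetric] x_def by (simp add: power2_eq_square power3_eq_cube)
  have L22: "16000000 \<le> L\<^sup>2" using power_mono[OF L, of 2] by simp
  have x: "16000000 \<le> x" unfolding x_def using mult_mono[OF R4 L22] by simp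
  have "16000000 * L \<le> x * L" using x L by (intro mult_right_mono) auto
  then have xx: "x \<le> E * real n" "1 \<le> E * real n"
  proof -
    have "x * 1 \<le> x * L" using x L by (intro mult_left_mono) auto
    then show "x \<le> E * real n" using xL by simp
    then show "1 \<le> E * real n" using x by simp
  qed
  show "1 / real n \<le> E" using xx(2) n0 by (simp add: field_simps)
  have K: "K = nat \<lceil>2 * x / 27\<rceil>" by (simp add: K_def mixture_order_def x_def L_def mult.assoc)
  show KR: "2 * R ^ 4 * L\<^sup>2 / 27 \<le> real K"
    unfolding mult.assoc x_def[symmetric] K by linarith
  have Kx: "real K \<le> x" "2 \<le> K" using x unfolding K by linarith+
  have "real K * L \<le> x * L" using Kx L by (intro mult_right_mono) auto
  then show "real K * L \<le> E * real n" using xL by simp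
  have "exp (- 4000) \<le> (1 :: real)" by simp
  then have E1: "E \<le> 1" using E(1) by linarith
  have En1: "E * real n \<le> real n" using E1 n0 by simp
  then have "real K \<le> real n" using Kx xx by linarith
  then show "K \<le> n" by simp
  let ?w = "weight_threshold n K"
  have wle: "?w \<le> real K * V / (real n * (real K - 1))" and w0: "0 \<le> ?w"
    using Kx V n0 by (auto simp: weight_threshold_def V_def)
  show "0 \<le> ?w" by (rule w0)
  have "real K * V / (real n * (real K - 1)) = real K / (real K - 1) * (V / real n)" using Kx by simp
  also have "\<dots> \<le> 2 * (V / real n)"
    using Kx V n0 by (intro mult_right_mono) (auto simp: divide_simps)
  finally have "?w \<le> 2 * V / real n" using wle by simp
  then have "real K * ?w \<le> (E * real n) * (2 * V / real n)"
    using Kx xx w0 by (intro mult_mono) auto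
  also have "\<dots> = 2 * V * E" using n0 by simp
  finally show Kw: "real K * ?w \<le> 2 * V * E" .
  have "(2 * V) * E \<le> (2 * V) * (1 / (2 * V + 1))" using E(2) V by (intro mult_left_mono) auto
  also have "\<dots> < 1" using V by (simp add: divide_simps)
  finally show "real K * ?w < 1" using Kw by linarith
  have "sqrt L \<le> L" using L real_le_lsqrt[of L L] self_le_power[of L 2] by simp
  then have "R * sqrt L \<le> R ^ 4 * L" using R self_le_power[of R 4] L by (intro mult_mono) auto
  then have "3 * R * sqrt L \<le> R ^ 4 * (3 * L)" by simp
  also have "\<dots> \<le> R ^ 4 * (L * L)" using L R4 by (intro mult_left_mono mult_right_mono) auto
  also have "\<dots> = x" by (simp add: x_def power2_eq_square)
  finally show "3 * R * sqrt L \<le> real n" using xx En1 by linarith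
qed

text \<open>
  The infimum over the class is attained up to \<open>E\<close>, at a mixture that depends neither on the sample
  nor on the estimator; the reference density approximating this mixture is therefore deterministic, as the deviation
  inequality demands.
\<close>

lemma rho_estimator_risk:
  fixes A R \<xi> :: real and n :: nat
  defines "L \<equiv> ln (real n)" and "V \<equiv> real (vc_index gaussian_densities)"
  defines "E \<equiv> R ^ 4 * L ^ 3 / real n" and "K \<equiv> mixture_order R n"
  assumes A: "0 < A" and R: "1 \<le> R" and nA: "exp (2 * (A / R)\<^sup>2) \<le> real n" and n2: "2 \<le> n"
    and F: "countable_dense_gaussians F" and P: "P \<in> real_distributions"
    and est: "is_rho_estimator n (finite_mixture_densities F K (weight_threshold n K)) Phat"
    and E: "E < exp (- 4000) / 8" "E < 1 / (2 * V + 1)"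
  obtains \<Omega> where "\<Omega> \<in> sets (PiM {..<n} (\<lambda>_. P))" "1 - exp (- \<xi>) \<le> measure (PiM {..<n} (\<lambda>_. P)) \<Omega>"
    "\<And>X. X \<in> \<Omega> \<Longrightarrow> hellinger_sq P (Phat X) \<le> 2564 * hellinger_sq_set P (distributions_of (mixture_densities A R))
       + (122364 + 5128 * V) * E + 2048 * \<xi> / real n"
proof -
  define \<delta> where "\<delta> = weight_threshold n K"
  define G where "G = finite_mixture_densities F K \<delta>"
  note reg = nontrivial_regime[OF n2 R, folded L_def V_def K_def, folded E_def \<delta>_def, OF E]
  have V: "0 \<le> V" by (simp add: V_def)
  have n0: "0 < real n" using n2 by simp
  have E0: "0 < E" using order.strict_trans2[OF _ reg(2), of 0] n0 by simp
  have n8: "8 \<le> n"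
  proof -
    have "L < real n" unfolding L_def using n0 by (rule ln_less_self)
    then show ?thesis using reg(1) by linarith
  qed
  have A2: "A\<^sup>2 \<le> R\<^sup>2 * ln (real n) / 2"
  proof -
    have "2 * (A / R)\<^sup>2 \<le> ln (real n)" using nA n0 by (simp add: ln_ge_iff)
    then show ?thesis using R by (simp add: power_divide field_simps)
  qed
  let ?D = "distributions_of (mixture_densities A R)"
  define h where "h = hellinger_sq_set P ?D"
  have "?D \<noteq> {}" using mixture_densities_nonempty[of A R] A R by (auto simp: distributions_of_def)
  then obtain Q where Q: "Q \<in> ?D" "hellinger_sq P Q < h + E"
    using E0 cInf_lessD[of "hellinger_sq P ` ?D" "h + E"] unfolding h_def hellinger_sq_set_def by auto
  then obtain H l s where H: "H \<in> mixing_distributions" "0 < s"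
    "supp H \<subseteq> {l - s * A..l + s * A} \<times> {s..s * R}" and QH: "Q = density lborel (\<lambda>x. ennreal (mixture_density H x))"
    unfolding distributions_of_def mixture_densities_def by auto
  have Qr: "Q \<in> real_distributions" unfolding QH
    using mixture_density_prob[OF H(1,3,2)] mixture_density_bounded_support(2)[OF H(1,3,2)]
    by (intro density_lborel_real_distribution)
  show thesis
  proof (rule reference_density_exists[OF H(1,3,2) A R F reg(1)[unfolded L_def] A2 reg(3)[unfolded L_def]
        reg(9)[unfolded L_def] reg(6,8)])
    fix q\<^sub>0 assume q0: "q\<^sub>0 \<in> finite_mixture_densities F K \<delta>"
      and h2: "hellinger_sq (density lborel (\<lambda>x. ennreal (mixture_density H x))) (density lborel (\<lambda>x. ennreal (q\<^sub>0 x)))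
        \<le> 6 / real n + real K * \<delta>"
      and win: "mass (- {l - s * real n..l + s * real n}) q\<^sub>0 \<le> 3 / real n"
      and spike: "\<And>j. mass (bracket_spike n l s j) q\<^sub>0 \<le> 2 / real n ^ 2"
    note gm = finite_mixture_densities_gaussian_mixture[OF q0]
    note q0D = gaussian_mixtureD[OF gm]
    let ?Q0 = "density lborel (\<lambda>x. ennreal (q\<^sub>0 x))"
    have Q0r: "?Q0 \<in> real_distributions"
      using q0D by (intro density_lborel_real_distribution) (auto intro: less_imp_le)
    define h0 where "h0 = hellinger_sq P ?Q0"
    have h0: "h0 \<le> 2 * h + (14 + 4 * V) * E"
    proof -
      have "h0 \<le> 2 * hellinger_sq P Q + 2 * hellinger_sq Q ?Q0"
        unfolding h0_def by (rule hellinger_sq_triangle[OF P Qr Q0r])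
      moreover have "hellinger_sq Q ?Q0 \<le> 6 * E + 2 * V * E"
        using h2 reg(2,7) unfolding QH by simp
      ultimately show ?thesis using Q(2) by (simp add: algebra_simps)
    qed
    show thesis
    proof (rule model_uniform_deviation[OF P gm n8 reg(5) H(2) win spike, of \<xi>])
      fix \<Omega> assume \<Omega>: "\<Omega> \<in> sets (PiM {..<n} (\<lambda>_. P))" "measure (PiM {..<n} (\<lambda>_. P)) \<Omega> \<ge> 1 - exp (- \<xi>)"
        and dev: "\<And>X q. X \<in> \<Omega> \<Longrightarrow> gaussian_mixture K q \<Longrightarrow> rho_T n X q\<^sub>0 q \<le>
         real n * (2 / real n + 5 * (3 / real n + real K * (2 / real n ^ 2)) + 20 * hellinger_sq P ?Q0
           - hellinger_sq ?Q0 (density lborel (\<lambda>x. ennreal (q x))) / 16)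
         + 32 * (\<xi> + 50 * real K * ln (real n))"
      show thesis
      proof (rule that[OF \<Omega>])
        fix X assume X: "X \<in> \<Omega>"
        define a b where "a = 2 / real n + 5 * (3 / real n + real K * (2 / real n ^ 2)) + 20 * h0"
          and "b = 32 * (\<xi> + 50 * real K * L)"
        have "X \<in> space (PiM {..<n} (\<lambda>_. P))" using X \<Omega>(1) sets.sets_into_space by blast
        also have "space (PiM {..<n} (\<lambda>_. P)) = space (PiM {..<n} (\<lambda>_. borel))"
          using real_distributionsD[OF P] by (simp add: space_PiM)
        finally have cl: "Phat X \<in> hellinger_closure
            (distributions_of {q \<in> G. rho_Upsilon n G X q < (INF q'\<in>G. rho_Upsilon n G X q') + 8.24})"
          using est unfolding is_rho_estimator_def G_def \<delta>_def by blast
        then have Phr: "Phat X \<in> real_distributions" by (simp add: hellinger_closure_def)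
        have "hellinger_sq ?Q0 (Phat X) \<le> 32 * a + (32 * b + 144) / real n"
        proof (rule near_minimizer_close_to_reference[OF _ _ _ _ cl])
          show "gaussian_mixture K q" if "q \<in> G" for q
            using that finite_mixture_densities_gaussian_mixture unfolding G_def by blast
          then show "rho_T n X q\<^sub>0 q \<le> real n * (a - hellinger_sq ?Q0 (density lborel (\<lambda>x. ennreal (q x))) / 16) + b"
            if "q \<in> G" for q
            using dev[OF X, of q] that unfolding a_def b_def h0_def L_def by simp
        qed (use q0 n2 in \<open>auto simp: G_def\<close>)
        also have "\<dots> \<le> 640 * h0 + 52208 * E + 1024 * \<xi> / real n"
        proof -
          have "real K * (2 / real n ^ 2) \<le> real n * (2 / real n ^ 2)" using reg(5) by (intro mult_right_mono) auto
          also have "\<dots> = 2 / real n" using n0 by (simp add: power2_eq_square)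
          finally have "a \<le> 27 * (1 / real n) + 20 * h0" unfolding a_def by simp
          then have "a \<le> 27 * E + 20 * h0" using reg(2) by linarith
          moreover have "b / real n \<le> 32 * \<xi> / real n + 1600 * E"
          proof -
            have "b \<le> 32 * \<xi> + 1600 * (E * real n)" unfolding b_def using reg(4) by simp
            then have "b / real n \<le> (32 * \<xi> + 1600 * (E * real n)) / real n" using n0 by (intro divide_right_mono) auto
            then show ?thesis using n0 by (simp add: add_divide_distrib)
          qed
          moreover have "(32 * b + 144) / real n = 32 * (b / real n) + 144 * (1 / real n)"
            by (simp add: add_divide_distrib)
          moreover have "1024 * \<xi> / real n = 32 * (32 * \<xi> / real n)" by simp
          ultimately show ?thesis using reg(2) by linarith
        qed
        finally have h1: "hellinger_sq ?Q0 (Phat X) \<le> 640 * h0 + 52208 * E + 1024 * \<xi> / real n" .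
        have "hellinger_sq P (Phat X) \<le> 2 * h0 + 2 * hellinger_sq ?Q0 (Phat X)"
          unfolding h0_def by (rule hellinger_sq_triangle[OF P Q0r Phr])
        also have "\<dots> \<le> 2 * h0 + 2 * (640 * h0 + 52208 * E + 1024 * \<xi> / real n)"
          by (intro add_left_mono mult_left_mono h1) simp
        also have "\<dots> = 1282 * h0 + 104416 * E + 2048 * \<xi> / real n" by simp
        also have "\<dots> \<le> 1282 * (2 * h + (14 + 4 * V) * E) + 104416 * E + 2048 * \<xi> / real n"
          using h0 by simp
        also have "\<dots> = 2564 * h + (122364 + 5128 * V) * E + 2048 * \<xi> / real n" by (simp add: algebra_simps)
        finally show "hellinger_sq P (Phat X) \<le> 2564 * hellinger_sq_set P ?D
           + (122364 + 5128 * V) * E + 2048 * \<xi> / real n" unfolding h_def .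
      qed
    qed
  qed
qed

theorem theorem3:
  shows "\<exists>C::real. C > 0 \<and> (\<forall>(A::real) (R::real) (n::nat) (F::real measure set) (Pstar::real measure)
             (Phat::(nat \<Rightarrow> real) \<Rightarrow> real measure) (\<xi>::real).
           A > 0 \<longrightarrow> R \<ge> 1 \<longrightarrow>
           real n \<ge> exp (2 * (A / R)\<^sup>2) \<longrightarrow>
           real n / (ln (real n))\<^sup>2 \<ge> 2 * R\<^sup>2 / 27 \<longrightarrow>
           countable_dense_gaussians F \<longrightarrow>
           Pstar \<in> real_distributions \<longrightarrow>
           (let K = mixture_order R n; \<delta> = weight_threshold n K in
              is_rho_estimator n (finite_mixture_densities F K \<delta>) Phat) \<longrightarrow>
           \<xi> > 0 \<longrightarrow>
           measure (PiM {..<n} (\<lambda>_. Pstar))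
             {X \<in> space (PiM {..<n} (\<lambda>_. Pstar)).
                C * hellinger_sq Pstar (Phat X) \<le>
                  hellinger_sq_set Pstar (distributions_of (mixture_densities A R))
                  + (R ^ 4 * (ln (real n)) ^ 3 + \<xi>) / real n}
           \<ge> 1 - exp (- \<xi>))"
proof -
  define V where "V = real (vc_index gaussian_densities)"
  have V: "0 \<le> V" by (simp add: V_def)
  \<comment> \<open>Below \<open>c\<^sub>0\<close> the remainder term satisfies the conditions of the risk bound; above it, the claim is trivial.\<close>
  define c\<^sub>0 where "c\<^sub>0 = min (exp (- 4000) / 8) (1 / (2 * V + 1))"
  define C where "C = min c\<^sub>0 (1 / (122364 + 5128 * V))"
  have C0: "0 < C" and Cc: "C \<le> c\<^sub>0" and C1: "C * (122364 + 5128 * V) \<le> 1"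
  proof -
    show "0 < C" "C \<le> c\<^sub>0" using V by (auto simp: C_def c\<^sub>0_def)
    have "C \<le> 1 / (122364 + 5128 * V)" by (simp add: C_def)
    then show "C * (122364 + 5128 * V) \<le> 1" using V by (simp add: pos_le_divide_eq)
  qed
  show ?thesis
  proof (intro exI[of _ C] conjI allI impI C0)
    fix A R :: real and n :: nat and F :: "real measure set" and P :: "real measure"
      and Phat :: "(nat \<Rightarrow> real) \<Rightarrow> real measure" and \<xi> :: real
    assume A: "A > 0" and R: "R \<ge> 1" and nA: "real n \<ge> exp (2 * (A / R)\<^sup>2)"
      and F: "countable_dense_gaussians F" and P: "P \<in> real_distributions"
      and est: "let K = mixture_order R n; \<delta> = weight_threshold n K in
              is_rho_estimator n (finite_mixture_densities F K \<delta>) Phat"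
      and \<xi>: "\<xi> > 0"
    define h where "h = hellinger_sq_set P (distributions_of (mixture_densities A R))"
    define E where "E = R ^ 4 * (ln (real n)) ^ 3 / real n"
    let ?M = "PiM {..<n} (\<lambda>_. P)"
    interpret M: prob_space ?M by (rule prob_space_PiM) (rule real_distributionsD[OF P])
    have est': "is_rho_estimator n (finite_mixture_densities F (mixture_order R n)
        (weight_threshold n (mixture_order R n))) Phat"
      using est by (simp add: Let_def)
    have n2: "2 \<le> n"
    proof -
      have "0 < 2 * (A / R)\<^sup>2" using A R by simp
      then have "1 < real n" using nA one_less_exp_iff[of "2 * (A / R)\<^sup>2"] by linarith
      then show ?thesis by linarith
    qed
    have n0: "0 < real n" using n2 by simp
    have h0: "0 \<le> h"
      unfolding h_def hellinger_sq_set_def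
      using mixture_densities_nonempty[of A R] A R hellinger_sq_nonneg
      by (intro cINF_greatest) (auto simp: distributions_of_def)
    have sM: "sets ?M = sets (PiM {..<n} (\<lambda>_. borel))"
      using real_distributionsD(3)[OF P] by (intro sets_PiM_cong) auto
    have Phr: "Phat X \<in> real_distributions" if "X \<in> space ?M" for X
      using est' that sets_eq_imp_space_eq[OF sM] unfolding is_rho_estimator_def
      by (auto simp: hellinger_closure_def)
    let ?good = "{X \<in> space ?M. C * hellinger_sq P (Phat X) \<le> h + (R ^ 4 * (ln (real n)) ^ 3 + \<xi>) / real n}"
    have rhs: "(R ^ 4 * (ln (real n)) ^ 3 + \<xi>) / real n = E + \<xi> / real n"
      by (simp add: E_def add_divide_distrib)
    have good_meas: "?good \<in> sets ?M"
    proof -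
      define r where "r = (h + (E + \<xi> / real n)) / C"
      have "Phat \<in> measurable ?M hellinger_borel"
        using est' unfolding is_rho_estimator_def measurable_cong_sets[OF sM refl] by blast
      from measurable_sets[OF this hellinger_sq_measurable[OF P, of r]]
      have "Phat -` {Q \<in> real_distributions. hellinger_sq P Q \<le> r} \<inter> space ?M \<in> sets ?M" .
      also have "Phat -` {Q \<in> real_distributions. hellinger_sq P Q \<le> r} \<inter> space ?M = ?good"
        using Phr C0 unfolding rhs r_def by (auto simp: pos_le_divide_eq mult.commute)
      finally show ?thesis .
    qed
    show "measure ?M {X \<in> space ?M. C * hellinger_sq P (Phat X) \<le>
          hellinger_sq_set P (distributions_of (mixture_densities A R)) + (R ^ 4 * (ln (real n)) ^ 3 + \<xi>) / real n}
        \<ge> 1 - exp (- \<xi>)"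
      unfolding h_def[symmetric]
    proof (cases "E < c\<^sub>0")
      case False
      have "?good = space ?M"
      proof safe
        fix X assume X: "X \<in> space ?M"
        have "C * hellinger_sq P (Phat X) \<le> C * 1"
          using hellinger_sq_le_1[OF P Phr[OF X]] C0 by (intro mult_left_mono) auto
        also have "\<dots> \<le> E" using Cc False by simp
        also have "\<dots> \<le> h + (E + \<xi> / real n)" using h0 \<xi> n0 by simp
        finally show "C * hellinger_sq P (Phat X) \<le> h + (R ^ 4 * (ln (real n)) ^ 3 + \<xi>) / real n"
          unfolding rhs .
      qed
      then show "1 - exp (- \<xi>) \<le> measure ?M ?good" using M.prob_space by simp
    next
      case True
      then have E: "E < exp (- 4000) / 8" "E < 1 / (2 * V + 1)" by (auto simp: c\<^sub>0_def)
      show "1 - exp (- \<xi>) \<le> measure ?M ?good"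
      proof (rule rho_estimator_risk[OF A R nA n2 F P est' E[unfolded E_def V_def], of \<xi>])
        fix \<Omega> assume \<Omega>: "\<Omega> \<in> sets ?M" "1 - exp (- \<xi>) \<le> measure ?M \<Omega>"
          and risk: "\<And>X. X \<in> \<Omega> \<Longrightarrow> hellinger_sq P (Phat X)
            \<le> 2564 * hellinger_sq_set P (distributions_of (mixture_densities A R))
              + (122364 + 5128 * real (vc_index gaussian_densities)) * (R ^ 4 * ln (real n) ^ 3 / real n)
              + 2048 * \<xi> / real n"
        have "\<Omega> \<subseteq> ?good"
        proof
          fix X assume X: "X \<in> \<Omega>"
          have E0: "0 \<le> E" using R n2 by (simp add: E_def)
          have \<xi>n: "0 \<le> \<xi> / real n" using \<xi> n0 by simp
          define D where "D = 122364 + 5128 * V"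
          have D: "2564 \<le> D" "2048 \<le> D" using V by (auto simp: D_def)
          have "hellinger_sq P (Phat X) \<le> 2564 * h + D * E + 2048 * (\<xi> / real n)"
            using risk[OF X] by (simp add: h_def E_def V_def D_def)
          also have "\<dots> \<le> D * h + D * E + D * (\<xi> / real n)"
            using D h0 \<xi>n E0 by (intro add_mono mult_right_mono) auto
          also have "\<dots> = D * (h + (E + \<xi> / real n))" by (simp add: distrib_left)
          finally have "C * hellinger_sq P (Phat X) \<le> C * (D * (h + (E + \<xi> / real n)))"
            using C0 by (intro mult_left_mono) auto
          also have "\<dots> = (C * D) * (h + (E + \<xi> / real n))" by simp
          also have "\<dots> \<le> 1 * (h + (E + \<xi> / real n))"
            using C1 h0 E0 \<xi>n by (intro mult_right_mono add_nonneg_nonneg) (simp_all add: D_def)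
          finally show "X \<in> ?good" using X \<Omega>(1) sets.sets_into_space[of \<Omega> ?M] unfolding rhs by auto
        qed
        then have "measure ?M \<Omega> \<le> measure ?M ?good" using good_meas by (intro M.finite_measure_mono)
        with \<Omega>(2) show "1 - exp (- \<xi>) \<le> measure ?M ?good" by simp
      qed
    qed
  qed
qed

end
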